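(* Let $\nu>-1/2$, let $G_\ell$ ($\ell\in\mathbb R$) be the operator on $L^2(\mathbb R)$ with kernel $e^{-\ell-\xi-\eta}J_\nu(e^{-\ell-\xi-\eta})$, and let $Q_\ell=G_\ell P_+G_\ell$. (i) $Q_\ell$ is an orthogonal projection on $L^2(\mathbb R)$. (ii) The range of $\mathcal F Q_\ell\mathcal F^*$ equals $e^{i\ell x}u_\nu H^2=\{e^{i\ell x}u_\nu(x)f(x):f\in H^2\}$, where $$u_\nu(z)=2^{iz}\frac{\Gamma((1+\nu+iz)/2)}{\Gamma((1+\nu-iz)/2)}$$ is meromorphic, holomorphic on $\{\Im z<0\}$, and unimodular and continuous on $\mathbb R$. (iii) $u_\nu^*H^2\cap H^2=\{0\}$, where $u_\nu^*(z)=\overline{u_\nu(\bar z)}$. Moreover, for $\nu>0$ the subspace $K=(u_\nu\overline{H^2})\cap H^2$ is non-zero and the Hankel operator $\Gamma_{\bar u_\nu}=R_-M_{\bar u_\nu}R_+:H^2\to\overline{H^2}$ restricts to an isometry $K\to\overline{H^2}$.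
   Context: $\Gamma$ is Euler's gamma function; $J_\nu$ the Bessel function of the first kind. $P_+$ is multiplication by the indicator of $(0,\infty)$. $\mathcal Ff(\xi)=(2\pi)^{-1/2}\int e^{-ix\xi}f(x)\,dx$ is the unitary Fourier transform on $L^2(\mathbb R)$. $H^2$ is the Hardy space of the upper half-plane identified with boundary values in $L^2(\mathbb R)$, $\overline{H^2}$ its conjugate; $R_\pm$ are the orthogonal projections onto $H^2$ and $\overline{H^2}$; $M_v$ is multiplication by $v$. *)

theory Defs
  imports "HOL-Complex_Analysis.Complex_Analysis"
begin

definition L2 :: "(real \<Rightarrow> complex) set" where
  "L2 = {f. f \<in> borel_measurable lborel \<and> integrable lborel (\<lambda>x. (cmod (f x))\<^sup>2)}"

definition l2_norm :: "(real \<Rightarrow> complex) \<Rightarrow> real" where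
  "l2_norm f = sqrt (LINT x|lborel. (cmod (f x))\<^sup>2)"

definition l2_inner :: "(real \<Rightarrow> complex) \<Rightarrow> (real \<Rightarrow> complex) \<Rightarrow> complex" where
  "l2_inner f g = (LINT x|lborel. f x * cnj (g x))"

definition aeeq :: "(real \<Rightarrow> complex) \<Rightarrow> (real \<Rightarrow> complex) \<Rightarrow> bool" where
  "aeeq f g \<longleftrightarrow> (AE x in lborel. f x = g x)"

definition fourier_int :: "(real \<Rightarrow> complex) \<Rightarrow> real \<Rightarrow> complex" where
  "fourier_int f \<xi> = (1 / sqrt (2 * pi)) * (LINT x|lborel. exp (- \<i> * of_real (x * \<xi>)) * f x)"

definition fourier_inv_int :: "(real \<Rightarrow> complex) \<Rightarrow> real \<Rightarrow> complex" where
  "fourier_inv_int f x = (1 / sqrt (2 * pi)) * (LINT \<xi>|lborel. exp (\<i> * of_real (x * \<xi>)) * f \<xi>)"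

definition fourier :: "(real \<Rightarrow> complex) \<Rightarrow> real \<Rightarrow> complex" where
  "fourier f = (SOME g. g \<in> L2 \<and>
     (\<lambda>n::nat. l2_norm (\<lambda>\<xi>. fourier_int (\<lambda>x. indicator {- real n..real n} x * f x) \<xi> - g \<xi>))
        \<longlonglongrightarrow> 0)"

definition fourier_inv :: "(real \<Rightarrow> complex) \<Rightarrow> real \<Rightarrow> complex" where
  "fourier_inv f = (SOME g. g \<in> L2 \<and>
     (\<lambda>n::nat. l2_norm (\<lambda>x. fourier_inv_int (\<lambda>\<xi>. indicator {- real n..real n} \<xi> * f \<xi>) x - g x))
        \<longlonglongrightarrow> 0)"

definition H2 :: "(real \<Rightarrow> complex) set" where
  "H2 = {f \<in> L2. \<exists>F. F holomorphic_on {z. Im z > 0} \<and>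
          (\<forall>y>0. (\<lambda>x. F (Complex x y)) \<in> L2) \<and>
          (\<exists>C. \<forall>y>0. l2_norm (\<lambda>x. F (Complex x y)) \<le> C) \<and>
          ((\<lambda>y. l2_norm (\<lambda>x. F (Complex x y) - f x)) \<longlongrightarrow> 0) (at_right 0)}"

definition H2_conj :: "(real \<Rightarrow> complex) set" where
  "H2_conj = {f. (\<lambda>x. cnj (f x)) \<in> H2}"

definition R_plus :: "(real \<Rightarrow> complex) \<Rightarrow> real \<Rightarrow> complex" where
  "R_plus f = (SOME g. g \<in> H2 \<and> (\<forall>h\<in>H2. l2_inner (\<lambda>x. f x - g x) h = 0))"

definition R_minus :: "(real \<Rightarrow> complex) \<Rightarrow> real \<Rightarrow> complex" where
  "R_minus f = (SOME g. g \<in> H2_conj \<and> (\<forall>h\<in>H2_conj. l2_inner (\<lambda>x. f x - g x) h = 0))"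

definition P_plus :: "(real \<Rightarrow> complex) \<Rightarrow> real \<Rightarrow> complex" where
  "P_plus f x = indicator {0<..} x * f x"

text \<open>G is the bounded operator on L^2 with integral kernel k: bounded, linear,
  well defined on a.e.-classes, and given by the (absolutely convergent) kernel
  integral on compactly supported L^2 functions (a dense subspace).\<close>
definition kernel_op :: "(real \<Rightarrow> real \<Rightarrow> complex) \<Rightarrow> ((real \<Rightarrow> complex) \<Rightarrow> real \<Rightarrow> complex) \<Rightarrow> bool" where
  "kernel_op k G \<longleftrightarrow>
     (\<forall>f\<in>L2. G f \<in> L2) \<and>
     (\<forall>f\<in>L2. \<forall>g\<in>L2. aeeq f g \<longrightarrow> aeeq (G f) (G g)) \<and>
     (\<forall>f\<in>L2. \<forall>g\<in>L2. \<forall>a. aeeq (G (\<lambda>x. a * f x + g x)) (\<lambda>x. a * G f x + G g x)) \<and>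
     (\<exists>C. \<forall>f\<in>L2. l2_norm (G f) \<le> C * l2_norm f) \<and>
     (\<forall>f\<in>L2. (\<exists>R. \<forall>x. \<bar>x\<bar> > R \<longrightarrow> f x = 0) \<longrightarrow>
        (AE \<xi> in lborel. integrable lborel (\<lambda>\<eta>. k \<xi> \<eta> * f \<eta>) \<and>
                         G f \<xi> = (LINT \<eta>|lborel. k \<xi> \<eta> * f \<eta>)))"

definition orth_proj :: "((real \<Rightarrow> complex) \<Rightarrow> real \<Rightarrow> complex) \<Rightarrow> bool" where
  "orth_proj Q \<longleftrightarrow>
     (\<forall>f\<in>L2. Q f \<in> L2) \<and>
     (\<forall>f\<in>L2. aeeq (Q (Q f)) (Q f)) \<and>
     (\<forall>f\<in>L2. \<forall>g\<in>L2. l2_inner (Q f) g = l2_inner f (Q g))"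

text \<open>Bessel function of the first kind, J_nu(t) for t > 0 (power series).\<close>
definition besselJ :: "real \<Rightarrow> real \<Rightarrow> real" where
  "besselJ \<nu> t = (\<Sum>m. (-1) ^ m / (fact m * Gamma (real m + \<nu> + 1)) * (t / 2) powr (2 * real m + \<nu>))"

definition G_kernel :: "real \<Rightarrow> real \<Rightarrow> real \<Rightarrow> real \<Rightarrow> complex" where
  "G_kernel \<nu> l \<xi> \<eta> = of_real (exp (- l - \<xi> - \<eta>) * besselJ \<nu> (exp (- l - \<xi> - \<eta>)))"

definition u_nu :: "real \<Rightarrow> complex \<Rightarrow> complex" where
  "u_nu \<nu> z = exp (\<i> * z * of_real (ln 2)) *
      Gamma ((1 + of_real \<nu> + \<i> * z) / 2) / Gamma ((1 + of_real \<nu> - \<i> * z) / 2)"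

definition u_nu_star :: "real \<Rightarrow> complex \<Rightarrow> complex" where
  "u_nu_star \<nu> z = cnj (u_nu \<nu> (cnj z))"

end

(*
  Write k(s) = e^{-s} J_nu(e^{-s}).  On the functions Phi_p(xi) = exp(-(nu+1) xi - p e^{-2 xi}) the kernel
  integral of k(l + xi + eta) can be computed term by term and gives a multiple of Phi_{p'} with
  p' = e^{-2l}/(4p), while the Fourier transform of Phi_p is a Gamma function.  Comparing the two, G_l is
  f |-> m f(-.) on the Fourier side, with the unimodular symbol m(x) = e^{ilx} u_nu(x).  Hence G_l is a
  self-adjoint involution, and (i) and (ii) follow from the Paley-Wiener description of H^2 as the
  transforms of functions supported on the negative half-line.

  For u_nu^* H^2 and H^2, a common element is a function phi on (0, oo) with G_0 phi = 0 on (0, oo).  Expanding k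
  in powers of e^{-2 xi} shows that all moments of phi against e^{-(2m+nu+1) eta} vanish, so phi = 0.

  For nu > 0, let chi have Laplace transform e^{-1/t} (1+t)^{-1-nu} and put
  phi(xi) = s^{1-nu} chi(s^2 - 1) with s = e^{-xi}.  By Euler's integral the transform of phi is
  F(x) / Gamma((1 + nu - ix)/2) with F even and real, so multiplying its conjugate by u_nu reproduces it up to
  the factor 2^{ix}; this is a non-zero element of K.
*)
theory Submission
  imports Defs "HOL-Probability.Probability"
begin

section \<open>Square-integrable functions\<close>

text \<open>The kernel of G_l is not absolutely integrable over the line and grows as its argument
  tends to minus infinity, so boundedness cannot be read off it by size estimates. The operator is
  therefore defined by its symbol, where norm, adjoint and square are immediate, and its kernel is
  identified afterwards by testing against the \<Phi>_p. These suffice: with s = e^{-\<xi>} they are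
  s^{\<nu>+1} e^{-p s^2}, a family permuted by the Hankel transform (Weber's integral), and p = 1,
  2, 3, ... yields all moments in the variable e^{-s^2}. An arbitrary operator with this kernel then
  agrees with the symbol by density of compactly supported functions. The function chi is dictated
  by evenness. With \<tau> = e^{-2\<eta>}, Euler's integral produces the product of
  e^{-(1+\<nu>)\<eta>}, of e^{-\<tau>} (from the shift s^2 - 1) and of the Laplace transform of chi
  at \<tau>; the factors e^{-1/\<tau>} and (1+\<tau>)^{-1-\<nu>} are what makes it even in \<eta>.
  The factor 2^{ix} is harmless, since it translates the support by ln 2 away from the positive
  half-line.\<close>

lemma L2_measurable [measurable_dest]: "f \<in> L2 \<Longrightarrow> f \<in> borel_measurable borel"
  by (simp add: L2_def)

lemma L2_integrable: "f \<in> L2 \<Longrightarrow> integrable lborel (\<lambda>x. (cmod (f x))\<^sup>2)"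
  by (simp add: L2_def)

lemma L2_I:
  "f \<in> borel_measurable borel \<Longrightarrow> integrable lborel (\<lambda>x. (cmod (f x))\<^sup>2) \<Longrightarrow> f \<in> L2"
  by (simp add: L2_def)

lemma L2_dominated:
  assumes "f \<in> borel_measurable borel" "g \<in> L2" "AE x in lborel. cmod (f x) \<le> C * cmod (g x)"
  shows "f \<in> L2"
proof (rule L2_I)
  note [measurable] = assms(1)
  have "integrable lborel (\<lambda>x. C\<^sup>2 * (cmod (g x))\<^sup>2)"
    using L2_integrable[OF assms(2)] by simp
  then show "integrable lborel (\<lambda>x. (cmod (f x))\<^sup>2)"
  proof (rule Bochner_Integration.integrable_bound)
    show "AE x in lborel. norm ((cmod (f x))\<^sup>2) \<le> norm (C\<^sup>2 * (cmod (g x))\<^sup>2)"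
      using assms(3)
    proof eventually_elim
      case (elim x)
      then have "(cmod (f x))\<^sup>2 \<le> (C * cmod (g x))\<^sup>2"
        by (intro power_mono) auto
      then show ?case by (simp add: power_mult_distrib)
    qed
  qed simp
qed fact

lemma L2_mult_bounded:
  assumes "m \<in> borel_measurable borel" "f \<in> L2" "\<And>x. cmod (m x) \<le> C"
  shows "(\<lambda>x. m x * f x) \<in> L2"
  using assms(1,2)
  by (intro L2_dominated[OF _ assms(2), where C = C]) (auto simp: norm_mult assms(3) mult_right_mono)

lemma L2_cmult: "f \<in> L2 \<Longrightarrow> (\<lambda>x. c * f x) \<in> L2"
  by (rule L2_mult_bounded[where C = "cmod c"]) auto

lemma borel_measurable_cnj [measurable]: "cnj \<in> borel_measurable borel"
  by (intro borel_measurable_continuous_onI continuous_intros)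

lemma L2_cnj:
  assumes "f \<in> L2" shows "(\<lambda>x. cnj (f x)) \<in> L2"
proof (rule L2_dominated[where C = 1 and g = f])
  show "(\<lambda>x. cnj (f x)) \<in> borel_measurable borel" using assms by measurable
qed (use assms in auto)

lemma L2_add:
  assumes "f \<in> L2" "g \<in> L2" shows "(\<lambda>x. f x + g x) \<in> L2"
proof (rule L2_I)
  note [measurable] = assms
  have "integrable lborel (\<lambda>x. 2 * (cmod (f x))\<^sup>2 + 2 * (cmod (g x))\<^sup>2)"
    using assms[THEN L2_integrable] by simp
  then show "integrable lborel (\<lambda>x. (cmod (f x + g x))\<^sup>2)"
  proof (rule Bochner_Integration.integrable_bound)
    have "(cmod (f x + g x))\<^sup>2 \<le> 2 * (cmod (f x))\<^sup>2 + 2 * (cmod (g x))\<^sup>2" for x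
    proof -
      have "(cmod (f x + g x))\<^sup>2 \<le> (cmod (f x) + cmod (g x))\<^sup>2"
        by (intro power_mono norm_triangle_ineq) auto
      also have "\<dots> \<le> 2 * (cmod (f x))\<^sup>2 + 2 * (cmod (g x))\<^sup>2"
        using sum_squares_bound[of "cmod (f x)" "cmod (g x)"] by (simp add: power2_sum)
      finally show ?thesis .
    qed
    then show "AE x in lborel. norm ((cmod (f x + g x))\<^sup>2) \<le> norm (2 * (cmod (f x))\<^sup>2 + 2 * (cmod (g x))\<^sup>2)"
      by simp
  qed measurable
qed (use assms in measurable)

lemma L2_uminus: "f \<in> L2 \<Longrightarrow> (\<lambda>x. - f x) \<in> L2"
  using L2_cmult[of f "-1"] by simp

lemma L2_diff: "f \<in> L2 \<Longrightarrow> g \<in> L2 \<Longrightarrow> (\<lambda>x. f x - g x) \<in> L2"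
  using L2_add[OF _ L2_uminus, of f g] by simp

lemma L2_zero: "(\<lambda>x. 0) \<in> L2"
  by (rule L2_I) auto

lemma L2_indicator: "f \<in> L2 \<Longrightarrow> A \<in> sets borel \<Longrightarrow> (\<lambda>x. indicator A x * f x) \<in> L2"
  by (rule L2_mult_bounded[where C = 1]) (auto simp: indicator_def)

lemma L2_reflect:
  assumes "f \<in> L2" shows "(\<lambda>x. f (- x)) \<in> L2"
proof (rule L2_I)
  show "(\<lambda>x. f (- x)) \<in> borel_measurable borel"
    by (rule measurable_compose[OF _ L2_measurable[OF assms]]) simp
  show "integrable lborel (\<lambda>x. (cmod (f (- x)))\<^sup>2)"
    using lborel_integrable_real_affine[OF L2_integrable[OF assms], of "-1" 0] by simp
qed

section \<open>Equality almost everywhere and reflection\<close>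

lemma aeeq_refl [simp]: "aeeq f f"
  by (simp add: aeeq_def)

lemma aeeq_sym: "aeeq f g \<Longrightarrow> aeeq g f"
  unfolding aeeq_def by (elim AE_mp, intro AE_I2) auto

lemma aeeq_trans [trans]: "aeeq f g \<Longrightarrow> aeeq g h \<Longrightarrow> aeeq f h"
  unfolding aeeq_def by (elim AE_mp, intro AE_I2) auto

lemma AE_reflect:
  assumes "AE x::real in lborel. P x" shows "AE x in lborel. P (- x)"
proof -
  have "AE x in distr lborel borel uminus. P x"
    by (subst lborel_distr_uminus) fact
  then show ?thesis by (rule AE_distrD[rotated]) simp
qed

lemma aeeq_reflect: "aeeq f g \<Longrightarrow> aeeq (\<lambda>x. f (- x)) (\<lambda>x. g (- x))"
  unfolding aeeq_def by (rule AE_reflect)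

section \<open>Norm inequalities\<close>

lemma l2_norm_nonneg [simp]: "l2_norm f \<ge> 0"
  by (simp add: l2_norm_def)

lemma l2_norm_power2: "(l2_norm f)\<^sup>2 = (LINT x|lborel. (cmod (f x))\<^sup>2)"
  by (simp add: l2_norm_def)

lemma l2_norm_aeeq:
  assumes "aeeq f g" "f \<in> borel_measurable borel" "g \<in> borel_measurable borel"
  shows "l2_norm f = l2_norm g"
  unfolding l2_norm_def using assms
  by (intro arg_cong[where f = sqrt] integral_cong_AE) (auto simp: aeeq_def)

lemma l2_norm_eq_0:
  assumes "f \<in> L2" "l2_norm f = 0" shows "aeeq f (\<lambda>x. 0)"
proof -
  have "AE x in lborel. (cmod (f x))\<^sup>2 = 0"
    using assms(2) L2_integrable[OF assms(1)]
    by (subst integral_nonneg_eq_0_iff_AE[symmetric]) (auto simp: l2_norm_def)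
  then show ?thesis by (simp add: aeeq_def)
qed

lemma l2_norm_zero [simp]: "l2_norm (\<lambda>x. 0) = 0"
  by (simp add: l2_norm_def)

lemma l2_norm_mono:
  assumes "f \<in> L2" "g \<in> L2" "AE x in lborel. cmod (f x) \<le> cmod (g x)"
  shows "l2_norm f \<le> l2_norm g"
  unfolding l2_norm_def
  using assms(3) by (intro real_sqrt_le_mono integral_mono_AE L2_integrable assms(1,2))
    (auto elim!: eventually_mono intro: power_mono)

lemma l2_norm_cmult: "l2_norm (\<lambda>x. c * f x) = cmod c * l2_norm f"
  by (simp add: l2_norm_def norm_mult power_mult_distrib real_sqrt_mult)

lemma l2_norm_reflect: "l2_norm (\<lambda>x. f (- x)) = l2_norm f"
  using lborel_integral_real_affine[of "-1" "\<lambda>x. (cmod (f x))\<^sup>2" 0]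
  by (simp add: l2_norm_def)

lemma l2_norm_minus: "l2_norm (\<lambda>x. f x - g x) = l2_norm (\<lambda>x. g x - f x)"
  by (simp add: l2_norm_def norm_minus_commute)

lemma L2_mult_integrable:
  assumes "f \<in> L2" "g \<in> L2" shows "integrable lborel (\<lambda>x. f x * g x)"
proof (rule Bochner_Integration.integrable_bound)
  show "integrable lborel (\<lambda>x. (cmod (f x))\<^sup>2 + (cmod (g x))\<^sup>2)"
    using assms[THEN L2_integrable] by simp
  have "cmod (f x) * cmod (g x) \<le> (cmod (f x))\<^sup>2 + (cmod (g x))\<^sup>2" for x
  proof -
    have "2 * cmod (f x) * cmod (g x) \<le> (cmod (f x))\<^sup>2 + (cmod (g x))\<^sup>2"
      by (rule sum_squares_bound)
    moreover have "0 \<le> cmod (f x) * cmod (g x)" by simp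
    ultimately show ?thesis by linarith
  qed
  then show "AE x in lborel. norm (f x * g x) \<le> norm ((cmod (f x))\<^sup>2 + (cmod (g x))\<^sup>2)"
    by (simp add: norm_mult)
qed (use assms in measurable)

text \<open>Weighted arithmetic-geometric mean: with a and b the two norms, |f g| <= b/(2a) |f|^2 +
  a/(2b) |g|^2 integrates to a b. The weights need both norms positive, hence the case split. Having
  |f g| inside the integral, rather than the modulus outside, is what the contour argument uses
  later.\<close>

lemma l2_cauchy_schwarz_abs:
  assumes "f \<in> L2" "g \<in> L2"
  shows "(LINT x|lborel. cmod (f x) * cmod (g x)) \<le> l2_norm f * l2_norm g"
proof -
  note int = assms[THEN L2_integrable]
  have ifg: "integrable lborel (\<lambda>x. cmod (f x) * cmod (g x))"
    using integrable_norm[OF L2_mult_integrable[OF assms]] by (simp add: norm_mult)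
  consider "l2_norm f = 0" | "l2_norm g = 0" | "l2_norm f > 0" "l2_norm g > 0"
    using l2_norm_nonneg[of f] l2_norm_nonneg[of g] by linarith
  then show ?thesis
  proof cases
    case 1
    then have "AE x in lborel. f x = 0" using l2_norm_eq_0[OF assms(1)] by (simp add: aeeq_def)
    then have "(LINT x|lborel. cmod (f x) * cmod (g x)) = (LINT x::real|lborel. 0)"
      using assms by (intro integral_cong_AE) (auto)
    then show ?thesis by simp
  next
    case 2
    then have "AE x in lborel. g x = 0" using l2_norm_eq_0[OF assms(2)] by (simp add: aeeq_def)
    then have "(LINT x|lborel. cmod (f x) * cmod (g x)) = (LINT x::real|lborel. 0)"
      using assms by (intro integral_cong_AE) (auto)
    then show ?thesis by simp
  next
    case 3
    define a b where "a = l2_norm f" and "b = l2_norm g"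
    have ab: "a > 0" "b > 0" using 3 by (auto simp: a_def b_def)
    have "(LINT x|lborel. cmod (f x) * cmod (g x))
        \<le> (LINT x|lborel. b / (2 * a) * (cmod (f x))\<^sup>2 + a / (2 * b) * (cmod (g x))\<^sup>2)"
    proof (intro integral_mono)
      fix x
      have "2 * (b * cmod (f x)) * (a * cmod (g x)) \<le> (b * cmod (f x))\<^sup>2 + (a * cmod (g x))\<^sup>2"
        by (rule sum_squares_bound)
      then show "cmod (f x) * cmod (g x) \<le> b / (2 * a) * (cmod (f x))\<^sup>2 + a / (2 * b) * (cmod (g x))\<^sup>2"
        using ab by (simp add: field_simps power2_eq_square)
    qed (use ifg int in auto)
    also have "\<dots> = b / (2 * a) * a\<^sup>2 + a / (2 * b) * b\<^sup>2"
      using int by (simp add: a_def b_def l2_norm_power2)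
    also have "\<dots> = a * b" using ab by (simp add: power2_eq_square)
    finally show ?thesis by (simp add: a_def b_def)
  qed
qed

lemma l2_cauchy_schwarz:
  assumes "f \<in> L2" "g \<in> L2"
  shows "cmod (LINT x|lborel. f x * g x) \<le> l2_norm f * l2_norm g"
  using integral_norm_bound[of lborel "\<lambda>x. f x * g x"] l2_cauchy_schwarz_abs[OF assms]
  by (simp add: norm_mult)

lemma l2_norm_triangle:
  assumes "f \<in> L2" "g \<in> L2"
  shows "l2_norm (\<lambda>x. f x + g x) \<le> l2_norm f + l2_norm g"
proof -
  note int = assms[THEN L2_integrable] L2_add[OF assms, THEN L2_integrable]
  have ifg: "integrable lborel (\<lambda>x. cmod (f x) * cmod (g x))"
    using integrable_norm[OF L2_mult_integrable[OF assms]] by (simp add: norm_mult)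
  have "(l2_norm (\<lambda>x. f x + g x))\<^sup>2 \<le>
      (LINT x|lborel. (cmod (f x))\<^sup>2 + 2 * (cmod (f x) * cmod (g x)) + (cmod (g x))\<^sup>2)"
    unfolding l2_norm_power2
  proof (intro integral_mono)
    fix x
    have "(cmod (f x + g x))\<^sup>2 \<le> (cmod (f x) + cmod (g x))\<^sup>2"
      by (intro power_mono norm_triangle_ineq) auto
    then show "(cmod (f x + g x))\<^sup>2 \<le> (cmod (f x))\<^sup>2 + 2 * (cmod (f x) * cmod (g x)) + (cmod (g x))\<^sup>2"
      by (simp add: power2_sum)
  qed (use int ifg in auto)
  also have "\<dots> = (l2_norm f)\<^sup>2 + 2 * (LINT x|lborel. cmod (f x) * cmod (g x)) + (l2_norm g)\<^sup>2"
    using int ifg by (simp add: l2_norm_power2)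
  also have "\<dots> \<le> (l2_norm f + l2_norm g)\<^sup>2"
    using l2_cauchy_schwarz_abs[OF assms] by (simp add: power2_sum)
  finally show ?thesis by (rule power2_le_imp_le) simp
qed

lemma l2_norm_triangle_diff:
  assumes "f \<in> L2" "g \<in> L2" "h \<in> L2"
  shows "l2_norm (\<lambda>x. f x - h x) \<le> l2_norm (\<lambda>x. f x - g x) + l2_norm (\<lambda>x. g x - h x)"
  using l2_norm_triangle[OF L2_diff[OF assms(1,2)] L2_diff[OF assms(2,3)]] by simp

section \<open>Limits in norm\<close>

lemma l2_norm_le_add_diff:
  assumes "f \<in> L2" "g \<in> L2"
  shows "l2_norm f \<le> l2_norm g + l2_norm (\<lambda>x. f x - g x)"
  using l2_norm_triangle[OF assms(2) L2_diff[OF assms]] by simp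

text \<open>Splitting X Y - f g as (X - f) Y + f (Y - g) reduces the claim to Cauchy-Schwarz. The
  filter is arbitrary and membership only eventual, because both truncations along n and slices F(x
  + i y) with y tending to 0 from the right are fed into it.\<close>

lemma l2_pairing_tendsto:
  assumes "eventually (\<lambda>n. X n \<in> L2) F" "f \<in> L2" "eventually (\<lambda>n. Y n \<in> L2) F" "g \<in> L2"
    and X: "((\<lambda>n. l2_norm (\<lambda>x. X n x - f x)) \<longlongrightarrow> 0) F"
    and Y: "((\<lambda>n. l2_norm (\<lambda>x. Y n x - g x)) \<longlongrightarrow> 0) F"
  shows "((\<lambda>n. LINT x|lborel. X n x * Y n x) \<longlongrightarrow> (LINT x|lborel. f x * g x)) F"
proof (rule Lim_null[THEN iffD2], rule Lim_null_comparison)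
  let ?d = "\<lambda>n. l2_norm (\<lambda>x. X n x - f x)" and ?e = "\<lambda>n. l2_norm (\<lambda>x. Y n x - g x)"
  show "((\<lambda>n. ?d n * (l2_norm g + ?e n) + l2_norm f * ?e n) \<longlongrightarrow> 0) F"
    using X Y by (auto intro!: tendsto_eq_intros)
  show "\<forall>\<^sub>F n in F. norm ((LINT x|lborel. X n x * Y n x) - (LINT x|lborel. f x * g x))
      \<le> ?d n * (l2_norm g + ?e n) + l2_norm f * ?e n"
    using assms(1,3)
  proof eventually_elim
    case (elim n)
    have "(LINT x|lborel. X n x * Y n x) - (LINT x|lborel. f x * g x) =
       (LINT x|lborel. X n x * Y n x - f x * g x)"
      using elim assms(2,4) by (intro Bochner_Integration.integral_diff[symmetric] L2_mult_integrable)
    also have "\<dots> = (LINT x|lborel. (X n x - f x) * Y n x + f x * (Y n x - g x))"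
      by (intro Bochner_Integration.integral_cong refl) (simp add: algebra_simps)
    also have "\<dots> = (LINT x|lborel. (X n x - f x) * Y n x) + (LINT x|lborel. f x * (Y n x - g x))"
      using elim assms(2,4)
      by (intro Bochner_Integration.integral_add L2_mult_integrable L2_diff)
    also have "cmod \<dots> \<le> ?d n * l2_norm (Y n) + l2_norm f * ?e n"
      using elim assms(2,4)
      by (intro norm_triangle_le add_mono l2_cauchy_schwarz L2_diff) auto
    also have "\<dots> \<le> ?d n * (l2_norm g + ?e n) + l2_norm f * ?e n"
      using elim assms(2,4) by (intro add_mono mult_left_mono l2_norm_le_add_diff) auto
    finally show ?case .
  qed
qed

lemma l2_limit_unique:
  assumes "eventually (\<lambda>n. X n \<in> L2) F" "f \<in> L2" "g \<in> L2" "F \<noteq> bot"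
    and X: "((\<lambda>n. l2_norm (\<lambda>x. X n x - f x)) \<longlongrightarrow> 0) F"
    and Y: "((\<lambda>n. l2_norm (\<lambda>x. X n x - g x)) \<longlongrightarrow> 0) F"
  shows "aeeq f g"
proof -
  have "((\<lambda>n. l2_norm (\<lambda>x. X n x - f x) + l2_norm (\<lambda>x. X n x - g x)) \<longlongrightarrow> 0) F"
    using tendsto_add[OF X Y] by simp
  then have "l2_norm (\<lambda>x. f x - g x) \<le> 0"
  proof (rule tendsto_lowerbound)
    show "\<forall>\<^sub>F n in F. l2_norm (\<lambda>x. f x - g x) \<le> l2_norm (\<lambda>x. X n x - f x) + l2_norm (\<lambda>x. X n x - g x)"
      using assms(1)
    proof eventually_elim
      case (elim n)
      show ?case
        using l2_norm_triangle_diff[OF assms(2) elim assms(3)] l2_norm_minus[of f "X n"] by simp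
    qed
  qed fact
  then have "l2_norm (\<lambda>x. f x - g x) = 0" using l2_norm_nonneg[of "\<lambda>x. f x - g x"] by linarith
  from l2_norm_eq_0[OF L2_diff[OF assms(2,3)] this] show ?thesis
    by (simp add: aeeq_def)
qed

text \<open>Dominated convergence is sequential, so the limit at 0 from the right is tested along
  sequences decreasing to 0. The bound holds only eventually, which is why such a sequence is used
  from an index N on.\<close>

lemma l2_dominated_convergence:
  fixes X :: "real \<Rightarrow> real \<Rightarrow> complex"
  assumes [measurable]: "\<And>t. X t \<in> borel_measurable borel" "f \<in> borel_measurable borel"
    and g: "g \<in> L2"
    and bound: "eventually (\<lambda>t. AE x in lborel. cmod (X t x - f x) \<le> C * cmod (g x)) (at_right 0)"
    and lim: "AE x in lborel. ((\<lambda>t. X t x) \<longlongrightarrow> f x) (at_right 0)"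
  shows "((\<lambda>t. l2_norm (\<lambda>x. X t x - f x)) \<longlongrightarrow> 0) (at_right 0)"
proof (rule tendsto_at_right_sequentially[of 0 1])
  fix S :: "nat \<Rightarrow> real"
  assume S: "\<And>n. 0 < S n" "\<And>n. S n < 1" "decseq S" "S \<longlonglongrightarrow> 0"
  have Sf: "filterlim S (at_right 0) sequentially"
    using S by (auto simp: filterlim_at intro!: always_eventually) (metis less_irrefl)
  have ev: "eventually (\<lambda>n. AE x in lborel. cmod (X (S n) x - f x) \<le> C * cmod (g x)) sequentially"
    using filterlim_iff[THEN iffD1, OF Sf, rule_format, OF bound] by simp
  then obtain N where N: "\<And>n. n \<ge> N \<Longrightarrow> AE x in lborel. cmod (X (S n) x - f x) \<le> C * cmod (g x)"
    by (auto simp: eventually_sequentially)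
  have "(\<lambda>n. LINT x|lborel. (cmod (X (S (n + N)) x - f x))\<^sup>2) \<longlonglongrightarrow> (LINT x::real|lborel. (0::real))"
  proof (rule integral_dominated_convergence[where w = "\<lambda>x. C\<^sup>2 * (cmod (g x))\<^sup>2"])
    show "integrable lborel (\<lambda>x. C\<^sup>2 * (cmod (g x))\<^sup>2)"
      using L2_integrable[OF g] by simp
    show "AE x in lborel. (\<lambda>n. (cmod (X (S (n + N)) x - f x))\<^sup>2) \<longlonglongrightarrow> 0"
      using lim
    proof eventually_elim
      case (elim x)
      have "(\<lambda>n. X (S n) x) \<longlonglongrightarrow> f x"
        using filterlim_compose[OF elim Sf] .
      then have "(\<lambda>n. X (S (n + N)) x) \<longlonglongrightarrow> f x" by (rule LIMSEQ_ignore_initial_segment)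
      then have "(\<lambda>n. X (S (n + N)) x - f x) \<longlonglongrightarrow> 0" by (simp add: LIM_zero)
      then have "(\<lambda>n. (cmod (X (S (n + N)) x - f x))\<^sup>2) \<longlonglongrightarrow> (cmod 0)\<^sup>2"
        by (intro tendsto_intros)
      then show ?case by simp
    qed
    show "AE x in lborel. norm ((cmod (X (S (n + N)) x - f x))\<^sup>2) \<le> C\<^sup>2 * (cmod (g x))\<^sup>2" for n
      using N[OF le_add2]
      by eventually_elim (auto simp: power_mult_distrib[symmetric] intro!: power_mono)
  qed auto
  then have "(\<lambda>n. sqrt (LINT x|lborel. (cmod (X (S (n + N)) x - f x))\<^sup>2)) \<longlonglongrightarrow> sqrt 0"
    by (intro tendsto_real_sqrt) simp
  then have "(\<lambda>n. l2_norm (\<lambda>x. X (S (n + N)) x - f x)) \<longlonglongrightarrow> 0"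
    by (simp add: l2_norm_def)
  then show "(\<lambda>n. l2_norm (\<lambda>x. X (S n) x - f x)) \<longlonglongrightarrow> 0"
    by (rule LIMSEQ_offset)
qed simp

lemma L2_truncate_tendsto:
  assumes "f \<in> L2"
  shows "(\<lambda>n. l2_norm (\<lambda>x. indicator {- real n..real n} x * f x - f x)) \<longlonglongrightarrow> 0"
proof -
  note [measurable] = assms
  have "(\<lambda>n. LINT x|lborel. (cmod (indicator {- real n..real n} x * f x - f x))\<^sup>2) \<longlonglongrightarrow> (LINT x::real|lborel. (0::real))"
  proof (rule integral_dominated_convergence[where w = "\<lambda>x. (cmod (f x))\<^sup>2"])
    show "integrable lborel (\<lambda>x. (cmod (f x))\<^sup>2)" using L2_integrable[OF assms] .
    show "AE x in lborel. (\<lambda>n. (cmod (indicator {- real n..real n} x * f x - f x))\<^sup>2) \<longlonglongrightarrow> 0"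
    proof (intro AE_I2 tendsto_eventually)
      fix x :: real
      obtain N where N: "\<bar>x\<bar> \<le> real N" using real_arch_simple by blast
      show "\<forall>\<^sub>F n in sequentially. (cmod (indicator {- real n..real n} x * f x - f x))\<^sup>2 = 0"
        using eventually_ge_at_top[of N] by eventually_elim (use N in \<open>auto simp: indicator_def\<close>)
    qed
    show "AE x in lborel. norm ((cmod (indicator {- real n..real n} x * f x - f x))\<^sup>2) \<le> (cmod (f x))\<^sup>2" for n
      by (auto simp: indicator_def)
  qed measurable
  then have "(\<lambda>n. sqrt (LINT x|lborel. (cmod (indicator {- real n..real n} x * f x - f x))\<^sup>2)) \<longlonglongrightarrow> sqrt 0"
    by (intro tendsto_real_sqrt) simp
  then show ?thesis by (simp add: l2_norm_def)
qed

text \<open>Riesz-Fischer: a subsequence with geometrically small gaps converges almost everywhere,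
  and Fatou's lemma makes its pointwise limit the limit in norm of the whole sequence. This is the
  source of existence for the Fourier transform.\<close>

lemma L2_complete:
  fixes X :: "nat \<Rightarrow> real \<Rightarrow> complex"
  assumes X: "\<And>n. X n \<in> L2"
    and Cauchy: "\<And>e. e > 0 \<Longrightarrow> \<exists>N. \<forall>m\<ge>N. \<forall>n\<ge>N. l2_norm (\<lambda>x. X m x - X n x) < e"
  shows "\<exists>g\<in>L2. (\<lambda>n. l2_norm (\<lambda>x. X n x - g x)) \<longlonglongrightarrow> 0"
proof -
  note [measurable] = X
  have "\<exists>N. \<forall>k. \<forall>m\<ge>N k. \<forall>n\<ge>N k. l2_norm (\<lambda>x. X m x - X n x) < (1/4::real)^k"
    by (rule choice) (use Cauchy in auto)
  then obtain N where N: "\<And>k m n. m \<ge> N k \<Longrightarrow> n \<ge> N k \<Longrightarrow> l2_norm (\<lambda>x. X m x - X n x) < (1/4::real)^k"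
    by blast
  \<comment> \<open>Partial sums of the thresholds are nondecreasing, so \<open>r j\<close> lies
    beyond \<open>N k\<close> whenever j >= k.\<close>
  define r where "r k = (\<Sum>i\<le>k. N i)" for k
  have rN: "r j \<ge> N k" if "j \<ge> k" for j k
    unfolding r_def using that by (intro member_le_sum) auto
  \<comment> \<open>The integral of \<open>d k\<close> is at most 16^{-k}. The weight 4^k keeps the
    total finite and forces d k x <= C 4^{-k} for almost every x, so the gaps are summable
    there.\<close>
  define d where "d k x = (cmod (X (r (Suc k)) x - X (r k) x))\<^sup>2" for k x
  have [measurable]: "d k \<in> borel_measurable borel" for k
    unfolding d_def by measurable
  have "(\<integral>\<^sup>+x. (\<Sum>k. ennreal (4^k * d k x)) \<partial>lborel) = (\<Sum>k. \<integral>\<^sup>+x. ennreal (4^k * d k x) \<partial>lborel)"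
    by (rule nn_integral_suminf) measurable
  also have "\<dots> \<le> (\<Sum>k. ennreal ((1/4)^k))"
  proof (rule suminf_le)
    fix k
    have int: "integrable lborel (d k)"
      unfolding d_def by (intro L2_integrable L2_diff X)
    have "(\<integral>\<^sup>+x. ennreal (4^k * d k x) \<partial>lborel) = ennreal (LINT x|lborel. 4^k * d k x)"
      using int by (intro nn_integral_eq_integral) (auto simp: d_def[abs_def])
    also have "(LINT x|lborel. 4^k * d k x) = 4^k * (l2_norm (\<lambda>x. X (r (Suc k)) x - X (r k) x))\<^sup>2"
      by (simp add: l2_norm_power2 d_def)
    also have "\<dots> \<le> 4^k * ((1/4)^k)\<^sup>2"
      using N[of k "r (Suc k)" "r k"] rN[of k "Suc k"] rN[of k k]
      by (intro mult_left_mono power_mono) auto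
    also have "\<dots> = (1/4)^k"
      by (simp add: power2_eq_square power_divide)
    finally show "(\<integral>\<^sup>+x. ennreal (4^k * d k x) \<partial>lborel) \<le> ennreal ((1/4)^k)"
      by (simp add: ennreal_leI)
  qed auto
  also have "\<dots> < \<infinity>"
    by (subst suminf_ennreal2) (auto intro: summable_geometric)
  finally have "AE x in lborel. (\<Sum>k. ennreal (4^k * d k x)) \<noteq> \<infinity>"
    by (intro nn_integral_PInf_AE) auto
  then have conv: "AE x in lborel. convergent (\<lambda>k. X (r k) x)"
  proof eventually_elim
    case (elim x)
    then obtain C where C: "C \<ge> 0" "(\<Sum>k. ennreal (4^k * d k x)) = ennreal C"
      by (cases "\<Sum>k. ennreal (4^k * d k x)") auto
    have bound: "cmod (X (r (Suc k)) x - X (r k) x) \<le> sqrt C * (1/2)^k" for k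
    proof -
      have "ennreal (4^k * d k x) \<le> (\<Sum>k. ennreal (4^k * d k x))"
        using sum_le_suminf[of "\<lambda>k. ennreal (4^k * d k x)" "{k}"] by auto
      then have "4^k * d k x \<le> C" using C by simp
      then have "d k x \<le> C * (1/4)^k" by (simp add: field_simps power_divide)
      then have "sqrt (d k x) \<le> sqrt (C * (1/4)^k)" by simp
      also have "\<dots> = sqrt C * (1/2)^k"
        by (simp add: real_sqrt_mult real_sqrt_power real_sqrt_divide)
      finally show ?thesis by (simp add: d_def)
    qed
    have "summable (\<lambda>k. X (r (Suc k)) x - X (r k) x)"
      by (rule summable_comparison_test[where g = "\<lambda>k. sqrt C * (1/2)^k"])
        (auto intro!: exI[of _ 0] bound summable_mult summable_geometric)
    then have "convergent (\<lambda>n. \<Sum>k<n. X (r (Suc k)) x - X (r k) x)"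
      by (simp add: summable_iff_convergent)
    then have "convergent (\<lambda>n. X (r n) x - X (r 0) x)"
      using sum_lessThan_telescope[of "\<lambda>k. X (r k) x"] by simp
    then show ?case
      by (simp add: convergent_diff_const_right_iff)
  qed
  define g where "g x = lim (\<lambda>k. X (r k) x)" for x
  have [measurable]: "g \<in> borel_measurable borel"
    unfolding g_def by measurable
  have lim: "AE x in lborel. (\<lambda>k. X (r k) x) \<longlonglongrightarrow> g x"
    using conv by eventually_elim (simp add: g_def convergent_LIMSEQ_iff)
  have fatou: "(\<integral>\<^sup>+x. ennreal ((cmod (X n x - g x))\<^sup>2) \<partial>lborel) \<le> ennreal (((1/4)^k)\<^sup>2)" if "n \<ge> N k" for n k
  proof -
    have "(\<integral>\<^sup>+x. ennreal ((cmod (X n x - g x))\<^sup>2) \<partial>lborel)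
        = (\<integral>\<^sup>+x. liminf (\<lambda>j. ennreal ((cmod (X n x - X (r j) x))\<^sup>2)) \<partial>lborel)"
    proof (rule nn_integral_cong_AE)
      show "AE x in lborel. ennreal ((cmod (X n x - g x))\<^sup>2) = liminf (\<lambda>j. ennreal ((cmod (X n x - X (r j) x))\<^sup>2))"
        using lim
      proof eventually_elim
        case (elim x)
        have "(\<lambda>j. ennreal ((cmod (X n x - X (r j) x))\<^sup>2)) \<longlonglongrightarrow> ennreal ((cmod (X n x - g x))\<^sup>2)"
          by (intro tendsto_intros elim)
        then show ?case by (intro lim_imp_Liminf[symmetric]) auto
      qed
    qed
    also have "\<dots> \<le> liminf (\<lambda>j. \<integral>\<^sup>+x. ennreal ((cmod (X n x - X (r j) x))\<^sup>2) \<partial>lborel)"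
      by (rule nn_integral_liminf) measurable
    also have "\<dots> \<le> liminf (\<lambda>j. ennreal (((1/4)^k)\<^sup>2))"
    proof (rule Liminf_mono)
      show "\<forall>\<^sub>F j in sequentially. (\<integral>\<^sup>+x. ennreal ((cmod (X n x - X (r j) x))\<^sup>2) \<partial>lborel) \<le> ennreal (((1/4)^k)\<^sup>2)"
        using eventually_ge_at_top[of k]
      proof eventually_elim
        case (elim j)
        have "(\<integral>\<^sup>+x. ennreal ((cmod (X n x - X (r j) x))\<^sup>2) \<partial>lborel) = ennreal ((l2_norm (\<lambda>x. X n x - X (r j) x))\<^sup>2)"
          unfolding l2_norm_power2 by (intro nn_integral_eq_integral L2_integrable L2_diff X) auto
        also have "\<dots> \<le> ennreal (((1/4)^k)\<^sup>2)"
          using N[OF that rN[OF elim]] by (intro ennreal_leI power_mono) auto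
        finally show ?case .
      qed
    qed
    also have "\<dots> = ennreal (((1/4)^k)\<^sup>2)" by (simp add: Liminf_const)
    finally show ?thesis .
  qed
  have Xg: "(\<lambda>x. X n x - g x) \<in> L2" if "n \<ge> N k" for n k
    using fatou[OF that] by (intro L2_I integrableI_nonneg) (auto simp: less_top[symmetric] top_unique)
  have "g \<in> L2"
    using L2_diff[OF X[of "N 0"] Xg[of 0 "N 0"]] by simp
  moreover have "(\<lambda>n. l2_norm (\<lambda>x. X n x - g x)) \<longlonglongrightarrow> 0"
  proof (rule LIMSEQ_I)
    fix e :: real assume "e > 0"
    then obtain k where k: "(1/4::real)^k < e"
      using real_arch_pow_inv[of e "1/4"] by auto
    have "norm (l2_norm (\<lambda>x. X n x - g x) - 0) < e" if "n \<ge> N k" for n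
    proof -
      have "ennreal ((l2_norm (\<lambda>x. X n x - g x))\<^sup>2) \<le> ennreal (((1/4)^k)\<^sup>2)"
        using fatou[OF that] Xg[OF that, THEN L2_integrable]
        by (simp add: l2_norm_power2 nn_integral_eq_integral)
      then have "(l2_norm (\<lambda>x. X n x - g x))\<^sup>2 \<le> ((1/4)^k)\<^sup>2" by simp
      then have "l2_norm (\<lambda>x. X n x - g x) \<le> (1/4)^k" by (rule power2_le_imp_le) simp
      then show ?thesis using k by simp
    qed
    then show "\<exists>no. \<forall>n\<ge>no. norm (l2_norm (\<lambda>x. X n x - g x) - 0) < e" by blast
  qed
  ultimately show ?thesis by blast
qed

section \<open>Uniqueness of characteristic functions\<close>

text \<open>The positive and the negative part of w have equal mass; normalized, they are
  probability measures whose images under \<theta> share their characteristic function. Levy's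
  uniqueness theorem equates the images, and pushing forward by \<rho> returns to the densities. The
  change of variable \<theta> lets the same argument serve Fourier integrals and moments.\<close>

lemma char_zero_imp_AE_zero_real:
  fixes w \<theta> \<rho> :: "real \<Rightarrow> real"
  assumes w: "integrable lborel w"
    and [measurable]: "\<theta> \<in> borel_measurable borel" "\<rho> \<in> borel_measurable borel"
    and inv: "\<And>x. w x \<noteq> 0 \<Longrightarrow> \<rho> (\<theta> x) = x"
    and zero: "\<And>a::real. (LINT x|lborel. complex_of_real (w x) * exp (\<i> * of_real (a * \<theta> x))) = 0"
  shows "AE x in lborel. w x = 0"
proof -
  have [measurable]: "w \<in> borel_measurable borel" using w by auto
  define p where "p x = max 0 (w x)" for x
  define n where "n x = max 0 (- w x)" for x
  have pn: "w x = p x - n x" "p x \<ge> 0" "n x \<ge> 0" for x by (auto simp: p_def n_def)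
  have [measurable]: "p \<in> borel_measurable borel" "n \<in> borel_measurable borel"
    unfolding p_def n_def by measurable
  have ip: "integrable lborel p" and "in": "integrable lborel n"
    using w by (auto simp: p_def n_def intro!: Bochner_Integration.integrable_bound[OF w])
  have int_exp: "integrable lborel (\<lambda>x. complex_of_real (q x) * exp (\<i> * of_real (a * \<theta> x)))"
    if "integrable lborel q" for q :: "real \<Rightarrow> real" and a
    using that by (intro Bochner_Integration.integrable_bound[OF that]) (auto simp: norm_mult)
  have eq: "(LINT x|lborel. complex_of_real (p x) * exp (\<i> * of_real (a * \<theta> x)))
      = (LINT x|lborel. complex_of_real (n x) * exp (\<i> * of_real (a * \<theta> x)))" for a :: real
  proof -
    have "(LINT x|lborel. complex_of_real (p x) * exp (\<i> * of_real (a * \<theta> x)))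
      - (LINT x|lborel. complex_of_real (n x) * exp (\<i> * of_real (a * \<theta> x)))
      = (LINT x|lborel. complex_of_real (p x) * exp (\<i> * of_real (a * \<theta> x)) - complex_of_real (n x) * exp (\<i> * of_real (a * \<theta> x)))"
      by (intro Bochner_Integration.integral_diff[symmetric] int_exp ip "in")
    also have "\<dots> = (LINT x|lborel. complex_of_real (w x) * exp (\<i> * of_real (a * \<theta> x)))"
      by (intro Bochner_Integration.integral_cong refl) (simp add: pn(1) algebra_simps)
    finally show ?thesis by (simp only: zero right_minus_eq)
  qed
  define c where "c = (LINT x|lborel. p x)"
  \<comment> \<open>Frequency a = 0: the two masses agree.\<close>
  have c': "(LINT x|lborel. n x) = c"
    using eq[of 0] by (simp add: c_def)
  have c_nonneg: "c \<ge> 0" by (simp add: c_def pn)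
  show ?thesis
  proof (cases "c = 0")
    case True
    then have "AE x in lborel. p x = 0" "AE x in lborel. n x = 0"
      using integral_nonneg_eq_0_iff_AE[OF ip] integral_nonneg_eq_0_iff_AE[OF "in"] c' pn
      by (auto simp: c_def)
    then show ?thesis by eventually_elim (simp add: pn)
  next
    case False
    then have c: "c > 0" using c_nonneg by simp
    define P where "P q = density lborel (\<lambda>x. ennreal (q x / c))" for q :: "real \<Rightarrow> real"
    have P: "prob_space (P q)" if "integrable lborel q" "\<And>x. q x \<ge> 0" "(LINT x|lborel. q x) = c" for q
    proof
      have "emeasure (P q) (space (P q)) = (\<integral>\<^sup>+x. ennreal (q x / c) \<partial>lborel)"
        unfolding P_def using that(1) by (subst emeasure_density) auto
      also have "\<dots> = ennreal (LINT x|lborel. q x / c)"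
        using that c by (intro nn_integral_eq_integral) auto
      also have "\<dots> = 1" using that c by simp
      finally show "emeasure (P q) (space (P q)) = 1" .
    qed
    have char: "char (distr (P q) borel \<theta>) a = (LINT x|lborel. complex_of_real (q x) * exp (\<i> * of_real (a * \<theta> x))) / c"
      if [measurable]: "q \<in> borel_measurable borel" and "\<And>x. q x \<ge> 0" for q a
    proof -
      have "char (distr (P q) borel \<theta>) a = (LINT x|P q. iexp (a * \<theta> x))"
        unfolding char_def by (subst integral_distr) (auto simp: P_def)
      also have "\<dots> = (LINT x|lborel. (q x / c) *\<^sub>R iexp (a * \<theta> x))"
        unfolding P_def using c that by (subst integral_density) auto
      also have "\<dots> = (LINT x|lborel. (complex_of_real (q x) * exp (\<i> * of_real (a * \<theta> x))) / c)"
        by (intro Bochner_Integration.integral_cong refl) (simp add: scaleR_conv_of_real)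
      finally show ?thesis by simp
    qed
    interpret Pp: prob_space "P p" by (rule P) (auto simp: ip pn c_def)
    interpret Pn: prob_space "P n" by (rule P) (auto simp: "in" pn c')
    have "distr (P p) borel \<theta> = distr (P n) borel \<theta>"
    proof (rule Levy_uniqueness)
      show "char (distr (P p) borel \<theta>) = char (distr (P n) borel \<theta>)"
      proof (rule ext)
        fix a
        show "char (distr (P p) borel \<theta>) a = char (distr (P n) borel \<theta>) a"
          by (subst (1 2) char) (simp_all only: pn eq, auto)
      qed
      show "real_distribution (distr (P p) borel \<theta>)"
        by (rule Pp.real_distribution_distr) (simp add: P_def)
      show "real_distribution (distr (P n) borel \<theta>)"
        by (rule Pn.real_distribution_distr) (simp add: P_def)
    qed
    then have eq2: "distr (distr (P p) borel \<theta>) borel \<rho> = distr (distr (P n) borel \<theta>) borel \<rho>"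
      by simp
    have inv2: "distr (distr (P q) borel \<theta>) borel \<rho> = P q"
      if [measurable]: "q \<in> borel_measurable borel" and "\<And>x. q x \<noteq> 0 \<Longrightarrow> w x \<noteq> 0" for q
    proof -
      have "distr (distr (P q) borel \<theta>) borel \<rho> = distr (P q) borel (\<rho> \<circ> \<theta>)"
        by (rule distr_distr) (auto simp: P_def)
      also have "\<dots> = distr (P q) (P q) (\<lambda>x. x)"
      proof (rule distr_cong_AE)
        show "AE x in P q. (\<rho> \<circ> \<theta>) x = x"
          unfolding P_def
        proof (subst AE_density)
          show "AE x in lborel. 0 < ennreal (q x / c) \<longrightarrow> (\<rho> \<circ> \<theta>) x = x"
          proof (intro AE_I2 impI)
            fix x assume "0 < ennreal (q x / c)"
            then have "q x \<noteq> 0" by auto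
            then show "(\<rho> \<circ> \<theta>) x = x" using that(2) inv by simp
          qed
        qed simp
      qed (auto simp: P_def)
      also have "\<dots> = P q" by (rule distr_id)
      finally show ?thesis .
    qed
    have "distr (distr (P p) borel \<theta>) borel \<rho> = P p" "distr (distr (P n) borel \<theta>) borel \<rho> = P n"
      by (auto intro!: inv2 simp: p_def n_def max_def split: if_splits)
    with eq2 have "P p = P n" by simp
    then have "AE x in lborel. ennreal (p x / c) = ennreal (n x / c)"
      unfolding P_def by (intro sigma_finite_measure.density_unique[OF sigma_finite_lborel]) auto
    then show ?thesis
      by eventually_elim (use c in \<open>auto simp: pn\<close>)
  qed
qed

text \<open>Conjugating the hypothesis at -a shows that \<open>cnj w\<close> satisfies it too, hence
  so do the real and the imaginary part.\<close>

lemma char_zero_imp_AE_zero: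
  fixes w :: "real \<Rightarrow> complex" and \<theta> \<rho> :: "real \<Rightarrow> real"
  assumes w: "integrable lborel w"
    and [measurable]: "\<theta> \<in> borel_measurable borel" "\<rho> \<in> borel_measurable borel"
    and inv: "\<And>x. w x \<noteq> 0 \<Longrightarrow> \<rho> (\<theta> x) = x"
    and zero: "\<And>a::real. (LINT x|lborel. w x * exp (\<i> * of_real (a * \<theta> x))) = 0"
  shows "AE x in lborel. w x = 0"
proof -
  have [measurable]: "w \<in> borel_measurable borel" using w by auto
  have int: "integrable lborel (\<lambda>x. w x * exp (\<i> * of_real (a * \<theta> x)))" for a :: real
    by (rule Bochner_Integration.integrable_bound[OF w]) (auto simp: norm_mult)
  have int': "integrable lborel (\<lambda>x. cnj (w x) * exp (\<i> * of_real (a * \<theta> x)))" for a :: real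
    by (rule Bochner_Integration.integrable_bound[OF w]) (auto simp: norm_mult)
  have zero': "(LINT x|lborel. cnj (w x) * exp (\<i> * of_real (a * \<theta> x))) = 0" for a :: real
  proof -
    have "cnj (LINT x|lborel. w x * exp (\<i> * of_real (- a * \<theta> x))) =
       (LINT x|lborel. cnj (w x * exp (\<i> * of_real (- a * \<theta> x))))"
      by (simp only: Bochner_Integration.integral_cnj)
    also have "\<dots> = (LINT x|lborel. cnj (w x) * exp (\<i> * of_real (a * \<theta> x)))"
      by (intro Bochner_Integration.integral_cong refl) (simp add: exp_cnj)
    finally show ?thesis using zero[of "-a"] by simp
  qed
  have "AE x in lborel. Re (w x) = 0"
  proof (rule char_zero_imp_AE_zero_real)
    fix a :: real
    have "(LINT x|lborel. complex_of_real (Re (w x)) * exp (\<i> * of_real (a * \<theta> x))) =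
       (LINT x|lborel. (w x * exp (\<i> * of_real (a * \<theta> x)) + cnj (w x) * exp (\<i> * of_real (a * \<theta> x))) / 2)"
      by (intro Bochner_Integration.integral_cong refl)
        (simp add: ring_distribs(2)[symmetric] complex_add_cnj)
    then show "(LINT x|lborel. complex_of_real (Re (w x)) * exp (\<i> * of_real (a * \<theta> x))) = 0"
      using int int' zero zero' by simp
  next
    show "Re (w x) \<noteq> 0 \<Longrightarrow> \<rho> (\<theta> x) = x" for x by (rule inv) auto
  qed (use w in simp_all)
  moreover have "AE x in lborel. Im (w x) = 0"
  proof (rule char_zero_imp_AE_zero_real)
    fix a :: real
    have "(LINT x|lborel. complex_of_real (Im (w x)) * exp (\<i> * of_real (a * \<theta> x))) =
       (LINT x|lborel. (w x * exp (\<i> * of_real (a * \<theta> x)) - cnj (w x) * exp (\<i> * of_real (a * \<theta> x))) / (2 * \<i>))"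
      by (intro Bochner_Integration.integral_cong refl)
        (simp add: left_diff_distrib[symmetric] complex_diff_cnj field_simps)
    then show "(LINT x|lborel. complex_of_real (Im (w x)) * exp (\<i> * of_real (a * \<theta> x))) = 0"
      using int int' zero zero' by simp
  next
    show "Im (w x) \<noteq> 0 \<Longrightarrow> \<rho> (\<theta> x) = x" for x by (rule inv) auto
  qed (use w in simp_all)
  ultimately show ?thesis by eventually_elim (simp add: complex_eq_iff)
qed

text \<open>As |\<theta>| <= 1 where w is nonzero, the series of exp(i a \<theta>) may be integrated
  term by term, with majorant |w| |a|^m / m!. Vanishing moments thus give a vanishing characteristic
  function. Both the identification of the kernel and the trivial intersection end in such a moment
  problem.\<close>

lemma moments_zero_imp_AE_zero:
  fixes w :: "real \<Rightarrow> complex" and \<theta> \<rho> :: "real \<Rightarrow> real"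
  assumes w: "integrable lborel w"
    and [measurable]: "\<theta> \<in> borel_measurable borel" "\<rho> \<in> borel_measurable borel"
    and inv: "\<And>x. w x \<noteq> 0 \<Longrightarrow> \<rho> (\<theta> x) = x"
    and bound: "\<And>x. w x \<noteq> 0 \<Longrightarrow> \<bar>\<theta> x\<bar> \<le> 1"
    and zero: "\<And>m. (LINT x|lborel. w x * of_real (\<theta> x ^ m)) = 0"
  shows "AE x in lborel. w x = 0"
proof (rule char_zero_imp_AE_zero[OF w])
  have [measurable]: "w \<in> borel_measurable borel" using w by auto
  fix a :: real
  define t where "t m x = w x * ((\<i> * of_real (a * \<theta> x)) ^ m /\<^sub>R fact m)" for m x
  have t_eq: "t m x = (\<i> * of_real a) ^ m / fact m * (w x * of_real (\<theta> x ^ m))" for m x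
    by (simp add: t_def scaleR_conv_of_real power_mult_distrib field_simps)
  have bnd: "norm (t m x) \<le> norm (w x) * (\<bar>a\<bar> ^ m / fact m)" for m x
  proof (cases "w x = 0")
    case False
    have "\<bar>\<theta> x\<bar> ^ m \<le> 1" using bound[OF False] by (simp add: power_le_one)
    then have "(\<bar>a\<bar> * \<bar>\<theta> x\<bar>) ^ m \<le> \<bar>a\<bar> ^ m" by (simp add: power_mult_distrib mult_left_le)
    then show ?thesis
      by (simp add: t_def norm_mult norm_power abs_mult field_simps mult_left_mono)
  qed (simp add: t_def)
  have [measurable]: "t m \<in> borel_measurable borel" for m unfolding t_def by measurable
  have int: "integrable lborel (t m)" for m
    by (rule Bochner_Integration.integrable_bound[where f = "\<lambda>x. norm (w x) * (\<bar>a\<bar> ^ m / fact m)"])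
      (use w bnd in \<open>auto simp: abs_mult\<close>)
  have sums: "(\<lambda>m. t m x) sums (w x * exp (\<i> * of_real (a * \<theta> x)))" for x
    unfolding t_def by (intro sums_mult exp_converges)
  have se: "summable (\<lambda>m. \<bar>a\<bar> ^ m / fact m)"
    using summable_exp[of "\<bar>a\<bar>"] by (simp add: field_simps)
  have "(LINT x|lborel. w x * exp (\<i> * of_real (a * \<theta> x))) = (LINT x|lborel. (\<Sum>m. t m x))"
    using sums by (simp add: sums_iff)
  also have "\<dots> = (\<Sum>m. LINT x|lborel. t m x)"
  proof (rule integral_suminf[OF int])
    show "AE x in lborel. summable (\<lambda>m. norm (t m x))"
      by (intro AE_I2 summable_comparison_test'[OF summable_mult[OF se]]) (use bnd in auto)
    have "(LINT x|lborel. norm (t m x)) \<le> (LINT x|lborel. norm (w x)) * (\<bar>a\<bar> ^ m / fact m)" for m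
    proof -
      have "(LINT x|lborel. norm (t m x)) \<le> (LINT x|lborel. norm (w x) * (\<bar>a\<bar> ^ m / fact m))"
        using int w bnd by (intro integral_mono) auto
      then show ?thesis by simp
    qed
    then show "summable (\<lambda>m. LINT x|lborel. norm (t m x))"
      by (intro summable_comparison_test'[OF summable_mult[OF se, of "LINT x|lborel. norm (w x)"]]) auto
  qed
  also have "\<dots> = 0" unfolding t_eq using zero by (simp del: of_real_power)
  finally show "(LINT x|lborel. w x * exp (\<i> * of_real (a * \<theta> x))) = 0" .
qed (fact assms inv)+

lemma fourier_zero_imp_AE_zero:
  fixes w :: "real \<Rightarrow> complex"
  assumes "integrable lborel w"
    and "\<And>a::real. (LINT x|lborel. w x * exp (\<i> * of_real (a * x))) = 0"
  shows "AE x in lborel. w x = 0"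
  by (rule char_zero_imp_AE_zero[where \<theta> = "\<lambda>x. x" and \<rho> = "\<lambda>x. x"]) (use assms in auto)

section \<open>The Fourier transform on square-integrable functions\<close>

text \<open>A Gaussian centred at a with frequency b. Up to a phase the transform maps the pair (a,
  b) to (b, -a), so the family is closed under it; for a = 0 and b varying, pairings with it are
  Fourier integrals against a fixed positive weight and therefore separate functions.\<close>

definition gaussian :: "real \<Rightarrow> real \<Rightarrow> real \<Rightarrow> complex" where
  "gaussian a b x = of_real (exp (- (x - a)\<^sup>2 / 2)) * exp (\<i> * of_real (b * x))"

lemma gaussian_measurable [measurable]: "gaussian a b \<in> borel_measurable borel"
  unfolding gaussian_def by measurable

lemma norm_gaussian: "cmod (gaussian a b x) = sqrt (2 * pi) * normal_density a 1 x"
  by (simp add: gaussian_def norm_mult normal_density_def)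

lemma integrable_gaussian: "integrable lborel (gaussian a b)"
proof (rule Bochner_Integration.integrable_bound)
  show "integrable lborel (\<lambda>x. sqrt (2 * pi) * normal_density a 1 x)"
    by (intro integrable_mult_right integrable_normal_density) simp
qed (auto simp: norm_gaussian)

lemma L2_gaussian: "gaussian a b \<in> L2"
proof (rule L2_I)
  show "integrable lborel (\<lambda>x. (cmod (gaussian a b x))\<^sup>2)"
  proof (rule Bochner_Integration.integrable_bound[OF integrable_norm[OF integrable_gaussian[of a b]]])
    have "cmod (gaussian a b x) \<le> 1" for x by (simp add: gaussian_def norm_mult)
    then show "AE x in lborel. norm ((cmod (gaussian a b x))\<^sup>2) \<le> norm (cmod (gaussian a b x))"
      by (auto simp: power2_eq_square intro!: AE_I2 mult_left_le)
  qed measurable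
qed measurable

lemma gaussian_reflect: "gaussian 0 b (- x) = gaussian 0 (- b) x" "gaussian a 0 (- x) = gaussian (- a) 0 x"
  by (auto simp: gaussian_def power2_eq_square algebra_simps)

lemma cnj_gaussian: "cnj (gaussian a b x) = gaussian a (- b) x"
  by (simp add: gaussian_def exp_cnj)

section \<open>The transform on integrable functions\<close>

lemma fourier_int_measurable [measurable]:
  assumes [measurable]: "f \<in> borel_measurable borel"
  shows "fourier_int f \<in> borel_measurable borel"
  unfolding fourier_int_def by measurable

lemma fourier_integrand_integrable:
  assumes "integrable lborel f"
  shows "integrable lborel (\<lambda>x. exp (- \<i> * of_real (x * \<xi>)) * f x)"
  by (rule Bochner_Integration.integrable_bound[OF assms]) (use assms in \<open>auto simp: norm_mult\<close>)

lemma fourier_int_bound: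
  "cmod (fourier_int f \<xi>) \<le> (LINT x|lborel. cmod (f x)) / sqrt (2 * pi)"
proof -
  have "cmod (LINT x|lborel. exp (- \<i> * of_real (x * \<xi>)) * f x) \<le> (LINT x|lborel. cmod (exp (- \<i> * of_real (x * \<xi>)) * f x))"
    by (rule integral_norm_bound)
  also have "\<dots> = (LINT x|lborel. cmod (f x))" by (simp add: norm_mult)
  finally show ?thesis
    by (simp add: fourier_int_def norm_mult norm_divide divide_right_mono)
qed

lemma fourier_int_diff:
  assumes "integrable lborel f" "integrable lborel g"
  shows "fourier_int (\<lambda>x. f x - g x) \<xi> = fourier_int f \<xi> - fourier_int g \<xi>"
proof -
  have "(LINT x|lborel. exp (- \<i> * of_real (x * \<xi>)) * (f x - g x)) =
     (LINT x|lborel. exp (- \<i> * of_real (x * \<xi>)) * f x) - (LINT x|lborel. exp (- \<i> * of_real (x * \<xi>)) * g x)"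
    unfolding right_diff_distrib
    by (intro Bochner_Integration.integral_diff fourier_integrand_integrable assms)
  then show ?thesis by (simp only: fourier_int_def right_diff_distrib)
qed

text \<open>Translating the centre to 0 leaves the characteristic function of the standard normal
  distribution at b - \<xi>.\<close>

lemma fourier_int_gaussian:
  "fourier_int (gaussian a b) \<xi> = exp (\<i> * of_real (a * b)) * gaussian b (- a) \<xi>"
proof -
  let ?t = "b - \<xi>"
  have "(LINT x|lborel. exp (- \<i> * of_real (x * \<xi>)) * gaussian a b x) =
     (LINT x|lborel. exp (- \<i> * of_real ((a + x) * \<xi>)) * gaussian a b (a + x))"
    using lborel_integral_real_affine[of 1 "\<lambda>x. exp (- \<i> * of_real (x * \<xi>)) * gaussian a b x" a] by simp
  also have "\<dots> = (LINT x|lborel. (sqrt (2 * pi) * exp (\<i> * of_real (a * ?t))) * (std_normal_density x *\<^sub>R iexp (?t * x)))"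
    by (intro Bochner_Integration.integral_cong refl)
       (simp add: gaussian_def std_normal_density_def scaleR_conv_of_real algebra_simps exp_add[symmetric] exp_of_real[symmetric] real_sqrt_mult del: exp_of_real)
  also have "\<dots> = (sqrt (2 * pi) * exp (\<i> * of_real (a * ?t))) * (LINT x|lborel. std_normal_density x *\<^sub>R iexp (?t * x))"
    by (rule integral_mult_right_zero)
  also have "(LINT x|lborel. std_normal_density x *\<^sub>R iexp (?t * x)) = char std_normal_distribution ?t"
    unfolding char_def by (subst integral_density) auto
  also have "\<dots> = exp (- (?t^2) / 2)" by (simp add: char_std_normal_distribution)
  finally have "fourier_int (gaussian a b) \<xi> = exp (\<i> * of_real (a * ?t)) * exp (- (?t^2) / 2)"
    by (simp add: fourier_int_def)
  also have "\<dots> = exp (\<i> * of_real (a * b)) * gaussian b (- a) \<xi>"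
    by (simp add: gaussian_def algebra_simps exp_add[symmetric] power2_commute)
  finally show ?thesis .
qed

lemma fourier_int_gaussian_0:
  "fourier_int (gaussian 0 b) = gaussian b 0" "fourier_int (gaussian a 0) = gaussian 0 (- a)"
  by (simp_all add: fourier_int_gaussian fun_eq_iff)

text \<open>Both sides are iterated integrals of exp(-i x \<xi>) f(x) g(\<xi>), which is absolutely
  integrable over the plane.\<close>

lemma fourier_int_pairing:
  assumes f: "integrable lborel f" and g: "integrable lborel g"
  shows "(LINT \<xi>|lborel. fourier_int f \<xi> * g \<xi>) = (LINT x|lborel. f x * fourier_int g x)"
proof -
  have [measurable]: "f \<in> borel_measurable borel" "g \<in> borel_measurable borel"
    using f g by auto
  define h where "h x \<xi> = exp (- \<i> * of_real (x * \<xi>)) * f x * g \<xi>" for x \<xi> :: real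
  have int: "integrable (lborel \<Otimes>\<^sub>M lborel) (case_prod h)"
  proof (rule lborel_pair.Fubini_integrable)
    show "case_prod h \<in> borel_measurable (lborel \<Otimes>\<^sub>M lborel)" unfolding h_def by measurable
    have "(LINT \<xi>|lborel. norm (case_prod h (x, \<xi>))) = norm (f x) * (LINT \<xi>|lborel. norm (g \<xi>))" for x
      by (simp add: h_def norm_mult)
    then show "integrable lborel (\<lambda>x. LINT \<xi>|lborel. norm (case_prod h (x, \<xi>)))"
      using f by simp
    show "AE x in lborel. integrable lborel (\<lambda>\<xi>. case_prod h (x, \<xi>))"
    proof (rule AE_I2)
      fix x :: real
      have "integrable lborel (\<lambda>\<xi>. norm (f x) * norm (g \<xi>))" using g by simp
      then show "integrable lborel (\<lambda>\<xi>. case_prod h (x, \<xi>))"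
        by (rule Bochner_Integration.integrable_bound) (auto simp: h_def norm_mult)
    qed
  qed
  have "(LINT \<xi>|lborel. fourier_int f \<xi> * g \<xi>) = (LINT \<xi>|lborel. (1 / sqrt (2 * pi)) * (LINT x|lborel. h x \<xi>))"
    by (intro Bochner_Integration.integral_cong refl) (simp add: h_def fourier_int_def)
  also have "\<dots> = (1 / sqrt (2 * pi)) * (LINT \<xi>|lborel. LINT x|lborel. h x \<xi>)"
    by (rule integral_mult_right_zero)
  also have "(LINT \<xi>|lborel. LINT x|lborel. h x \<xi>) = (LINT x|lborel. LINT \<xi>|lborel. h x \<xi>)"
    by (rule lborel_pair.Fubini_integral[OF int])
  also have "(1 / sqrt (2 * pi)) * (LINT x|lborel. LINT \<xi>|lborel. h x \<xi>) = (LINT x|lborel. (1 / sqrt (2 * pi)) * (LINT \<xi>|lborel. h x \<xi>))"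
    by (rule integral_mult_right_zero[symmetric])
  also have "\<dots> = (LINT x|lborel. f x * fourier_int g x)"
  proof (intro Bochner_Integration.integral_cong refl)
    fix x
    have "(LINT \<xi>|lborel. h x \<xi>) = f x * (LINT \<xi>|lborel. exp (- \<i> * of_real (\<xi> * x)) * g \<xi>)"
      unfolding integral_mult_right_zero[symmetric]
      by (intro Bochner_Integration.integral_cong refl) (simp add: h_def mult_ac)
    then show "(1 / sqrt (2 * pi)) * (LINT \<xi>|lborel. h x \<xi>) = f x * fourier_int g x"
      by (simp add: fourier_int_def)
  qed
  finally show ?thesis .
qed

text \<open>Schur test: the kernel is symmetric with total mass 1 in either variable, and |f(x)|
  |f(y)| is at most the mean of the two squares.\<close>

lemma normal_density_pairing_le:
  assumes f: "f \<in> L2" and s: "s > 0"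
  shows "(\<integral>\<^sup>+x. \<integral>\<^sup>+y. ennreal (cmod (f x) * cmod (f y) * normal_density x s y) \<partial>lborel \<partial>lborel)
     \<le> ennreal ((l2_norm f)\<^sup>2)"
proof -
  let ?N = "normal_density"
  have [measurable]: "f \<in> borel_measurable borel" using f by (rule L2_measurable)
  have sym: "?N x s y = ?N y s x" for x y by (simp add: normal_density_def power2_commute)
  have N1: "(\<integral>\<^sup>+y. ennreal (?N x s y) \<partial>lborel) = 1" for x
    using s by (subst nn_integral_eq_integral) (auto simp: integrable_normal_density integral_normal_density)
  have nf: "(\<integral>\<^sup>+x. ennreal ((cmod (f x))\<^sup>2) \<partial>lborel) = ennreal ((l2_norm f)\<^sup>2)"
    unfolding l2_norm_power2 by (intro nn_integral_eq_integral L2_integrable f) auto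
  have A: "(\<integral>\<^sup>+x. \<integral>\<^sup>+y. ennreal ((cmod (f x))\<^sup>2 * ?N x s y) \<partial>lborel \<partial>lborel) = ennreal ((l2_norm f)\<^sup>2)"
    by (simp add: ennreal_mult nn_integral_cmult N1 nf)
  have B: "(\<integral>\<^sup>+x. \<integral>\<^sup>+y. ennreal ((cmod (f y))\<^sup>2 * ?N x s y) \<partial>lborel \<partial>lborel) = ennreal ((l2_norm f)\<^sup>2)"
  proof -
    have "(\<integral>\<^sup>+x. \<integral>\<^sup>+y. ennreal ((cmod (f y))\<^sup>2 * ?N x s y) \<partial>lborel \<partial>lborel) =
      (\<integral>\<^sup>+y. \<integral>\<^sup>+x. ennreal ((cmod (f y))\<^sup>2 * ?N x s y) \<partial>lborel \<partial>lborel)"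
      by (rule lborel_pair.Fubini') (unfold normal_density_def, measurable)
    also have "\<dots> = (\<integral>\<^sup>+x. \<integral>\<^sup>+y. ennreal ((cmod (f x))\<^sup>2 * ?N x s y) \<partial>lborel \<partial>lborel)"
      by (subst sym) simp
    finally show ?thesis using A by simp
  qed
  have "(\<integral>\<^sup>+x. \<integral>\<^sup>+y. ennreal (cmod (f x) * cmod (f y) * ?N x s y) \<partial>lborel \<partial>lborel)
    \<le> (\<integral>\<^sup>+x. \<integral>\<^sup>+y. ennreal (1/2) * (ennreal ((cmod (f x))\<^sup>2 * ?N x s y) + ennreal ((cmod (f y))\<^sup>2 * ?N x s y)) \<partial>lborel \<partial>lborel)"
  proof (intro nn_integral_mono)
    fix x y
    have "2 * cmod (f x) * cmod (f y) \<le> (cmod (f x))\<^sup>2 + (cmod (f y))\<^sup>2" by (rule sum_squares_bound)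
    then have "cmod (f x) * cmod (f y) \<le> 1/2 * ((cmod (f x))\<^sup>2 + (cmod (f y))\<^sup>2)" by simp
    then have "cmod (f x) * cmod (f y) * ?N x s y \<le> 1/2 * ((cmod (f x))\<^sup>2 + (cmod (f y))\<^sup>2) * ?N x s y"
      by (intro mult_right_mono) auto
    then show "ennreal (cmod (f x) * cmod (f y) * ?N x s y) \<le>
       ennreal (1/2) * (ennreal ((cmod (f x))\<^sup>2 * ?N x s y) + ennreal ((cmod (f y))\<^sup>2 * ?N x s y))"
      by (subst ennreal_plus[symmetric], simp, simp, subst ennreal_mult[symmetric], simp, simp, intro ennreal_leI)
        (simp add: algebra_simps)
  qed
  also have "\<dots> = ennreal (1/2) * ((\<integral>\<^sup>+x. \<integral>\<^sup>+y. ennreal ((cmod (f x))\<^sup>2 * ?N x s y) \<partial>lborel \<partial>lborel) +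
      (\<integral>\<^sup>+x. \<integral>\<^sup>+y. ennreal ((cmod (f y))\<^sup>2 * ?N x s y) \<partial>lborel \<partial>lborel))"
    unfolding normal_density_def by (simp add: nn_integral_cmult nn_integral_add)
  also have "\<dots> = ennreal (1/2) * ennreal ((l2_norm f)\<^sup>2 + (l2_norm f)\<^sup>2)"
    unfolding A B by (subst ennreal_plus) auto
  also have "\<dots> = ennreal ((l2_norm f)\<^sup>2)"
    by (subst ennreal_mult[symmetric]) auto
  finally show ?thesis .
qed

text \<open>A Gaussian of width 1/s is turned into a normal density of standard deviation s centred
  at x, an approximate identity as s tends to 0.\<close>

lemma fourier_int_weighted_gaussian:
  assumes s: "s > 0"
  shows "integrable lborel (\<lambda>\<xi>. of_real (exp (- (s * \<xi>)\<^sup>2 / 2)) * exp (\<i> * of_real (x * \<xi>)))" (is "integrable lborel ?g")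
    and "fourier_int (\<lambda>\<xi>. of_real (exp (- (s * \<xi>)\<^sup>2 / 2)) * exp (\<i> * of_real (x * \<xi>))) y
       = of_real (sqrt (2 * pi) * normal_density x s y)"
proof -
  have g: "?g \<xi> = gaussian 0 (x / s) (s * \<xi>)" for \<xi>
    using s by (simp add: gaussian_def)
  show "integrable lborel ?g"
    unfolding g using lborel_integrable_real_affine[OF integrable_gaussian[of 0 "x/s"], of s 0] s by simp
  have "(LINT \<xi>|lborel. exp (- \<i> * of_real (\<xi> * (y / s))) * gaussian 0 (x / s) \<xi>) =
     of_real s * (LINT \<xi>|lborel. exp (- \<i> * of_real (s * \<xi> * (y / s))) * gaussian 0 (x / s) (s * \<xi>))"
    using lborel_integral_real_affine[of s "\<lambda>\<xi>. exp (- \<i> * of_real (\<xi> * (y / s))) * gaussian 0 (x / s) \<xi>" 0] s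
    by (simp add: scaleR_conv_of_real)
  also have "(LINT \<xi>|lborel. exp (- \<i> * of_real (s * \<xi> * (y / s))) * gaussian 0 (x / s) (s * \<xi>)) =
     (LINT \<xi>|lborel. exp (- \<i> * of_real (\<xi> * y)) * ?g \<xi>)"
    unfolding g using s by (intro Bochner_Integration.integral_cong refl) (simp add: field_simps)
  finally have "fourier_int (gaussian 0 (x/s)) (y / s) = of_real s * fourier_int ?g y"
    unfolding fourier_int_def by simp
  then have "fourier_int ?g y = gaussian (x / s) 0 (y / s) / of_real s"
    using s by (simp add: fourier_int_gaussian_0)
  also have "\<dots> = of_real (sqrt (2 * pi) * normal_density x s y)"
    using s by (simp add: gaussian_def normal_density_def real_sqrt_mult diff_divide_distrib[symmetric] power_divide field_simps)
  finally show "fourier_int ?g y = of_real (sqrt (2 * pi) * normal_density x s y)" .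
qed

text \<open>A priori the transform F of f is merely bounded, so its square is integrated against a
  Gaussian weight W first. Writing |F|^2 W as F h with h = conj(F) W and moving the transform from f
  to h leaves a double integral of f and conj f against a normal density, which the Schur bound
  controls uniformly in s.\<close>

lemma fourier_int_weighted_norm_le:
  assumes f: "f \<in> L2" and fi: "integrable lborel f" and s: "s > 0"
  shows "(\<integral>\<^sup>+\<xi>. ennreal ((cmod (fourier_int f \<xi>))\<^sup>2 * exp (- (s * \<xi>)\<^sup>2 / 2)) \<partial>lborel) \<le> ennreal ((l2_norm f)\<^sup>2)"
proof -
  note [measurable] = f
  let ?F = "fourier_int f" and ?W = "\<lambda>\<xi>. exp (- (s * \<xi>)\<^sup>2 / 2)"
  let ?N = "normal_density"
  define B where "B = (LINT x|lborel. cmod (f x)) / sqrt (2 * pi)"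
  have B: "cmod (?F \<xi>) \<le> B" for \<xi> unfolding B_def by (rule fourier_int_bound)
  have iW: "integrable lborel (\<lambda>\<xi>. complex_of_real (?W \<xi>))"
    using fourier_int_weighted_gaussian(1)[OF s, of 0] by simp
  define h where "h \<xi> = cnj (?F \<xi>) * of_real (?W \<xi>)" for \<xi>
  have [measurable]: "h \<in> borel_measurable borel" unfolding h_def by measurable
  have ih: "integrable lborel h"
  proof (rule Bochner_Integration.integrable_bound)
    show "integrable lborel (\<lambda>\<xi>. B *\<^sub>R complex_of_real (?W \<xi>))" using iW by (intro integrable_scaleR_right) auto
    show "AE \<xi> in lborel. norm (h \<xi>) \<le> norm (B *\<^sub>R complex_of_real (?W \<xi>))"
      using B order_trans[OF B abs_ge_self] by (auto simp: h_def norm_mult intro!: mult_right_mono)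
  qed measurable
  \<comment> \<open>A second use of the pairing formula: the transform of h is conj f smoothed by a
    normal density.\<close>
  have hF: "fourier_int h x = (LINT y|lborel. cnj (f y) * of_real (?N x s y))" for x
  proof -
    let ?g = "\<lambda>\<xi>. complex_of_real (?W \<xi>) * exp (\<i> * of_real (x * \<xi>))"
    have "fourier_int h x = cnj ((1 / sqrt (2 * pi)) * (LINT \<xi>|lborel. ?F \<xi> * ?g \<xi>))"
      unfolding fourier_int_def[of h] complex_cnj_mult Bochner_Integration.integral_cnj[symmetric]
      by (simp add: h_def exp_cnj mult_ac)
    also have "(LINT \<xi>|lborel. ?F \<xi> * ?g \<xi>) = (LINT y|lborel. f y * fourier_int ?g y)"
      by (rule fourier_int_pairing[OF fi fourier_int_weighted_gaussian(1)[OF s]])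
    also have "\<dots> = (LINT y|lborel. sqrt (2 * pi) * (f y * of_real (?N x s y)))"
      unfolding fourier_int_weighted_gaussian(2)[OF s]
      by (intro Bochner_Integration.integral_cong refl) simp
    also have "\<dots> = sqrt (2 * pi) * (LINT y|lborel. f y * of_real (?N x s y))"
      by (rule integral_mult_right_zero)
    finally have "fourier_int h x = cnj (LINT y|lborel. f y * of_real (?N x s y))" by simp
    then show ?thesis unfolding Bochner_Integration.integral_cnj[symmetric] by simp
  qed
  have Fh: "?F \<xi> * h \<xi> = of_real ((cmod (?F \<xi>))\<^sup>2 * ?W \<xi>)" for \<xi>
    by (simp only: h_def of_real_mult complex_norm_square mult.assoc)
  have int: "integrable lborel (\<lambda>\<xi>. (cmod (?F \<xi>))\<^sup>2 * ?W \<xi>)"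
  proof -
    have "integrable lborel (\<lambda>\<xi>. ?F \<xi> * h \<xi>)"
    proof (rule Bochner_Integration.integrable_bound)
      show "integrable lborel (\<lambda>\<xi>. B *\<^sub>R h \<xi>)" using ih by simp
      show "AE \<xi> in lborel. norm (?F \<xi> * h \<xi>) \<le> norm (B *\<^sub>R h \<xi>)"
        using order_trans[OF B abs_ge_self] by (auto simp: norm_mult intro!: mult_right_mono)
    qed measurable
    then show ?thesis unfolding Fh complex_of_real_integrable_eq .
  qed
  have "(\<integral>\<^sup>+\<xi>. ennreal ((cmod (?F \<xi>))\<^sup>2 * ?W \<xi>) \<partial>lborel) = ennreal (LINT \<xi>|lborel. (cmod (?F \<xi>))\<^sup>2 * ?W \<xi>)"
    using int by (intro nn_integral_eq_integral) auto
  also have "(LINT \<xi>|lborel. (cmod (?F \<xi>))\<^sup>2 * ?W \<xi>) = cmod (LINT \<xi>|lborel. complex_of_real ((cmod (?F \<xi>))\<^sup>2 * ?W \<xi>))"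
    by (simp only: integral_complex_of_real norm_of_real) simp
  also have "(LINT \<xi>|lborel. complex_of_real ((cmod (?F \<xi>))\<^sup>2 * ?W \<xi>)) = (LINT x|lborel. f x * fourier_int h x)"
    unfolding Fh[symmetric] by (rule fourier_int_pairing[OF fi ih])
  also have "ennreal (cmod \<dots>) \<le> (\<integral>\<^sup>+x. ennreal (cmod (f x * fourier_int h x)) \<partial>lborel)"
  proof (rule integral_norm_bound_ennreal)
    define H where "H = (LINT x|lborel. cmod (h x)) / sqrt (2 * pi)"
    have H: "cmod (fourier_int h x) \<le> \<bar>H\<bar>" for x
      unfolding H_def by (rule order_trans[OF fourier_int_bound abs_ge_self])
    show "integrable lborel (\<lambda>x. f x * fourier_int h x)"
    proof (rule Bochner_Integration.integrable_bound)
      show "integrable lborel (\<lambda>x. f x * of_real H)" using fi by simp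
      show "AE x in lborel. norm (f x * fourier_int h x) \<le> norm (f x * of_real H)"
        using H by (auto simp: norm_mult intro!: mult_left_mono)
    qed measurable
  qed
  also have "\<dots> \<le> (\<integral>\<^sup>+x. \<integral>\<^sup>+y. ennreal (cmod (f x) * cmod (f y) * ?N x s y) \<partial>lborel \<partial>lborel)"
  proof (rule nn_integral_mono)
    fix x
    have "ennreal (cmod (f x * fourier_int h x)) = ennreal (cmod (f x)) * ennreal (cmod (LINT y|lborel. cnj (f y) * of_real (?N x s y)))"
      by (simp add: hF norm_mult ennreal_mult)
    also have "ennreal (cmod (LINT y|lborel. cnj (f y) * of_real (?N x s y))) \<le> (\<integral>\<^sup>+y. ennreal (cmod (cnj (f y) * of_real (?N x s y))) \<partial>lborel)"
    proof (rule integral_norm_bound_ennreal, rule Bochner_Integration.integrable_bound[where f = "\<lambda>y. f y * of_real (?N x s x)"])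
      have "?N x s y \<le> ?N x s x" for y
        using s by (simp add: normal_density_def divide_right_mono)
      then show "AE y in lborel. norm (cnj (f y) * complex_of_real (?N x s y)) \<le> norm (f y * complex_of_real (?N x s x))"
        by (auto simp: norm_mult intro!: mult_left_mono)
      show "(\<lambda>y. cnj (f y) * complex_of_real (?N x s y)) \<in> borel_measurable lborel"
        unfolding normal_density_def by measurable
    qed (use fi in auto)
    also have "ennreal (cmod (f x)) * (\<integral>\<^sup>+y. ennreal (cmod (cnj (f y) * of_real (?N x s y))) \<partial>lborel)
       = (\<integral>\<^sup>+y. ennreal (cmod (f x) * cmod (f y) * ?N x s y) \<partial>lborel)"
    proof -
      have "cmod (cnj (f y) * of_real (?N x s y)) = cmod (f y) * ?N x s y" for y
        by (simp add: norm_mult)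
      then show ?thesis
        by (simp only: ennreal_mult' norm_ge_zero mult.assoc) (simp add: nn_integral_cmult)
    qed
    finally show "ennreal (cmod (f x * fourier_int h x)) \<le> (\<integral>\<^sup>+y. ennreal (cmod (f x) * cmod (f y) * ?N x s y) \<partial>lborel)"
      by (simp add: mult_left_mono)
  qed
  also have "\<dots> \<le> ennreal ((l2_norm f)\<^sup>2)" by (rule normal_density_pairing_le[OF f s])
  finally show ?thesis .
qed

text \<open>Fatou's lemma along s = 1/(n+1) removes the weight. Only a contraction is obtained here;
  the isometry follows once the square of the transform is known to be the reflection.\<close>

lemma fourier_int_L2:
  assumes f: "f \<in> L2" and fi: "integrable lborel f"
  shows "fourier_int f \<in> L2" "l2_norm (fourier_int f) \<le> l2_norm f"
proof -
  note [measurable] = f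
  let ?F = "fourier_int f" and ?W = "\<lambda>n \<xi>. exp (- (inverse (real (Suc n)) * \<xi>)\<^sup>2 / 2)"
  have "(\<integral>\<^sup>+\<xi>. ennreal ((cmod (?F \<xi>))\<^sup>2) \<partial>lborel) = (\<integral>\<^sup>+\<xi>. liminf (\<lambda>n. ennreal ((cmod (?F \<xi>))\<^sup>2 * ?W n \<xi>)) \<partial>lborel)"
  proof (rule nn_integral_cong)
    fix \<xi>
    have "(\<lambda>n. ennreal ((cmod (?F \<xi>))\<^sup>2 * ?W n \<xi>)) \<longlonglongrightarrow> ennreal ((cmod (?F \<xi>))\<^sup>2 * exp (- (0 * \<xi>)\<^sup>2 / 2))"
      by (intro tendsto_intros LIMSEQ_inverse_real_of_nat) auto
    then show "ennreal ((cmod (?F \<xi>))\<^sup>2) = liminf (\<lambda>n. ennreal ((cmod (?F \<xi>))\<^sup>2 * ?W n \<xi>))"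
      by (intro lim_imp_Liminf[symmetric]) auto
  qed
  also have "\<dots> \<le> liminf (\<lambda>n. \<integral>\<^sup>+\<xi>. ennreal ((cmod (?F \<xi>))\<^sup>2 * ?W n \<xi>) \<partial>lborel)"
    by (rule nn_integral_liminf) measurable
  also have "\<dots> \<le> liminf (\<lambda>n::nat. ennreal ((l2_norm f)\<^sup>2))"
    by (intro Liminf_mono always_eventually allI fourier_int_weighted_norm_le f fi) simp
  also have "\<dots> = ennreal ((l2_norm f)\<^sup>2)" by (simp add: Liminf_const)
  finally have *: "(\<integral>\<^sup>+\<xi>. ennreal ((cmod (?F \<xi>))\<^sup>2) \<partial>lborel) \<le> ennreal ((l2_norm f)\<^sup>2)" .
  then show F: "?F \<in> L2"
    by (intro L2_I integrableI_nonneg) (auto simp: less_top[symmetric] top_unique)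
  have "ennreal ((l2_norm ?F)\<^sup>2) \<le> ennreal ((l2_norm f)\<^sup>2)"
    using * L2_integrable[OF F] by (simp add: l2_norm_power2 nn_integral_eq_integral)
  then have "(l2_norm ?F)\<^sup>2 \<le> (l2_norm f)\<^sup>2" by simp
  then show "l2_norm ?F \<le> l2_norm f" by (rule power2_le_imp_le) simp
qed

section \<open>Extension of the transform to all square-integrable functions\<close>

lemma L2_truncate_integrable:
  assumes "f \<in> L2"
  shows "integrable lborel (\<lambda>x. indicator {- r..r} x * f x)"
proof (rule L2_mult_integrable[OF _ assms])
  show "(\<lambda>x. indicator {- r..r} x :: complex) \<in> L2"
  proof (rule L2_I)
    have "(cmod (indicator {- r..r} x))\<^sup>2 = (indicator {- r..r} x :: real)" for x
      by (simp add: indicator_def)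
    then show "integrable lborel (\<lambda>x. (cmod (indicator {- r..r} x))\<^sup>2)"
      by (simp add: integrable_indicator_iff emeasure_lborel_Icc_eq)
  qed measurable
qed

text \<open>Truncations to bounded intervals are integrable and form a Cauchy sequence in norm. The
  contraction bound carries this over to their transforms, and completeness supplies the limit that
  the choice in \<open>fourier\<close> asks for.\<close>

lemma fourier_exists:
  assumes f: "f \<in> L2"
  shows "\<exists>g. g \<in> L2 \<and>
     (\<lambda>n::nat. l2_norm (\<lambda>\<xi>. fourier_int (\<lambda>x. indicator {- real n..real n} x * f x) \<xi> - g \<xi>)) \<longlonglongrightarrow> 0"
proof -
  define T where "T n x = indicator {- real n..real n} x * f x" for n x
  have T: "T n \<in> L2" for n unfolding T_def by (intro L2_indicator f) simp
  have Ti: "integrable lborel (T n)" for n unfolding T_def by (rule L2_truncate_integrable[OF f])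
  have "\<exists>g\<in>L2. (\<lambda>n. l2_norm (\<lambda>\<xi>. fourier_int (T n) \<xi> - g \<xi>)) \<longlonglongrightarrow> 0"
  proof (rule L2_complete)
    show "fourier_int (T n) \<in> L2" for n by (rule fourier_int_L2[OF T Ti])
    fix e :: real assume "e > 0"
    then have "\<forall>\<^sub>F n in sequentially. l2_norm (\<lambda>x. T n x - f x) < e / 2"
      using L2_truncate_tendsto[OF f] unfolding T_def by (intro order_tendstoD) auto
    then obtain N where N: "\<And>n. n \<ge> N \<Longrightarrow> l2_norm (\<lambda>x. T n x - f x) < e / 2"
      by (auto simp: eventually_sequentially)
    have "l2_norm (\<lambda>\<xi>. fourier_int (T m) \<xi> - fourier_int (T n) \<xi>) < e" if "m \<ge> N" "n \<ge> N" for m n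
    proof -
      have "l2_norm (\<lambda>\<xi>. fourier_int (T m) \<xi> - fourier_int (T n) \<xi>) = l2_norm (fourier_int (\<lambda>x. T m x - T n x))"
        by (intro arg_cong[where f = l2_norm] ext fourier_int_diff[symmetric] Ti)
      also have "\<dots> \<le> l2_norm (\<lambda>x. T m x - T n x)"
        by (intro fourier_int_L2 L2_diff T Bochner_Integration.integrable_diff Ti)
      also have "\<dots> \<le> l2_norm (\<lambda>x. T m x - f x) + l2_norm (\<lambda>x. f x - T n x)"
        by (intro l2_norm_triangle_diff T f)
      also have "\<dots> < e"
        using N[OF that(1)] N[OF that(2)] l2_norm_minus[of f "T n"] by simp
      finally show ?thesis .
    qed
    then show "\<exists>N. \<forall>m\<ge>N. \<forall>n\<ge>N. l2_norm (\<lambda>\<xi>. fourier_int (T m) \<xi> - fourier_int (T n) \<xi>) < e"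
      by blast
  qed
  then show ?thesis unfolding T_def by blast
qed

lemma fourier_L2 [intro]: "f \<in> L2 \<Longrightarrow> fourier f \<in> L2"
  and fourier_tendsto: "f \<in> L2 \<Longrightarrow>
     (\<lambda>n::nat. l2_norm (\<lambda>\<xi>. fourier_int (\<lambda>x. indicator {- real n..real n} x * f x) \<xi> - fourier f \<xi>)) \<longlonglongrightarrow> 0"
  using someI_ex[OF fourier_exists[of f]] unfolding fourier_def by auto

lemma fourier_pairing_int:
  assumes f: "f \<in> L2" and g: "g \<in> L2" and gi: "integrable lborel g"
  shows "(LINT x|lborel. fourier f x * g x) = (LINT x|lborel. f x * fourier_int g x)"
proof (rule LIMSEQ_unique)
  let ?T = "\<lambda>n x. indicator {- real n..real n} x * f x"
  have T: "?T n \<in> L2" for n by (intro L2_indicator f) simp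
  have Ti: "integrable lborel (?T n)" for n by (rule L2_truncate_integrable[OF f])
  show "(\<lambda>n. LINT x|lborel. fourier_int (?T n) x * g x) \<longlonglongrightarrow> (LINT x|lborel. fourier f x * g x)"
    by (intro l2_pairing_tendsto fourier_L2 f g fourier_tendsto always_eventually allI fourier_int_L2 T Ti) auto
  have "(\<lambda>n. LINT x|lborel. ?T n x * fourier_int g x) \<longlonglongrightarrow> (LINT x|lborel. f x * fourier_int g x)"
    by (intro l2_pairing_tendsto f g L2_truncate_tendsto always_eventually allI fourier_int_L2 T gi) auto
  then show "(\<lambda>n. LINT x|lborel. fourier_int (?T n) x * g x) \<longlonglongrightarrow> (LINT x|lborel. f x * fourier_int g x)"
    by (simp add: fourier_int_pairing[OF Ti gi])
qed

text \<open>Modulated Gaussians are total in the space, which gives a weak characterization of the transform.\<close>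

lemma fourier_eqI:
  assumes f: "f \<in> L2" and g: "g \<in> L2"
    and eq: "\<And>b. (LINT x|lborel. g x * gaussian 0 b x) = (LINT x|lborel. f x * gaussian b 0 x)"
  shows "aeeq (fourier f) g"
proof -
  \<comment> \<open>The factor \<open>gaussian 0 0\<close> makes the difference integrable, and
    multiplying it by exp(i a x) gives the test function \<open>gaussian 0 a\<close>.\<close>
  define w where "w x = (fourier f x - g x) * gaussian 0 0 x" for x
  have D: "(\<lambda>x. fourier f x - g x) \<in> L2" by (intro L2_diff fourier_L2 f g)
  have "AE x in lborel. w x = 0"
  proof (rule fourier_zero_imp_AE_zero)
    show "integrable lborel w" unfolding w_def by (intro L2_mult_integrable D L2_gaussian)
    fix a :: real
    have "(LINT x|lborel. w x * exp (\<i> * of_real (a * x))) = (LINT x|lborel. fourier f x * gaussian 0 a x - g x * gaussian 0 a x)"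
      by (intro Bochner_Integration.integral_cong refl) (simp add: w_def gaussian_def algebra_simps)
    also have "\<dots> = (LINT x|lborel. fourier f x * gaussian 0 a x) - (LINT x|lborel. g x * gaussian 0 a x)"
      by (intro Bochner_Integration.integral_diff L2_mult_integrable L2_gaussian fourier_L2 f g)
    also have "\<dots> = 0"
      unfolding fourier_pairing_int[OF f L2_gaussian integrable_gaussian] eq fourier_int_gaussian_0 by simp
    finally show "(LINT x|lborel. w x * exp (\<i> * of_real (a * x))) = 0" .
  qed
  then show ?thesis
    unfolding aeeq_def by eventually_elim (simp add: w_def gaussian_def)
qed

lemma fourier_gaussian_pairing:
  "f \<in> L2 \<Longrightarrow> (LINT x|lborel. fourier f x * gaussian 0 b x) = (LINT x|lborel. f x * gaussian b 0 x)"
  "f \<in> L2 \<Longrightarrow> (LINT x|lborel. fourier f x * gaussian a 0 x) = (LINT x|lborel. f x * gaussian 0 (- a) x)"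
  by (simp_all add: fourier_pairing_int[OF _ L2_gaussian integrable_gaussian] fourier_int_gaussian_0)

lemma fourier_eq_fourier_int:
  assumes f: "f \<in> L2" and fi: "integrable lborel f"
  shows "aeeq (fourier f) (fourier_int f)"
  by (rule fourier_eqI[OF f fourier_int_L2(1)[OF f fi]])
     (simp add: fourier_int_pairing[OF fi integrable_gaussian] fourier_int_gaussian_0)

lemma fourier_aeeq:
  assumes f: "f \<in> L2" and g: "g \<in> L2" and fg: "aeeq f g"
  shows "aeeq (fourier f) (fourier g)"
proof (rule fourier_eqI[OF f fourier_L2[OF g]])
  fix b
  have [measurable]: "f \<in> borel_measurable borel" "g \<in> borel_measurable borel" using f g by auto
  show "(LINT x|lborel. fourier g x * gaussian 0 b x) = (LINT x|lborel. f x * gaussian b 0 x)"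
    unfolding fourier_gaussian_pairing[OF g]
    by (rule integral_cong_AE) (use fg in \<open>auto simp: aeeq_def\<close>)
qed

lemma fourier_linear:
  assumes f: "f \<in> L2" and g: "g \<in> L2"
  shows "aeeq (fourier (\<lambda>x. a * f x + g x)) (\<lambda>x. a * fourier f x + fourier g x)"
proof (rule fourier_eqI)
  fix b
  have "(LINT x|lborel. (a * u x + v x) * w x) = a * (LINT x|lborel. u x * w x) + (LINT x|lborel. v x * w x)"
    if "u \<in> L2" "v \<in> L2" "w \<in> L2" for u v w :: "real \<Rightarrow> complex"
  proof -
    have "(LINT x|lborel. (a * u x + v x) * w x) = (LINT x|lborel. a * (u x * w x) + v x * w x)"
      by (intro Bochner_Integration.integral_cong refl) (simp add: algebra_simps)
    also have "\<dots> = (LINT x|lborel. a * (u x * w x)) + (LINT x|lborel. v x * w x)"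
      by (intro Bochner_Integration.integral_add integrable_mult_right L2_mult_integrable that)
    finally show ?thesis by simp
  qed
  note lin = this
  show "(LINT x|lborel. (a * fourier f x + fourier g x) * gaussian 0 b x) = (LINT x|lborel. (a * f x + g x) * gaussian b 0 x)"
    using f g by (simp add: lin fourier_L2 L2_gaussian fourier_gaussian_pairing)
qed (intro L2_add L2_cmult fourier_L2 f g)+

lemma LINT_reflect: "(LINT x|lborel. f (- x)) = (LINT x::real|lborel. f x :: complex)"
  using lborel_integral_real_affine[of "-1" f 0] by simp

text \<open>Two applications take \<open>gaussian 0 b\<close> to \<open>gaussian 0 (- b)\<close>,
  its own reflection; testing against this family already gives the inversion formula.\<close>

lemma fourier_fourier:
  assumes f: "f \<in> L2" shows "aeeq (fourier (fourier f)) (\<lambda>x. f (- x))"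
proof (rule fourier_eqI)
  fix b
  show "(LINT x|lborel. f (- x) * gaussian 0 b x) = (LINT x|lborel. fourier f x * gaussian b 0 x)"
    using LINT_reflect[of "\<lambda>x. f (- x) * gaussian 0 b x"]
    by (simp add: fourier_gaussian_pairing[OF f] gaussian_reflect)
qed (intro fourier_L2 L2_reflect f)+

lemma fourier_pairing:
  assumes f: "f \<in> L2" and g: "g \<in> L2"
  shows "(LINT x|lborel. fourier f x * g x) = (LINT x|lborel. f x * fourier g x)"
proof (rule LIMSEQ_unique)
  let ?T = "\<lambda>n x. indicator {- real n..real n} x * g x"
  have T: "?T n \<in> L2" for n by (intro L2_indicator g) simp
  have Ti: "integrable lborel (?T n)" for n by (rule L2_truncate_integrable[OF g])
  show "(\<lambda>n. LINT x|lborel. fourier f x * ?T n x) \<longlonglongrightarrow> (LINT x|lborel. fourier f x * g x)"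
    by (intro l2_pairing_tendsto fourier_L2 f g L2_truncate_tendsto always_eventually allI T) auto
  have "(\<lambda>n. LINT x|lborel. f x * fourier_int (?T n) x) \<longlonglongrightarrow> (LINT x|lborel. f x * fourier g x)"
    by (intro l2_pairing_tendsto f g fourier_tendsto always_eventually allI fourier_int_L2 fourier_L2 T Ti) auto
  then show "(\<lambda>n. LINT x|lborel. fourier f x * ?T n x) \<longlonglongrightarrow> (LINT x|lborel. f x * fourier g x)"
    by (simp add: fourier_pairing_int[OF f T Ti])
qed

lemma fourier_reflect:
  assumes f: "f \<in> L2" shows "aeeq (fourier (\<lambda>x. f (- x))) (\<lambda>x. fourier f (- x))"
proof (rule fourier_eqI)
  fix b
  show "(LINT x|lborel. fourier f (- x) * gaussian 0 b x) = (LINT x|lborel. f (- x) * gaussian b 0 x)"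
    using LINT_reflect[of "\<lambda>x. fourier f (- x) * gaussian 0 b x"] LINT_reflect[of "\<lambda>x. f (- x) * gaussian b 0 x"]
    by (simp add: fourier_gaussian_pairing[OF f] gaussian_reflect)
qed (intro fourier_L2 L2_reflect f)+

lemma fourier_cnj:
  assumes f: "f \<in> L2" shows "aeeq (fourier (\<lambda>x. cnj (f x))) (\<lambda>x. cnj (fourier f (- x)))"
proof (rule fourier_eqI)
  fix b
  have "(LINT x|lborel. cnj (fourier f (- x)) * gaussian 0 b x) = cnj (LINT x|lborel. fourier f (- x) * gaussian 0 (- b) x)"
    unfolding Bochner_Integration.integral_cnj[symmetric] by (simp add: cnj_gaussian)
  also have "(LINT x|lborel. fourier f (- x) * gaussian 0 (- b) x) = (LINT x|lborel. f x * gaussian b 0 x)"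
    using LINT_reflect[of "\<lambda>x. fourier f (- x) * gaussian 0 (- b) x"]
    by (simp add: fourier_gaussian_pairing[OF f] gaussian_reflect)
  also have "cnj \<dots> = (LINT x|lborel. cnj (f x) * gaussian b 0 x)"
    unfolding Bochner_Integration.integral_cnj[symmetric] by (simp add: cnj_gaussian)
  finally show "(LINT x|lborel. cnj (fourier f (- x)) * gaussian 0 b x) = (LINT x|lborel. cnj (f x) * gaussian b 0 x)" .
qed (intro fourier_L2 L2_reflect L2_cnj f)+

lemma LINT_cong_aeeq:
  assumes "aeeq f g" "f \<in> L2" "g \<in> L2" "aeeq h k" "h \<in> L2" "k \<in> L2"
  shows "(LINT x|lborel. f x * h x) = (LINT x|lborel. g x * k x)"
proof (rule integral_cong_AE)
  show "AE x in lborel. f x * h x = g x * k x"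
    using assms(1,4) unfolding aeeq_def by eventually_elim simp
qed (use assms(2,3,5,6) in measurable)

lemma l2_inner_aeeq:
  assumes "aeeq f g" "f \<in> L2" "g \<in> L2" "aeeq h k" "h \<in> L2" "k \<in> L2"
  shows "l2_inner f h = l2_inner g k"
  unfolding l2_inner_def
proof (rule LINT_cong_aeeq)
  show "aeeq (\<lambda>x. cnj (h x)) (\<lambda>x. cnj (k x))"
    using assms(4) unfolding aeeq_def by eventually_elim simp
qed (intro assms L2_cnj)+

lemma l2_inner_self: "l2_inner f f = of_real ((l2_norm f)\<^sup>2)"
  unfolding l2_inner_def l2_norm_power2 integral_complex_of_real[symmetric] complex_norm_square ..

text \<open>The multiplication formula for f and the transform of h, where h(x) = conj g(-x) is
  chosen so that its transform is the conjugate of that of g. Transforming h once more reflects it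
  to conj g.\<close>

lemma plancherel:
  assumes f: "f \<in> L2" and g: "g \<in> L2"
  shows "l2_inner (fourier f) (fourier g) = l2_inner f g"
proof -
  let ?h = "\<lambda>x. cnj (g (- x))"
  have h: "?h \<in> L2" by (intro L2_cnj L2_reflect g)
  have 1: "aeeq (fourier ?h) (\<lambda>x. cnj (fourier g x))"
  proof -
    have "aeeq (fourier ?h) (\<lambda>x. cnj (fourier (\<lambda>x. g (- x)) (- x)))"
      by (rule fourier_cnj[OF L2_reflect[OF g]])
    also have "aeeq \<dots> (\<lambda>x. cnj (fourier g x))"
      using aeeq_reflect[OF fourier_reflect[OF g]] unfolding aeeq_def by eventually_elim simp
    finally show ?thesis .
  qed
  have "l2_inner (fourier f) (fourier g) = (LINT x|lborel. fourier f x * fourier ?h x)"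
    unfolding l2_inner_def
    by (rule LINT_cong_aeeq[OF _ _ _ aeeq_sym[OF 1]]) (auto intro!: fourier_L2 f g h L2_cnj)
  also have "\<dots> = (LINT x|lborel. f x * fourier (fourier ?h) x)"
    by (rule fourier_pairing[OF f fourier_L2[OF h]])
  also have "\<dots> = l2_inner f g"
    unfolding l2_inner_def
    by (rule LINT_cong_aeeq) (use fourier_fourier[OF h] in \<open>auto intro!: fourier_L2 f g h L2_cnj\<close>)
  finally show ?thesis .
qed

lemma l2_norm_fourier:
  assumes f: "f \<in> L2" shows "l2_norm (fourier f) = l2_norm f"
proof -
  have "(l2_norm (fourier f))\<^sup>2 = (l2_norm f)\<^sup>2"
    using plancherel[OF f f] unfolding l2_inner_self of_real_eq_iff .
  then show ?thesis by simp
qed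

section \<open>The inverse transform\<close>

lemma fourier_inv_int_eq: "fourier_inv_int f x = fourier_int f (- x)"
  by (simp add: fourier_inv_int_def fourier_int_def mult.commute)

text \<open>The truncated inverse integrals are reflections of the truncated transforms, so
  uniqueness of limits in norm identifies the choice in \<open>fourier_inv\<close> with the
  reflected transform.\<close>

lemma fourier_inv_L2 [intro]: "f \<in> L2 \<Longrightarrow> fourier_inv f \<in> L2"
  and fourier_inv_eq: "f \<in> L2 \<Longrightarrow> aeeq (fourier_inv f) (\<lambda>x. fourier f (- x))"
proof -
  assume f: "f \<in> L2"
  let ?T = "\<lambda>n x. indicator {- real n..real n} x * f x"
  let ?P = "\<lambda>g. g \<in> L2 \<and> (\<lambda>n::nat. l2_norm (\<lambda>x. fourier_inv_int (?T n) x - g x)) \<longlonglongrightarrow> 0"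
  have P: "?P (\<lambda>x. fourier f (- x))"
  proof
    show "(\<lambda>x. fourier f (- x)) \<in> L2" by (intro L2_reflect fourier_L2 f)
    have "l2_norm (\<lambda>x. fourier_inv_int (?T n) x - fourier f (- x)) = l2_norm (\<lambda>\<xi>. fourier_int (?T n) \<xi> - fourier f \<xi>)" for n
      unfolding fourier_inv_int_eq using l2_norm_reflect[of "\<lambda>\<xi>. fourier_int (?T n) \<xi> - fourier f \<xi>"] .
    then show "(\<lambda>n::nat. l2_norm (\<lambda>x. fourier_inv_int (?T n) x - fourier f (- x))) \<longlonglongrightarrow> 0"
      using fourier_tendsto[OF f] by simp
  qed
  then have Q: "?P (fourier_inv f)" unfolding fourier_inv_def by (rule someI[where P = ?P])
  then show "fourier_inv f \<in> L2" by simp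
  show "aeeq (fourier_inv f) (\<lambda>x. fourier f (- x))"
  proof (rule l2_limit_unique[where F = sequentially])
    show "\<forall>\<^sub>F n in sequentially. fourier_inv_int (?T n) \<in> L2"
    proof (intro always_eventually allI)
      fix n
      have "fourier_int (?T n) \<in> L2"
        by (intro fourier_int_L2 L2_indicator f L2_truncate_integrable) simp
      from L2_reflect[OF this] show "fourier_inv_int (?T n) \<in> L2"
        unfolding fourier_inv_int_eq[abs_def] .
    qed
  qed (use P Q in auto)
qed

lemma fourier_inv_fourier:
  assumes f: "f \<in> L2" shows "aeeq (fourier_inv (fourier f)) f"
proof -
  have "aeeq (fourier_inv (fourier f)) (\<lambda>x. fourier (fourier f) (- x))"
    by (rule fourier_inv_eq[OF fourier_L2[OF f]])
  also have "aeeq \<dots> f" using aeeq_reflect[OF fourier_fourier[OF f]] by simp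
  finally show ?thesis .
qed

lemma fourier_fourier_inv:
  assumes f: "f \<in> L2" shows "aeeq (fourier (fourier_inv f)) f"
proof -
  have "aeeq (fourier (fourier_inv f)) (fourier (\<lambda>x. fourier f (- x)))"
    by (intro fourier_aeeq fourier_inv_eq fourier_inv_L2 L2_reflect fourier_L2 f)
  also have "aeeq \<dots> (\<lambda>x. fourier (fourier f) (- x))"
    by (rule fourier_reflect[OF fourier_L2[OF f]])
  also have "aeeq \<dots> f" using aeeq_reflect[OF fourier_fourier[OF f]] by simp
  finally show ?thesis .
qed

lemma fourier_inv_aeeq:
  assumes "f \<in> L2" "g \<in> L2" "aeeq f g"
  shows "aeeq (fourier_inv f) (fourier_inv g)"
  using aeeq_trans[OF aeeq_trans[OF fourier_inv_eq[OF assms(1)] aeeq_reflect[OF fourier_aeeq[OF assms]]]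
    aeeq_sym[OF fourier_inv_eq[OF assms(2)]]] .

lemma l2_norm_fourier_inv:
  assumes f: "f \<in> L2" shows "l2_norm (fourier_inv f) = l2_norm f"
proof -
  have "l2_norm (fourier_inv f) = l2_norm (\<lambda>x. fourier f (- x))"
    using fourier_inv_eq[OF f] by (rule l2_norm_aeeq) (intro L2_measurable fourier_inv_L2 L2_reflect fourier_L2 f)+
  then show ?thesis using l2_norm_reflect[of "fourier f"] l2_norm_fourier[OF f] by simp
qed

lemma l2_inner_fourier_inv:
  assumes f: "f \<in> L2" and g: "g \<in> L2"
  shows "l2_inner (fourier_inv f) g = l2_inner f (fourier g)"
proof -
  have "l2_inner (fourier_inv f) g = l2_inner (fourier (fourier_inv f)) (fourier g)"
    by (rule plancherel[symmetric]) (auto intro: f g)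
  also have "\<dots> = l2_inner f (fourier g)"
    by (rule l2_inner_aeeq) (auto intro: f g fourier_fourier_inv)
  finally show ?thesis .
qed

lemma fourier_inv_linear:
  assumes f: "f \<in> L2" and g: "g \<in> L2"
  shows "aeeq (fourier_inv (\<lambda>x. a * f x + g x)) (\<lambda>x. a * fourier_inv f x + fourier_inv g x)"
proof -
  have "aeeq (fourier_inv (\<lambda>x. a * f x + g x)) (\<lambda>x. fourier (\<lambda>x. a * f x + g x) (- x))"
    by (intro fourier_inv_eq L2_add L2_cmult f g)
  also have "aeeq \<dots> (\<lambda>x. a * fourier f (- x) + fourier g (- x))"
    using aeeq_reflect[OF fourier_linear[OF f g]] .
  also have "aeeq \<dots> (\<lambda>x. a * fourier_inv f x + fourier_inv g x)"
    using fourier_inv_eq[OF f] fourier_inv_eq[OF g] unfolding aeeq_def by eventually_elim simp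
  finally show ?thesis .
qed

section \<open>The Hardy space and half-line supports\<close>

text \<open>At z = x + i y this is the transform of exp(y \<xi>) \<phi>(\<xi>) at x, hence the
  candidate for the extension of the transform of \<phi> to the upper half-plane when \<phi> lives
  on the negative half-line.\<close>

definition laplace_ext :: "(real \<Rightarrow> complex) \<Rightarrow> complex \<Rightarrow> complex" where
  "laplace_ext \<phi> z = (1 / sqrt (2 * pi)) * (LINT \<xi>|lborel. exp (- \<i> * z * of_real \<xi>) * \<phi> \<xi>)"

section \<open>Laplace integrals over the negative half-line\<close>

lemma integrable_power_exp_neg:
  assumes y: "y > 0"
  shows "integrable lborel (\<lambda>\<xi>::real. indicator {..<0} \<xi> * (\<bar>\<xi>\<bar> ^ k * exp (y * \<xi>)))"
proof -
  have "integrable lborel (\<lambda>x::real. indicator {0<..} x *\<^sub>R (x ^ k * exp (- x)))"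
    using has_bochner_integral_I0i_power_exp_m[of k] by (simp add: has_bochner_integral_iff mult_ac)
  from lborel_integrable_real_affine[OF this, of "-y" 0]
  have "integrable lborel (\<lambda>x::real. indicator {0<..} (- y * x) *\<^sub>R ((- y * x) ^ k * exp (y * x)))"
    using y by simp
  then have "integrable lborel (\<lambda>x::real. (1 / y ^ k) * (indicator {0<..} (- y * x) *\<^sub>R ((- y * x) ^ k * exp (y * x))))"
    by (rule integrable_mult_right)
  also have "(\<lambda>x::real. (1 / y ^ k) * (indicator {0<..} (- y * x) *\<^sub>R ((- y * x) ^ k * exp (y * x))))
     = (\<lambda>\<xi>. indicator {..<0} \<xi> * (\<bar>\<xi>\<bar> ^ k * exp (y * \<xi>)))"
  proof (rule ext)
    fix \<xi> :: real
    show "(1 / y ^ k) * (indicator {0<..} (- y * \<xi>) *\<^sub>R ((- y * \<xi>) ^ k * exp (y * \<xi>))) =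
        indicator {..<0} \<xi> * (\<bar>\<xi>\<bar> ^ k * exp (y * \<xi>))"
    proof (cases "\<xi> < 0")
      case True
      have "(- y * \<xi>) ^ k = y ^ k * \<bar>\<xi>\<bar> ^ k"
        unfolding power_mult_distrib[symmetric] using True by simp
      moreover have "- y * \<xi> > 0" using True y by (simp add: mult_pos_neg)
      ultimately show ?thesis using True y by simp
    next
      case False
      then have "\<not> - y * \<xi> > 0" using y by (simp add: not_less)
      then show ?thesis using False by simp
    qed
  qed
  finally show ?thesis .
qed

lemma L2_power_exp_neg:
  assumes y: "y > 0"
  shows "(\<lambda>\<xi>::real. complex_of_real (indicator {..<0} \<xi> * (\<bar>\<xi>\<bar> ^ k * exp (y * \<xi>)))) \<in> L2"
proof (rule L2_I)
  have "(cmod (complex_of_real (indicator {..<0} \<xi> * (\<bar>\<xi>\<bar> ^ k * exp (y * \<xi>)))))\<^sup>2 =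
     indicator {..<0} \<xi> * (\<bar>\<xi>\<bar> ^ (k + k) * exp (2 * y * \<xi>))" for \<xi> :: real
    by (simp add: indicator_def norm_mult norm_power power2_eq_square power_add exp_add[symmetric] mult_ac)
  then show "integrable lborel (\<lambda>\<xi>::real. (cmod (complex_of_real (indicator {..<0} \<xi> * (\<bar>\<xi>\<bar> ^ k * exp (y * \<xi>)))))\<^sup>2)"
    using integrable_power_exp_neg[of "2 * y" "k + k"] y by simp
qed measurable

lemma integrable_power_exp_neg_mult:
  assumes y: "y > 0" and \<phi>: "\<phi> \<in> L2" and supp: "\<And>\<xi>. \<xi> \<ge> 0 \<Longrightarrow> \<phi> \<xi> = 0"
  shows "integrable lborel (\<lambda>\<xi>. of_real (\<bar>\<xi>\<bar> ^ k * exp (y * \<xi>)) * \<phi> \<xi>)"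
proof -
  have "of_real (\<bar>\<xi>\<bar> ^ k * exp (y * \<xi>)) * \<phi> \<xi> = complex_of_real (indicator {..<0} \<xi> * (\<bar>\<xi>\<bar> ^ k * exp (y * \<xi>))) * \<phi> \<xi>" for \<xi>
    using supp[of \<xi>] by (cases "\<xi> < 0") auto
  then show ?thesis using L2_mult_integrable[OF L2_power_exp_neg[OF y] \<phi>] by (simp only:)
qed

lemma laplace_ext_integrable:
  assumes z: "Im z > 0" and \<phi>: "\<phi> \<in> L2" and supp: "\<And>\<xi>. \<xi> \<ge> 0 \<Longrightarrow> \<phi> \<xi> = 0"
  shows "integrable lborel (\<lambda>\<xi>. exp (- \<i> * z * of_real \<xi>) * \<phi> \<xi>)"
    "integrable lborel (\<lambda>\<xi>. exp (- \<i> * z * of_real \<xi>) * (- \<i> * of_real \<xi>) * \<phi> \<xi>)"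
proof -
  have [measurable]: "\<phi> \<in> borel_measurable borel" using \<phi> by (rule L2_measurable)
  show "integrable lborel (\<lambda>\<xi>. exp (- \<i> * z * of_real \<xi>) * \<phi> \<xi>)"
    by (rule Bochner_Integration.integrable_bound[OF integrable_power_exp_neg_mult[OF z \<phi> supp, where k = 0]])
      (auto simp: norm_mult)
  show "integrable lborel (\<lambda>\<xi>. exp (- \<i> * z * of_real \<xi>) * (- \<i> * of_real \<xi>) * \<phi> \<xi>)"
    by (rule Bochner_Integration.integrable_bound[OF integrable_power_exp_neg_mult[OF z \<phi> supp, where k = 1]])
      (auto simp: norm_mult)
qed

lemma norm_exp_minus_linear_le: "cmod (exp w - 1 - w) \<le> exp \<bar>Re w\<bar> * cmod w ^ 2"
  using Taylor_exp[of w 1] by (simp add: numeral_2_eq_2 diff_diff_eq)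

text \<open>Differentiation under the integral sign: by the second-order remainder of exp, the
  difference quotient differs from the formal derivative by at most a multiple of |h|.\<close>

lemma laplace_ext_holomorphic:
  assumes \<phi>: "\<phi> \<in> L2" and supp: "\<And>\<xi>. \<xi> \<ge> 0 \<Longrightarrow> \<phi> \<xi> = 0"
  shows "laplace_ext \<phi> holomorphic_on {z. Im z > 0}"
proof -
  have [measurable]: "\<phi> \<in> borel_measurable borel" using \<phi> by (rule L2_measurable)
  let ?I = "\<lambda>z. LINT \<xi>|lborel. exp (- \<i> * z * of_real \<xi>) * \<phi> \<xi>"
  have "?I field_differentiable at z" if z: "Im z > 0" for z
  proof -
    define y where "y = Im z"
    have y: "y > 0" using z by (simp add: y_def)
    define D where "D = (LINT \<xi>|lborel. exp (- \<i> * z * of_real \<xi>) * (- \<i> * of_real \<xi>) * \<phi> \<xi>)"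
    \<comment> \<open>For |h| < y/2 the remainder grows at most like exp(y |\<xi>| / 2) up to a
      square, so half of the decay exp(y \<xi>) is left to keep this constant finite.\<close>
    define C where "C = (LINT \<xi>|lborel. cmod (of_real (\<bar>\<xi>\<bar> ^ 2 * exp (y / 2 * \<xi>)) * \<phi> \<xi>))"
    have iC: "integrable lborel (\<lambda>\<xi>. cmod (of_real (\<bar>\<xi>\<bar> ^ 2 * exp (y / 2 * \<xi>)) * \<phi> \<xi>))"
      by (intro integrable_norm integrable_power_exp_neg_mult \<phi> supp) (use y in auto)
    have est: "cmod ((?I (z + h) - ?I z) / h - D) \<le> C * cmod h" if h: "h \<noteq> 0" "cmod h < y / 2" for h
    proof -
      have zh: "Im (z + h) > 0"
        using abs_Im_le_cmod[of h] h z by (auto simp: y_def)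
      let ?r = "\<lambda>\<xi>::real. exp (- \<i> * z * of_real \<xi>) * (exp (- \<i> * h * of_real \<xi>) - 1 - (- \<i> * h * of_real \<xi>)) * \<phi> \<xi>"
      have i1: "integrable lborel (\<lambda>\<xi>. exp (- \<i> * (z + h) * of_real \<xi>) * \<phi> \<xi>)"
        by (rule laplace_ext_integrable[OF zh \<phi> supp])
      have i2: "integrable lborel (\<lambda>\<xi>. exp (- \<i> * z * of_real \<xi>) * \<phi> \<xi>)"
        by (rule laplace_ext_integrable[OF z \<phi> supp])
      have i3: "integrable lborel (\<lambda>\<xi>. h * (exp (- \<i> * z * of_real \<xi>) * (- \<i> * of_real \<xi>) * \<phi> \<xi>))"
        by (rule integrable_mult_right[OF laplace_ext_integrable(2)[OF z \<phi> supp]])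
      have "?I (z + h) - ?I z - h * D =
         (LINT \<xi>|lborel. exp (- \<i> * (z + h) * of_real \<xi>) * \<phi> \<xi> - exp (- \<i> * z * of_real \<xi>) * \<phi> \<xi>
            - h * (exp (- \<i> * z * of_real \<xi>) * (- \<i> * of_real \<xi>) * \<phi> \<xi>))"
        unfolding D_def integral_mult_right_zero[symmetric]
        by (simp only: Bochner_Integration.integral_diff[OF Bochner_Integration.integrable_diff[OF i1 i2] i3]
            Bochner_Integration.integral_diff[OF i1 i2])
      also have "\<dots> = (LINT \<xi>|lborel. ?r \<xi>)"
        by (intro Bochner_Integration.integral_cong refl) (simp add: algebra_simps exp_add exp_diff exp_minus divide_inverse)
      also have "cmod \<dots> \<le> (LINT \<xi>|lborel. (cmod h)\<^sup>2 * cmod (of_real (\<bar>\<xi>\<bar> ^ 2 * exp (y / 2 * \<xi>)) * \<phi> \<xi>))"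
      proof (rule order_trans[OF integral_norm_bound integral_mono])
        have r_bound: "cmod (?r \<xi>) \<le> (cmod h)\<^sup>2 * cmod (of_real (\<bar>\<xi>\<bar> ^ 2 * exp (y / 2 * \<xi>)) * \<phi> \<xi>)" for \<xi>
        proof (cases "\<xi> < 0")
          case True
          let ?w = "- \<i> * h * of_real \<xi>"
          have "cmod (exp ?w - 1 - ?w) \<le> exp \<bar>Re ?w\<bar> * cmod ?w ^ 2"
            by (rule norm_exp_minus_linear_le)
          also have "\<dots> \<le> exp (- (y / 2 * \<xi>)) * ((cmod h)\<^sup>2 * \<xi>\<^sup>2)"
          proof (intro mult_mono)
            have "\<bar>Re ?w\<bar> \<le> cmod ?w" by (rule abs_Re_le_cmod)
            also have "\<dots> = cmod h * (- \<xi>)" using True by (simp add: norm_mult)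
            also have "\<dots> \<le> y / 2 * (- \<xi>)" using h True by (intro mult_right_mono) auto
            finally show "exp \<bar>Re ?w\<bar> \<le> exp (- (y / 2 * \<xi>))" by simp
            show "cmod ?w ^ 2 \<le> (cmod h)\<^sup>2 * \<xi>\<^sup>2" by (simp add: norm_mult power_mult_distrib)
          qed auto
          finally have *: "cmod (exp ?w - 1 - ?w) \<le> exp (- (y / 2 * \<xi>)) * ((cmod h)\<^sup>2 * \<xi>\<^sup>2)" .
          have "cmod (?r \<xi>) = exp (y * \<xi>) * cmod (exp ?w - 1 - ?w) * cmod (\<phi> \<xi>)"
            by (simp add: norm_mult y_def)
          also have "\<dots> \<le> exp (y * \<xi>) * (exp (- (y / 2 * \<xi>)) * ((cmod h)\<^sup>2 * \<xi>\<^sup>2)) * cmod (\<phi> \<xi>)"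
            by (intro mult_right_mono mult_left_mono *) auto
          also have "\<dots> = (cmod h)\<^sup>2 * (\<xi>\<^sup>2 * (exp (y * \<xi>) * exp (- (y / 2 * \<xi>))) * cmod (\<phi> \<xi>))"
            by (simp add: mult_ac)
          also have "exp (y * \<xi>) * exp (- (y / 2 * \<xi>)) = exp (y / 2 * \<xi>)"
            by (simp add: exp_add[symmetric] field_simps)
          finally show ?thesis by (simp add: norm_mult norm_power)
        next
          case False
          then show ?thesis using supp[of \<xi>] by simp
        qed
        then show "\<And>\<xi>. \<xi> \<in> space lborel \<Longrightarrow> cmod (?r \<xi>) \<le> (cmod h)\<^sup>2 * cmod (of_real (\<bar>\<xi>\<bar> ^ 2 * exp (y / 2 * \<xi>)) * \<phi> \<xi>)"
          by blast
        show i: "integrable lborel (\<lambda>\<xi>. (cmod h)\<^sup>2 * cmod (of_real (\<bar>\<xi>\<bar> ^ 2 * exp (y / 2 * \<xi>)) * \<phi> \<xi>))"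
          using iC by (rule integrable_mult_right)
        show "integrable lborel (\<lambda>\<xi>. cmod (?r \<xi>))"
          by (rule Bochner_Integration.integrable_bound[OF i]) (use r_bound in \<open>auto simp: abs_mult\<close>)
      qed
      also have "\<dots> = (cmod h)\<^sup>2 * C" unfolding C_def by simp
      finally have "cmod (?I (z + h) - ?I z - h * D) / cmod h \<le> (cmod h)\<^sup>2 * C / cmod h"
        by (intro divide_right_mono) auto
      moreover have "(?I (z + h) - ?I z) / h - D = (?I (z + h) - ?I z - h * D) / h"
        using h by (simp add: field_simps)
      ultimately show ?thesis using h by (simp add: norm_divide power2_eq_square mult_ac)
    qed
    have "(?I has_field_derivative D) (at z)"
      unfolding DERIV_def
    proof (rule Lim_null[THEN iffD2], rule Lim_null_comparison)
      show "\<forall>\<^sub>F h in at 0. norm ((?I (z + h) - ?I z) / h - D) \<le> C * cmod h"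
        unfolding eventually_at using est y by (intro exI[of _ "y / 2"]) auto
      show "((\<lambda>h. C * cmod h) \<longlongrightarrow> 0) (at 0)"
        by (auto intro!: tendsto_eq_intros)
    qed
    then show ?thesis by (auto simp: field_differentiable_def)
  qed
  then have "?I holomorphic_on {z. Im z > 0}"
    by (auto simp: holomorphic_on_def intro: field_differentiable_at_within)
  then show ?thesis
    unfolding laplace_ext_def[abs_def] by (intro holomorphic_intros)
qed

lemma laplace_ext_Complex:
  "laplace_ext \<phi> (Complex x y) = fourier_int (\<lambda>\<xi>. of_real (exp (y * \<xi>)) * \<phi> \<xi>) x"
proof -
  have "exp (- \<i> * Complex x y * of_real \<xi>) = exp (- \<i> * of_real (\<xi> * x)) * of_real (exp (y * \<xi>))" for \<xi>
    by (simp add: Complex_eq algebra_simps exp_add[symmetric] exp_of_real[symmetric] del: exp_of_real)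
  then show ?thesis by (simp add: laplace_ext_def fourier_int_def mult.assoc)
qed

lemma L2_exp_weight:
  assumes y: "y \<ge> 0" and \<phi>: "\<phi> \<in> L2" and supp: "\<And>\<xi>. \<xi> \<ge> 0 \<Longrightarrow> \<phi> \<xi> = 0"
  shows "(\<lambda>\<xi>. of_real (exp (y * \<xi>)) * \<phi> \<xi>) \<in> L2"
    "cmod (of_real (exp (y * \<xi>)) * \<phi> \<xi>) \<le> cmod (\<phi> \<xi>)"
proof -
  have [measurable]: "\<phi> \<in> borel_measurable borel" using \<phi> by (rule L2_measurable)
  show *: "cmod (of_real (exp (y * \<xi>)) * \<phi> \<xi>) \<le> cmod (\<phi> \<xi>)" for \<xi>
  proof (cases "\<xi> < 0")
    case True
    then have "y * \<xi> \<le> 0" using y by (simp add: mult_nonneg_nonpos)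
    then show ?thesis by (simp add: norm_mult mult_left_le_one_le)
  qed (use supp in simp)
  then show "(\<lambda>\<xi>. of_real (exp (y * \<xi>)) * \<phi> \<xi>) \<in> L2"
    by (intro L2_dominated[OF _ \<phi>, where C = 1]) auto
qed

lemma fourier_diff:
  assumes f: "f \<in> L2" and g: "g \<in> L2"
  shows "aeeq (fourier (\<lambda>x. f x - g x)) (\<lambda>x. fourier f x - fourier g x)"
  using fourier_linear[OF g f, of "-1"] by simp

text \<open>The slice at height y is the transform of exp(y \<xi>) \<phi>, so the isometry converts
  convergence of the slices into dominated convergence of exp(y \<xi>) \<phi> to \<phi>. The
  function f stands for any representative of the transform.\<close>

lemma fourier_half_line_in_H2:
  assumes \<phi>: "\<phi> \<in> L2" and supp: "AE \<xi> in lborel. \<xi> > 0 \<longrightarrow> \<phi> \<xi> = 0"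
    and f: "f \<in> L2" and eq: "aeeq f (fourier \<phi>)"
  shows "f \<in> H2"
proof -
  \<comment> \<open>The cut changes \<phi> on a null set only and makes the support condition hold
    at every point, as the Laplace integrals require.\<close>
  define \<psi> where "\<psi> \<xi> = indicator {..<0} \<xi> * \<phi> \<xi>" for \<xi>
  have \<psi>: "\<psi> \<in> L2" unfolding \<psi>_def by (intro L2_indicator \<phi>) simp
  have \<psi>0: "\<psi> \<xi> = 0" if "\<xi> \<ge> 0" for \<xi> using that by (simp add: \<psi>_def)
  have "aeeq \<phi> \<psi>"
    unfolding aeeq_def using supp AE_lborel_singleton[of 0]
    by eventually_elim (auto simp: \<psi>_def indicator_def)
  then have eq': "aeeq f (fourier \<psi>)"
    using aeeq_trans[OF eq fourier_aeeq[OF \<phi> \<psi>]] by simp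
  define E where "E y \<xi> = of_real (exp (y * \<xi>)) * \<psi> \<xi>" for y \<xi>
  have E: "E y \<in> L2" "cmod (E y \<xi>) \<le> cmod (\<psi> \<xi>)" if "y \<ge> 0" for y \<xi>
    using L2_exp_weight[OF that \<psi> \<psi>0] by (auto simp: E_def[abs_def])
  have Ei: "integrable lborel (E y)" if "y > 0" for y
    using integrable_power_exp_neg_mult[OF that \<psi> \<psi>0, of 0] by (simp add: E_def[abs_def])
  let ?F = "laplace_ext \<psi>"
  have F: "?F (Complex x y) = fourier_int (E y) x" for x y
    by (simp add: laplace_ext_Complex E_def[abs_def])
  have FL2: "(\<lambda>x. ?F (Complex x y)) \<in> L2" if "y > 0" for y
    unfolding F using fourier_int_L2(1)[OF E(1) Ei] that by simp
  have "l2_norm (\<lambda>x. ?F (Complex x y)) \<le> l2_norm \<psi>" if "y > 0" for y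
  proof -
    have "l2_norm (fourier_int (E y)) \<le> l2_norm (E y)"
      using that by (intro fourier_int_L2 E Ei) auto
    also have "\<dots> \<le> l2_norm \<psi>" using that by (intro l2_norm_mono E \<psi> AE_I2) auto
    finally show ?thesis by (simp add: F)
  qed
  moreover have "((\<lambda>y. l2_norm (\<lambda>x. ?F (Complex x y) - f x)) \<longlongrightarrow> 0) (at_right 0)"
  proof (rule Lim_transform_eventually)
    show "((\<lambda>y. l2_norm (\<lambda>\<xi>. E y \<xi> - \<psi> \<xi>)) \<longlongrightarrow> 0) (at_right 0)"
    proof (rule l2_dominated_convergence[where g = \<psi> and C = 2])
      show "E y \<in> borel_measurable borel" for y unfolding E_def using L2_measurable[OF \<psi>] by measurable
      show "AE \<xi> in lborel. ((\<lambda>y. E y \<xi>) \<longlongrightarrow> \<psi> \<xi>) (at_right 0)"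
        unfolding E_def by (auto intro!: AE_I2 tendsto_eq_intros)
      show "\<forall>\<^sub>F y in at_right 0. AE \<xi> in lborel. cmod (E y \<xi> - \<psi> \<xi>) \<le> 2 * cmod (\<psi> \<xi>)"
      proof (rule eventually_at_rightI[of 0 1])
        fix y :: real assume "y \<in> {0<..<1}"
        then have "cmod (E y \<xi> - \<psi> \<xi>) \<le> 2 * cmod (\<psi> \<xi>)" for \<xi>
          using norm_triangle_ineq4[of "E y \<xi>" "\<psi> \<xi>"] E(2)[of y \<xi>] by auto
        then show "AE \<xi> in lborel. cmod (E y \<xi> - \<psi> \<xi>) \<le> 2 * cmod (\<psi> \<xi>)" by simp
      qed simp
    qed (use \<psi> in auto)
    show "\<forall>\<^sub>F y in at_right 0. l2_norm (\<lambda>\<xi>. E y \<xi> - \<psi> \<xi>) = l2_norm (\<lambda>x. ?F (Complex x y) - f x)"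
    proof (rule eventually_at_rightI[of 0 1])
      fix y :: real assume "y \<in> {0<..<1}"
      then have y: "y > 0" by simp
      note Ey = E(1)[OF less_imp_le[OF y]]
      have "l2_norm (\<lambda>\<xi>. E y \<xi> - \<psi> \<xi>) = l2_norm (fourier (\<lambda>\<xi>. E y \<xi> - \<psi> \<xi>))"
        by (intro l2_norm_fourier[symmetric] L2_diff Ey \<psi>)
      also have "\<dots> = l2_norm (\<lambda>x. ?F (Complex x y) - f x)"
      proof (rule l2_norm_aeeq)
        have "aeeq (fourier (\<lambda>\<xi>. E y \<xi> - \<psi> \<xi>)) (\<lambda>x. fourier (E y) x - fourier \<psi> x)"
          by (rule fourier_diff[OF Ey \<psi>])
        also have "aeeq \<dots> (\<lambda>x. ?F (Complex x y) - f x)"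
          using fourier_eq_fourier_int[OF Ey Ei[OF y]] eq' unfolding aeeq_def F
          by eventually_elim simp
        finally show "aeeq (fourier (\<lambda>\<xi>. E y \<xi> - \<psi> \<xi>)) (\<lambda>x. ?F (Complex x y) - f x)" .
      qed (intro L2_measurable fourier_L2 L2_diff Ey \<psi> f FL2 y)+
      finally show "l2_norm (\<lambda>\<xi>. E y \<xi> - \<psi> \<xi>) = l2_norm (\<lambda>x. ?F (Complex x y) - f x)" .
    qed simp
  qed
  ultimately show ?thesis
    unfolding H2_def using f FL2 laplace_ext_holomorphic[OF \<psi> \<psi>0]
    by (intro CollectI conjI exI[of _ ?F]) auto
qed

section \<open>Moving a horizontal line of integration\<close>

lemma has_vector_derivative_horizontal:
  assumes "(P has_field_derivative D) (at (Complex x y))"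
  shows "((\<lambda>x. P (Complex x y)) has_vector_derivative D) (at x within S)"
proof -
  have "((\<lambda>x. Complex x y) has_vector_derivative 1) (at x)"
    unfolding Complex_eq by (auto intro!: derivative_eq_intros simp: has_vector_derivative_def scaleR_conv_of_real)
  from field_vector_diff_chain_at[OF this assms]
  show ?thesis by (auto simp: o_def intro: has_vector_derivative_at_within)
qed

lemma has_vector_derivative_vertical:
  assumes "(P has_field_derivative D) (at (Complex x y))"
  shows "((\<lambda>y. P (Complex x y)) has_vector_derivative (\<i> * D)) (at y within S)"
proof -
  have "((\<lambda>y. Complex x y) has_vector_derivative \<i>) (at y)"
    unfolding Complex_eq by (auto intro!: derivative_eq_intros simp: has_vector_derivative_def scaleR_conv_of_real)
  from field_vector_diff_chain_at[OF this assms]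
  show ?thesis by (auto simp: o_def intro: has_vector_derivative_at_within)
qed

lemma continuous_on_Complex_compose:
  assumes "continuous_on {z. Im z > 0} H" "continuous_on S a" "continuous_on S b" "\<And>p. p \<in> S \<Longrightarrow> b p > 0"
  shows "continuous_on S (\<lambda>p. H (Complex (a p) (b p)))"
proof (rule continuous_on_compose2[OF assms(1)])
  show "continuous_on S (\<lambda>p. Complex (a p) (b p))"
    unfolding Complex_eq using assms(2,3) by (intro continuous_intros)
qed (use assms(4) in auto)

text \<open>A function that is at least e on a half-line has infinite integral. The points R and -R
  are treated together because both vertical sides of a rectangle have to be small at once.\<close>

lemma liminf_zero_of_nn_integrable:
  fixes V :: "real \<Rightarrow> ennreal"
  assumes [measurable]: "V \<in> borel_measurable borel" and V: "(\<integral>\<^sup>+R. V R \<partial>lborel) < \<infinity>" and e: "e > (0::real)"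
  shows "\<exists>R\<ge>R0. V R + V (- R) < ennreal e"
proof (rule ccontr)
  assume "\<not> ?thesis"
  then have ge: "V R + V (- R) \<ge> ennreal e" if "R \<ge> R0" for R using that by (auto simp: not_less)
  have "(\<integral>\<^sup>+R. V (- R) \<partial>lborel) = (\<integral>\<^sup>+R. V R \<partial>lborel)"
    using nn_integral_real_affine[of V "-1" 0] by simp
  then have fin: "(\<integral>\<^sup>+R. V R + V (- R) \<partial>lborel) < \<infinity>"
    using V by (subst nn_integral_add) auto
  have top: "emeasure lborel {R0..} = \<infinity>"
  proof (rule ccontr)
    assume "\<not> ?thesis"
    then obtain n where n: "emeasure lborel {R0..} < of_nat n"
      using ennreal_Ex_less_of_nat by (auto simp: less_top)
    have "ennreal (real n) = emeasure lborel {R0..R0 + real n}" by simp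
    also have "\<dots> \<le> emeasure lborel {R0..}" by (intro emeasure_mono) auto
    finally show False using n by (simp add: ennreal_of_nat_eq_real_of_nat)
  qed
  have "\<infinity> = (\<integral>\<^sup>+R. ennreal e * indicator {R0..} R \<partial>lborel)"
    using e by (simp add: nn_integral_cmult_indicator top ennreal_mult_top)
  also have "\<dots> \<le> (\<integral>\<^sup>+R. V R + V (- R) \<partial>lborel)"
    using ge by (intro nn_integral_mono) (auto simp: indicator_def)
  finally show False using fin by simp
qed

text \<open>Cauchy's theorem on long rectangles: the vertical sides are integrable as functions of
  their abscissa, so they vanish along a sequence of rectangles.\<close>

lemma horizontal_integral_const:
  fixes H :: "complex \<Rightarrow> complex"
  assumes hol: "H holomorphic_on {z. Im z > 0}" and y: "0 < y1" "y1 < y2"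
    and int: "\<And>y. y1 \<le> y \<Longrightarrow> y \<le> y2 \<Longrightarrow> integrable lborel (\<lambda>x. H (Complex x y))"
    and bound: "\<And>y. y1 \<le> y \<Longrightarrow> y \<le> y2 \<Longrightarrow> (LINT x|lborel. cmod (H (Complex x y))) \<le> B"
  shows "(LINT x|lborel. H (Complex x y1)) = (LINT x|lborel. H (Complex x y2))"
proof (rule ccontr)
  assume neq: "(LINT x|lborel. H (Complex x y1)) \<noteq> (LINT x|lborel. H (Complex x y2))"
  let ?U = "{z. Im z > 0}"
  have cont: "continuous_on ?U H" using hol by (rule holomorphic_on_imp_continuous_on)
  have U: "open ?U" "convex ?U"
    by (auto simp: open_halfspace_Im_gt convex_halfspace_Im_gt)
  \<comment> \<open>A primitive on the convex half-plane replaces contour integrals: each side of a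
    rectangle becomes a difference of two values of P.\<close>
  obtain P where P: "\<And>z. z \<in> ?U \<Longrightarrow> (P has_field_derivative H z) (at z within ?U)"
    using holomorphic_convex_primitive'[OF U(2,1) hol] by blast
  have P: "(P has_field_derivative H (Complex x y)) (at (Complex x y))" if "y > 0" for x y
  proof -
    have m: "Complex x y \<in> ?U" using that by simp
    show ?thesis using P[OF m] unfolding at_within_open[OF m U(1)] .
  qed
  define h where "h x y = (indicator (UNIV \<times> {y1..y2}) (x, y) *\<^sub>R H (Complex x y))" for x y
  have hm: "(\<lambda>p. indicator (UNIV \<times> {y1..y2}) p *\<^sub>R H (Complex (fst p) (snd p))) \<in> borel_measurable (borel :: (real \<times> real) measure)"
  proof (rule borel_measurable_continuous_on_indicator)
    show "(UNIV \<times> {y1..y2} :: (real \<times> real) set) \<in> sets borel"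
      by (intro borel_closed closed_Times closed_UNIV closed_atLeastAtMost)
    show "continuous_on (UNIV \<times> {y1..y2}) (\<lambda>p. H (Complex (fst p) (snd p)))"
    proof (rule continuous_on_Complex_compose[OF cont])
      show "p \<in> UNIV \<times> {y1..y2} \<Longrightarrow> snd p > 0" for p :: "real \<times> real"
        using y(1) by (cases p) simp
    qed (rule continuous_on_fst continuous_on_snd, rule continuous_on_id)+
  qed
  have [measurable]: "(\<lambda>(x, y). h x y) \<in> borel_measurable (borel \<Otimes>\<^sub>M borel)"
    using hm unfolding h_def borel_prod by (simp add: case_prod_beta')
  \<comment> \<open>\<open>V x\<close> bounds the vertical side at abscissa x; exchanging the order
    of integration bounds its integral over the line by B (y2 - y1).\<close>
  define V where "V x = (\<integral>\<^sup>+y. ennreal (cmod (h x y)) \<partial>lborel)" for x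
  have [measurable]: "V \<in> borel_measurable borel"
    unfolding V_def by measurable
  have "(\<integral>\<^sup>+x. V x \<partial>lborel) = (\<integral>\<^sup>+y. \<integral>\<^sup>+x. ennreal (cmod (h x y)) \<partial>lborel \<partial>lborel)"
    unfolding V_def by (rule lborel_pair.Fubini'[symmetric]) measurable
  also have "\<dots> \<le> (\<integral>\<^sup>+y. ennreal B * indicator {y1..y2} y \<partial>lborel)"
  proof (rule nn_integral_mono)
    fix y
    show "(\<integral>\<^sup>+x. ennreal (cmod (h x y)) \<partial>lborel) \<le> ennreal B * indicator {y1..y2} y"
    proof (cases "y \<in> {y1..y2}")
      case True
      then have "(\<integral>\<^sup>+x. ennreal (cmod (h x y)) \<partial>lborel) = (\<integral>\<^sup>+x. ennreal (cmod (H (Complex x y))) \<partial>lborel)"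
        by (simp add: h_def)
      also have "\<dots> = ennreal (LINT x|lborel. cmod (H (Complex x y)))"
        using True int by (intro nn_integral_eq_integral) auto
      also have "\<dots> \<le> ennreal B" using bound[of y] True by (intro ennreal_leI) auto
      finally show ?thesis using True by simp
    qed (simp add: h_def)
  qed
  also have "\<dots> < \<infinity>"
    using y by (subst nn_integral_cmult_indicator) (auto simp: ennreal_mult_less_top)
  finally have Vfin: "(\<integral>\<^sup>+x. V x \<partial>lborel) < \<infinity>" .
  have vertical: "ennreal (cmod (P (Complex x y2) - P (Complex x y1))) \<le> V x" for x
  proof -
    have "continuous_on {y1..y2} (\<lambda>y. \<i> * H (Complex x y))"
      using y by (intro continuous_intros continuous_on_Complex_compose[OF cont]) auto
    then have FTC: "(LINT y|lborel. indicator {y1..y2} y *\<^sub>R (\<i> * H (Complex x y))) = P (Complex x y2) - P (Complex x y1)"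
      and "integrable lborel (\<lambda>y. indicator {y1..y2} y *\<^sub>R (\<i> * H (Complex x y)))"
      using y P by (intro integral_FTC_atLeastAtMost has_vector_derivative_vertical borel_integrable_atLeastAtMost'[unfolded set_integrable_def]; auto)+
    then have "ennreal (cmod (P (Complex x y2) - P (Complex x y1))) \<le> (\<integral>\<^sup>+y. ennreal (cmod (indicator {y1..y2} y *\<^sub>R (\<i> * H (Complex x y)))) \<partial>lborel)"
      using integral_norm_bound_ennreal by metis
    also have "\<dots> = V x"
      unfolding V_def h_def by (intro nn_integral_cong) (auto simp: norm_mult indicator_def)
    finally show ?thesis .
  qed
  \<comment> \<open>The difference of the two horizontal sides, which through the primitive is
    bounded by the vertical sides at R and -R.\<close>
  define A where "A R = (LINT x|lborel. indicator {-R..R} x *\<^sub>R (H (Complex x y1) - H (Complex x y2)))" for R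
  have A_le: "ennreal (cmod (A R)) \<le> V R + V (- R)" if "R \<ge> 0" for R
  proof -
    have c: "continuous_on {-R..R} (\<lambda>x. H (Complex x yy))" if "yy > 0" for yy
      using that by (intro continuous_on_Complex_compose[OF cont] continuous_intros) auto
    have "A R = (P (Complex R y1) - P (Complex R y2)) - (P (Complex (- R) y1) - P (Complex (- R) y2))"
      unfolding A_def
      by (rule integral_FTC_atLeastAtMost)
        (use \<open>R \<ge> 0\<close> y c[of y1] c[of y2] in \<open>auto intro!: has_vector_derivative_diff has_vector_derivative_horizontal P continuous_intros\<close>)
    then have "cmod (A R) \<le> cmod (P (Complex R y2) - P (Complex R y1)) + cmod (P (Complex (- R) y2) - P (Complex (- R) y1))"
      using norm_triangle_ineq4[of "P (Complex R y1) - P (Complex R y2)" "P (Complex (- R) y1) - P (Complex (- R) y2)"]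
      by (simp add: norm_minus_commute)
    then have "ennreal (cmod (A R)) \<le> ennreal (cmod (P (Complex R y2) - P (Complex R y1))) + ennreal (cmod (P (Complex (- R) y2) - P (Complex (- R) y1)))"
      by (simp flip: ennreal_plus add: ennreal_leI)
    also have "\<dots> \<le> V R + V (- R)" by (intro add_mono vertical)
    finally show ?thesis .
  qed
  define L where "L = (LINT x|lborel. H (Complex x y1)) - (LINT x|lborel. H (Complex x y2))"
  have iH: "integrable lborel (\<lambda>x. H (Complex x y1))" "integrable lborel (\<lambda>x. H (Complex x y2))"
    using y by (auto intro: int)
  have "(A \<longlongrightarrow> (LINT x|lborel. H (Complex x y1) - H (Complex x y2))) at_top"
    unfolding A_def
  proof (rule integral_dominated_convergence_at_top[where w = "\<lambda>x. cmod (H (Complex x y1) - H (Complex x y2))"])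
    show "AE x in lborel. ((\<lambda>R. indicator {-R..R} x *\<^sub>R (H (Complex x y1) - H (Complex x y2))) \<longlongrightarrow> H (Complex x y1) - H (Complex x y2)) at_top"
    proof (intro AE_I2 tendsto_eventually)
      fix x :: real
      show "\<forall>\<^sub>F R in at_top. indicator {-R..R} x *\<^sub>R (H (Complex x y1) - H (Complex x y2)) = H (Complex x y1) - H (Complex x y2)"
        using eventually_ge_at_top[of "\<bar>x\<bar>"] by eventually_elim (auto simp: indicator_def)
    qed
  qed (use iH in \<open>auto simp: indicator_def intro!: always_eventually\<close>)
  also have "(LINT x|lborel. H (Complex x y1) - H (Complex x y2)) = L"
    unfolding L_def using iH by simp
  finally have "(A \<longlongrightarrow> L) at_top" .
  then have "((\<lambda>R. cmod (A R)) \<longlongrightarrow> cmod L) at_top" by (rule tendsto_norm)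
  moreover have "cmod L > cmod L / 2" using neq by (simp add: L_def)
  ultimately have "\<forall>\<^sub>F R in at_top. cmod (A R) > cmod L / 2" by (rule order_tendstoD)
  then obtain R0 where R0: "\<And>R. R \<ge> R0 \<Longrightarrow> cmod (A R) > cmod L / 2"
    by (auto simp: eventually_at_top_linorder)
  have "cmod L / 2 > 0" using neq by (simp add: L_def)
  from liminf_zero_of_nn_integrable[OF _ Vfin this, of "max 0 R0"]
  obtain R where R: "R \<ge> max 0 R0" "V R + V (- R) < ennreal (cmod L / 2)" by auto
  have "ennreal (cmod (A R)) < ennreal (cmod L / 2)"
    using A_le[of R] R by auto
  with R0[of R] R(1) show False by (simp add: ennreal_less_iff)
qed

text \<open>The Gaussian extends to the entire function exp(-(z - a)^2 / 2). On the line at height y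
  it is, up to a constant, again a member of the family, now with frequency -y, so its transform is
  explicit.\<close>

lemma shifted_gaussian_eq:
  "exp (- (Complex x y - of_real a)\<^sup>2 / 2) =
     (of_real (exp (y\<^sup>2 / 2)) * exp (\<i> * of_real (a * y))) * gaussian a (- y) x"
  unfolding gaussian_def Complex_eq exp_of_real[symmetric] exp_add[symmetric]
  by (rule arg_cong[where f = exp]) (simp add: power2_eq_square algebra_simps add_divide_distrib diff_divide_distrib)

text \<open>Completing the square: the weight exp(-y \<xi>) only moves the centre of the Gaussian,
  so the weighted Gaussian stays square-integrable.\<close>

lemma gaussian_shift_eq:
  "of_real (exp (y\<^sup>2 / 2)) * gaussian (- y) b \<xi> = of_real (exp (- y * \<xi>)) * gaussian 0 b \<xi>"
  unfolding gaussian_def exp_of_real[symmetric] exp_add[symmetric]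
  by (rule arg_cong[where f = exp]) (simp add: power2_eq_square algebra_simps add_divide_distrib diff_divide_distrib)

lemma l2_norm_gaussian: "l2_norm (gaussian a b) = l2_norm (gaussian a 0)"
  by (simp add: l2_norm_def norm_gaussian)

lemma fourier_int_cmult: "fourier_int (\<lambda>x. c * f x) \<xi> = c * fourier_int f \<xi>"
proof -
  have "(LINT x|lborel. exp (- \<i> * of_real (x * \<xi>)) * (c * f x)) = (LINT x|lborel. c * (exp (- \<i> * of_real (x * \<xi>)) * f x))"
    by (intro Bochner_Integration.integral_cong refl) (simp add: mult_ac)
  then show ?thesis by (simp add: fourier_int_def)
qed

section \<open>From the Hardy space to support on the negative half-line\<close>

context
  fixes F :: "complex \<Rightarrow> complex" and f :: "real \<Rightarrow> complex" and C :: real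
  assumes hol: "F holomorphic_on {z. Im z > 0}"
    and FL2: "\<And>y. y > 0 \<Longrightarrow> (\<lambda>x. F (Complex x y)) \<in> L2"
    and bound: "\<And>y. y > 0 \<Longrightarrow> l2_norm (\<lambda>x. F (Complex x y)) \<le> C"
    and f: "f \<in> L2"
    and lim: "((\<lambda>y. l2_norm (\<lambda>x. F (Complex x y) - f x)) \<longlongrightarrow> 0) (at_right 0)"
begin

text \<open>The function F(z) exp(-(z - a)^2 / 2) has horizontal integrals independent of the
  height, and as the height tends to 0 they tend to the pairing of the boundary values with the
  Gaussian. The Gaussian factor supplies the integrability of the slices that the contour argument
  asks for.\<close>

lemma hardy_weighted_integral:
  assumes y: "y > 0"
  shows "(LINT x|lborel. F (Complex x y) * exp (- (Complex x y - of_real a)\<^sup>2 / 2)) = (LINT x|lborel. f x * gaussian a 0 x)"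
proof -
  define W where "W y x = exp (- (Complex x y - of_real a)\<^sup>2 / 2)" for y x
  define c where "c y = of_real (exp (y\<^sup>2 / 2)) * exp (\<i> * of_real (a * y))" for y
  have W: "W y x = c y * gaussian a (- y) x" for y x
    unfolding W_def c_def by (rule shifted_gaussian_eq)
  have nc: "cmod (c y) = exp (y\<^sup>2 / 2)" for y by (simp add: c_def norm_mult)
  have WL2: "W y \<in> L2" for y
    unfolding W[abs_def] by (intro L2_cmult L2_gaussian)
  have const: "(LINT x|lborel. F (Complex x s) * W s x) = (LINT x|lborel. F (Complex x t) * W t x)" if st: "0 < s" "s < t" for s t
  proof -
    let ?H = "\<lambda>z. F z * exp (- (z - of_real a)\<^sup>2 / 2)"
    have "(LINT x|lborel. ?H (Complex x s)) = (LINT x|lborel. ?H (Complex x t))"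
    proof (rule horizontal_integral_const[OF _ st])
      show "?H holomorphic_on {z. Im z > 0}" by (intro holomorphic_intros hol) auto
      fix y assume y: "s \<le> y" "y \<le> t"
      then have y0: "y > 0" using st by simp
      show "integrable lborel (\<lambda>x. ?H (Complex x y))"
        using L2_mult_integrable[OF FL2[OF y0] WL2[of y]] by (simp add: W_def[abs_def])
      have "(LINT x|lborel. cmod (?H (Complex x y))) \<le> l2_norm (\<lambda>x. F (Complex x y)) * l2_norm (W y)"
        using l2_cauchy_schwarz_abs[OF FL2[OF y0] WL2[of y]] by (simp add: W_def[abs_def] norm_mult)
      also have "l2_norm (W y) = exp (y\<^sup>2 / 2) * l2_norm (gaussian a 0)"
        unfolding W[abs_def] l2_norm_cmult nc l2_norm_gaussian[of a "- y"] ..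
      also have "l2_norm (\<lambda>x. F (Complex x y)) * (exp (y\<^sup>2 / 2) * l2_norm (gaussian a 0)) \<le> C * (exp (t\<^sup>2 / 2) * l2_norm (gaussian a 0))"
        using y y0 order_trans[OF l2_norm_nonneg bound[OF y0]]
        by (intro mult_mono bound) (auto intro!: power_mono)
      finally show "(LINT x|lborel. cmod (?H (Complex x y))) \<le> C * (exp (t\<^sup>2 / 2) * l2_norm (gaussian a 0))" .
    qed
    then show ?thesis by (simp add: W_def)
  qed
  have "((\<lambda>y. LINT x|lborel. F (Complex x y) * W y x) \<longlongrightarrow> (LINT x|lborel. f x * gaussian a 0 x)) (at_right 0)"
  proof (rule l2_pairing_tendsto[OF _ f _ L2_gaussian lim])
    show "\<forall>\<^sub>F y in at_right 0. (\<lambda>x. F (Complex x y)) \<in> L2"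
      by (rule eventually_at_rightI[of 0 1]) (auto intro: FL2)
    show "((\<lambda>y. l2_norm (\<lambda>x. W y x - gaussian a 0 x)) \<longlongrightarrow> 0) (at_right 0)"
    proof (rule l2_dominated_convergence[where g = "gaussian a 0" and C = "exp (1 / 2) + 1"])
      show "W t \<in> borel_measurable borel" for t using WL2 by (rule L2_measurable)
      show "AE x in lborel. ((\<lambda>t. W t x) \<longlongrightarrow> gaussian a 0 x) (at_right 0)"
        unfolding W c_def gaussian_def by (auto intro!: AE_I2 tendsto_eq_intros)
      show "\<forall>\<^sub>F y in at_right 0. AE x in lborel. cmod (W y x - gaussian a 0 x) \<le> (exp (1 / 2) + 1) * cmod (gaussian a 0 x)"
      proof (rule eventually_at_rightI[of 0 1])
        fix y :: real assume y: "y \<in> {0<..<1}"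
        have "cmod (W y x - gaussian a 0 x) \<le> (exp (1 / 2) + 1) * cmod (gaussian a 0 x)" for x
        proof -
          have "cmod (W y x - gaussian a 0 x) \<le> cmod (W y x) + cmod (gaussian a 0 x)" by (rule norm_triangle_ineq4)
          also have "cmod (W y x) = exp (y\<^sup>2 / 2) * cmod (gaussian a 0 x)"
            by (simp add: W norm_mult nc norm_gaussian)
          also have "\<dots> \<le> exp (1 / 2) * cmod (gaussian a 0 x)"
            using y by (intro mult_right_mono) (auto simp: power_le_one)
          finally show ?thesis by (simp add: algebra_simps)
        qed
        then show "AE x in lborel. cmod (W y x - gaussian a 0 x) \<le> (exp (1 / 2) + 1) * cmod (gaussian a 0 x)" by simp
      qed simp
    qed (auto intro: L2_gaussian)
  qed (simp add: WL2)
  moreover have "((\<lambda>y. LINT x|lborel. F (Complex x y) * W y x) \<longlongrightarrow> (LINT x|lborel. F (Complex x y) * W y x)) (at_right 0)"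
    by (intro tendsto_eventually eventually_at_rightI[of 0 y]) (use const y in auto)
  ultimately show ?thesis
    unfolding W_def by (intro tendsto_unique[rotated]) auto
qed

text \<open>Moving the transform onto the Gaussian turns the height-independent pairing into an
  identity tested by all \<open>gaussian 0 (- a)\<close>. Since these separate functions, the slice
  at height y is the transform of exp(y \<xi>) times the inverse transform of f.\<close>

lemma hardy_fourier_inv_slice:
  assumes y: "y > 0"
  shows "aeeq (fourier_inv (\<lambda>x. F (Complex x y))) (\<lambda>\<xi>. of_real (exp (y * \<xi>)) * fourier_inv f \<xi>)"
proof -
  define \<psi> where "\<psi> = fourier_inv (\<lambda>x. F (Complex x y))"
  have \<psi>: "\<psi> \<in> L2" unfolding \<psi>_def by (intro fourier_inv_L2 FL2 y)
  define \<phi> where "\<phi> = fourier_inv f"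
  have \<phi>: "\<phi> \<in> L2" unfolding \<phi>_def by (intro fourier_inv_L2 f)
  have e: "of_real (exp (- y * \<xi>)) * gaussian 0 b \<xi> = of_real (exp (y\<^sup>2 / 2)) * gaussian (- y) b \<xi>" for b \<xi>
    by (rule gaussian_shift_eq[symmetric])
  have key: "(LINT \<xi>|lborel. \<psi> \<xi> * (of_real (exp (- y * \<xi>)) * gaussian 0 (- a) \<xi>)) = (LINT \<xi>|lborel. \<phi> \<xi> * gaussian 0 (- a) \<xi>)" for a
  proof -
    have "(LINT x|lborel. f x * gaussian a 0 x) = (LINT x|lborel. fourier \<phi> x * gaussian a 0 x)"
      by (rule LINT_cong_aeeq) (auto intro: f \<phi> L2_gaussian aeeq_sym[OF fourier_fourier_inv[OF f, folded \<phi>_def]])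
    also have "\<dots> = (LINT \<xi>|lborel. \<phi> \<xi> * gaussian 0 (- a) \<xi>)"
      by (rule fourier_gaussian_pairing(2)[OF \<phi>])
    finally have 1: "(LINT x|lborel. f x * gaussian a 0 x) = (LINT \<xi>|lborel. \<phi> \<xi> * gaussian 0 (- a) \<xi>)" .
    let ?c = "of_real (exp (y\<^sup>2 / 2)) * exp (\<i> * of_real (a * y))"
    have "(LINT x|lborel. f x * gaussian a 0 x) = (LINT x|lborel. F (Complex x y) * (?c * gaussian a (- y) x))"
      using hardy_weighted_integral[OF y, of a] unfolding shifted_gaussian_eq by simp
    also have "\<dots> = (LINT x|lborel. fourier \<psi> x * (?c * gaussian a (- y) x))"
      by (rule LINT_cong_aeeq)
        (auto intro!: FL2 y \<psi> L2_cmult L2_gaussian aeeq_sym[OF fourier_fourier_inv[OF FL2[OF y], folded \<psi>_def]])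
    also have "\<dots> = (LINT x|lborel. \<psi> x * fourier_int (\<lambda>x. ?c * gaussian a (- y) x) x)"
      by (intro fourier_pairing_int \<psi> L2_cmult L2_gaussian integrable_mult_right integrable_gaussian)
    also have "\<dots> = (LINT \<xi>|lborel. \<psi> \<xi> * (of_real (exp (- y * \<xi>)) * gaussian 0 (- a) \<xi>))"
    proof (intro Bochner_Integration.integral_cong refl)
      fix \<xi>
      have "fourier_int (\<lambda>x. ?c * gaussian a (- y) x) \<xi> = ?c * (exp (\<i> * of_real (a * (- y))) * gaussian (- y) (- a) \<xi>)"
        by (simp only: fourier_int_cmult fourier_int_gaussian)
      also have "\<dots> = (exp (\<i> * of_real (a * y)) * exp (\<i> * of_real (a * (- y)))) * (of_real (exp (y\<^sup>2 / 2)) * gaussian (- y) (- a) \<xi>)"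
        by (simp only: mult_ac)
      also have "exp (\<i> * of_real (a * y)) * exp (\<i> * of_real (a * (- y))) = 1"
        by (simp add: exp_add[symmetric])
      finally show "\<psi> \<xi> * fourier_int (\<lambda>x. ?c * gaussian a (- y) x) \<xi> = \<psi> \<xi> * (of_real (exp (- y * \<xi>)) * gaussian 0 (- a) \<xi>)"
        unfolding e by simp
    qed
    finally show ?thesis using 1 by simp
  qed
  \<comment> \<open>By \<open>key\<close> the Fourier integral of w vanishes at every
    frequency.\<close>
  define w where "w \<xi> = \<psi> \<xi> * (of_real (exp (- y * \<xi>)) * gaussian 0 0 \<xi>) - \<phi> \<xi> * gaussian 0 0 \<xi>" for \<xi>
  have i1: "integrable lborel (\<lambda>\<xi>. \<psi> \<xi> * (of_real (exp (- y * \<xi>)) * gaussian 0 a \<xi>))" for a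
    unfolding e by (intro L2_mult_integrable \<psi> L2_cmult L2_gaussian)
  have i2: "integrable lborel (\<lambda>\<xi>. \<phi> \<xi> * gaussian 0 a \<xi>)" for a
    by (intro L2_mult_integrable \<phi> L2_gaussian)
  have "AE \<xi> in lborel. w \<xi> = 0"
  proof (rule fourier_zero_imp_AE_zero)
    show "integrable lborel w" unfolding w_def by (rule Bochner_Integration.integrable_diff[OF i1 i2])
    fix a :: real
    have "(LINT x|lborel. w x * exp (\<i> * of_real (a * x))) =
       (LINT \<xi>|lborel. \<psi> \<xi> * (of_real (exp (- y * \<xi>)) * gaussian 0 a \<xi>) - \<phi> \<xi> * gaussian 0 a \<xi>)"
      by (intro Bochner_Integration.integral_cong refl) (simp add: w_def gaussian_def algebra_simps)
    also have "\<dots> = 0"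
      unfolding Bochner_Integration.integral_diff[OF i1 i2] using key[of "- a"] by simp
    finally show "(LINT x|lborel. w x * exp (\<i> * of_real (a * x))) = 0" .
  qed
  then have "AE \<xi> in lborel. \<psi> \<xi> = of_real (exp (y * \<xi>)) * \<phi> \<xi>"
  proof eventually_elim
    case (elim \<xi>)
    have "gaussian 0 0 \<xi> \<noteq> 0" by (simp add: gaussian_def)
    moreover have "(\<psi> \<xi> * of_real (exp (- y * \<xi>)) - \<phi> \<xi>) * gaussian 0 0 \<xi> = 0"
      using elim by (simp add: w_def algebra_simps)
    ultimately have "\<phi> \<xi> = \<psi> \<xi> * of_real (exp (- y * \<xi>))" by simp
    then show ?case by (simp add: exp_minus field_simps flip: exp_of_real)
  qed
  then show ?thesis by (simp add: aeeq_def \<psi>_def \<phi>_def)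
qed

text \<open>For \<xi> >= d the slice relation gives |\<phi>| <= exp(-d y) |\<psi>|, where \<psi> has
  the norm of the slice, at most C. Letting y tend to infinity kills this part of \<phi> for each d
  > 0.\<close>

lemma hardy_fourier_inv_support: "AE \<xi> in lborel. \<xi> > 0 \<longrightarrow> fourier_inv f \<xi> = 0"
proof -
  define \<phi> where "\<phi> = fourier_inv f"
  have \<phi>: "\<phi> \<in> L2" unfolding \<phi>_def by (intro fourier_inv_L2 f)
  have "aeeq (\<lambda>\<xi>. indicator {d..} \<xi> * \<phi> \<xi>) (\<lambda>\<xi>. 0)" if d: "d > 0" for d
  proof -
    have p: "(\<lambda>\<xi>. indicator {d..} \<xi> * \<phi> \<xi>) \<in> L2" by (intro L2_indicator \<phi>) simp
    have le: "l2_norm (\<lambda>\<xi>. indicator {d..} \<xi> * \<phi> \<xi>) \<le> C * exp (- (d * y))" if y: "y > 0" for y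
    proof -
      define \<psi> where "\<psi> = fourier_inv (\<lambda>x. F (Complex x y))"
      have \<psi>: "\<psi> \<in> L2" unfolding \<psi>_def by (intro fourier_inv_L2 FL2 y)
      have "l2_norm (\<lambda>\<xi>. indicator {d..} \<xi> * \<phi> \<xi>) \<le> l2_norm (\<lambda>\<xi>. of_real (exp (- (d * y))) * \<psi> \<xi>)"
      proof (rule l2_norm_mono[OF p L2_cmult[OF \<psi>]])
        show "AE \<xi> in lborel. cmod (indicator {d..} \<xi> * \<phi> \<xi>) \<le> cmod (of_real (exp (- (d * y))) * \<psi> \<xi>)"
          using hardy_fourier_inv_slice[OF y] unfolding aeeq_def \<psi>_def[symmetric] \<phi>_def[symmetric]
        proof eventually_elim
          case (elim \<xi>)
          show ?case
          proof (cases "\<xi> \<ge> d")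
            case True
            then have "1 \<le> exp (- (d * y)) * exp (y * \<xi>)"
              using y by (simp add: exp_add[symmetric] mult.commute[of d] mult_left_mono)
            from mult_right_mono[OF this, of "cmod (\<phi> \<xi>)"] True
            show ?thesis by (simp add: elim norm_mult mult.assoc)
          qed simp
        qed
      qed
      also have "\<dots> = exp (- (d * y)) * l2_norm \<psi>" by (simp add: l2_norm_cmult)
      also have "l2_norm \<psi> \<le> C" unfolding \<psi>_def l2_norm_fourier_inv[OF FL2[OF y]] by (rule bound[OF y])
      finally show ?thesis by (simp add: mult.commute)
    qed
    have "((\<lambda>y. C * exp (- (d * y))) \<longlongrightarrow> C * 0) at_top"
      by (intro tendsto_mult_left filterlim_compose[OF exp_at_bot])
        (use d in \<open>auto simp: filterlim_uminus_at_bot intro!: filterlim_tendsto_pos_mult_at_top[OF tendsto_const] filterlim_ident\<close>)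
    then have "l2_norm (\<lambda>\<xi>. indicator {d..} \<xi> * \<phi> \<xi>) \<le> C * 0"
      by (rule tendsto_lowerbound) (use le in \<open>auto intro!: eventually_mono[OF eventually_gt_at_top[of 0]]\<close>)
    then have "l2_norm (\<lambda>\<xi>. indicator {d..} \<xi> * \<phi> \<xi>) = 0"
      using l2_norm_nonneg[of "\<lambda>\<xi>. indicator {d..} \<xi> * \<phi> \<xi>"] by linarith
    then show ?thesis by (rule l2_norm_eq_0[OF p])
  qed
  then have "AE \<xi> in lborel. \<forall>n. indicator {inverse (real (Suc n))..} \<xi> * \<phi> \<xi> = 0"
    unfolding aeeq_def AE_all_countable by simp
  then show ?thesis
    unfolding \<phi>_def[symmetric]
  proof (eventually_elim, intro impI)
    fix \<xi> assume *: "\<forall>n. indicator {inverse (real (Suc n))..} \<xi> * \<phi> \<xi> = 0" "(0::real) < \<xi>"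
    then obtain n where "inverse (real (Suc n)) < \<xi>" using reals_Archimedean by blast
    then show "\<phi> \<xi> = 0" using *(1)[rule_format, of n] by simp
  qed
qed

text \<open>The slice relation gives the formula almost everywhere on the horizontal line through z;
  both sides are continuous there, so it holds at z itself. It allows a Laplace transform to be read
  off at individual points.\<close>

lemma hardy_laplace_ext:
  assumes z: "Im z > 0"
  shows "F z = laplace_ext (\<lambda>\<xi>. indicator {..<0} \<xi> * fourier_inv f \<xi>) z"
proof -
  define \<phi> where "\<phi> \<xi> = indicator {..<0} \<xi> * fourier_inv f \<xi>" for \<xi>
  have \<phi>: "\<phi> \<in> L2" unfolding \<phi>_def by (intro L2_indicator fourier_inv_L2 f) simp
  have \<phi>0: "\<phi> \<xi> = 0" if "\<xi> \<ge> 0" for \<xi> using that by (simp add: \<phi>_def)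
  have \<phi>_eq: "AE \<xi> in lborel. fourier_inv f \<xi> = \<phi> \<xi>"
    using hardy_fourier_inv_support AE_lborel_singleton[of 0]
    by eventually_elim (auto simp: \<phi>_def indicator_def)
  define y where "y = Im z"
  have y: "y > 0" using z by (simp add: y_def)
  define E where "E \<xi> = of_real (exp (y * \<xi>)) * \<phi> \<xi>" for \<xi>
  have E: "E \<in> L2" using L2_exp_weight(1)[OF less_imp_le[OF y] \<phi> \<phi>0] by (simp add: E_def[abs_def])
  have Ei: "integrable lborel E"
    using integrable_power_exp_neg_mult[OF y \<phi> \<phi>0, of 0] by (simp add: E_def[abs_def])
  have "aeeq (\<lambda>x. F (Complex x y)) (fourier (fourier_inv (\<lambda>x. F (Complex x y))))"
    by (rule aeeq_sym[OF fourier_fourier_inv[OF FL2[OF y]]])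
  also have "aeeq \<dots> (fourier E)"
  proof (rule fourier_aeeq[OF fourier_inv_L2[OF FL2[OF y]] E])
    show "aeeq (fourier_inv (\<lambda>x. F (Complex x y))) E"
      using hardy_fourier_inv_slice[OF y] \<phi>_eq unfolding aeeq_def
      by eventually_elim (simp add: E_def)
  qed
  also have "aeeq \<dots> (fourier_int E)" by (rule fourier_eq_fourier_int[OF E Ei])
  finally have ae: "AE x in lborel. F (Complex x y) = laplace_ext \<phi> (Complex x y)"
    by (simp add: aeeq_def laplace_ext_Complex E_def[abs_def])
  let ?S = "{x. F (Complex x y) = laplace_ext \<phi> (Complex x y)}"
  have "continuous_on UNIV (\<lambda>x. F (Complex x y))" "continuous_on UNIV (\<lambda>x. laplace_ext \<phi> (Complex x y))"
    by (rule continuous_on_Complex_compose[OF holomorphic_on_imp_continuous_on[OF hol]], rule continuous_on_id, rule continuous_on_const, rule y,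
        rule continuous_on_Complex_compose[OF holomorphic_on_imp_continuous_on[OF laplace_ext_holomorphic[OF \<phi> \<phi>0]]],
        assumption, rule continuous_on_id, rule continuous_on_const, rule y)
  then have "closed ?S" by (rule closed_Collect_eq)
  moreover have "AE x in lebesgue. x \<in> ?S"
    using AE_completion[OF ae] by simp
  ultimately have "Re z \<in> ?S" by (rule mem_closed_if_AE_lebesgue)
  then show ?thesis by (simp add: y_def \<phi>_def[abs_def])
qed

end

theorem H2_iff_fourier_inv_support:
  "f \<in> H2 \<longleftrightarrow> f \<in> L2 \<and> (AE \<xi> in lborel. \<xi> > 0 \<longrightarrow> fourier_inv f \<xi> = 0)"
proof
  assume "f \<in> H2"
  then obtain F C where *: "f \<in> L2" "F holomorphic_on {z. Im z > 0}"
    "\<And>y. y > 0 \<Longrightarrow> (\<lambda>x. F (Complex x y)) \<in> L2"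
    "\<And>y. y > 0 \<Longrightarrow> l2_norm (\<lambda>x. F (Complex x y)) \<le> C"
    "((\<lambda>y. l2_norm (\<lambda>x. F (Complex x y) - f x)) \<longlongrightarrow> 0) (at_right 0)"
    unfolding H2_def by blast
  then show "f \<in> L2 \<and> (AE \<xi> in lborel. \<xi> > 0 \<longrightarrow> fourier_inv f \<xi> = 0)"
    using hardy_fourier_inv_support[of F C f] by blast
next
  assume *: "f \<in> L2 \<and> (AE \<xi> in lborel. \<xi> > 0 \<longrightarrow> fourier_inv f \<xi> = 0)"
  then show "f \<in> H2"
    by (intro fourier_half_line_in_H2[where \<phi> = "fourier_inv f"]) (auto intro: aeeq_sym[OF fourier_fourier_inv])
qed

section \<open>The phase function\<close>

text \<open>At the poles of \<open>Gamma\<close> both \<open>1 / Gamma\<close> and the entire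
  function \<open>rGamma\<close> are 0, so the identity holds for every z and the denominator causes
  no singularities.\<close>

lemma u_nu_rGamma:
  "u_nu \<nu> z = exp (\<i> * z * of_real (ln 2)) * Gamma ((1 + of_real \<nu> + \<i> * z) / 2) * rGamma ((1 + of_real \<nu> - \<i> * z) / 2)"
  by (simp only: u_nu_def rGamma_inverse_Gamma divide_inverse)

lemma not_nonpos_Int_of_Re_pos: "Re z > 0 \<Longrightarrow> z \<notin> \<int>\<^sub>\<le>\<^sub>0"
  by (auto elim!: nonpos_Ints_cases)

lemma u_nu_meromorphic: "u_nu \<nu> meromorphic_on UNIV"
proof -
  have r: "(\<lambda>z. rGamma (g z)) meromorphic_on UNIV" if "g holomorphic_on UNIV" for g :: "complex \<Rightarrow> complex"
    by (intro analytic_on_imp_meromorphic_on) (simp add: analytic_on_open holomorphic_rGamma' that)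
  have e: "(\<lambda>z. exp (\<i> * z * of_real (ln 2))) meromorphic_on UNIV"
    by (intro analytic_on_imp_meromorphic_on analytic_intros)
  have "(\<lambda>z. exp (\<i> * z * of_real (ln 2)) / rGamma ((1 + of_real \<nu> + \<i> * z) / 2) * rGamma ((1 + of_real \<nu> - \<i> * z) / 2)) meromorphic_on UNIV"
    by (intro meromorphic_on_mult meromorphic_on_divide e r holomorphic_intros; simp)
  also have "(\<lambda>z. exp (\<i> * z * of_real (ln 2)) / rGamma ((1 + of_real \<nu> + \<i> * z) / 2) * rGamma ((1 + of_real \<nu> - \<i> * z) / 2)) = u_nu \<nu>"
    by (rule ext) (simp only: u_nu_rGamma Gamma_def divide_inverse)
  finally show ?thesis .
qed

text \<open>The condition keeps (1 + \<nu> \<plusminus> i x)/2 in the right half-plane for real x.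
  The locale stands apart from the Bessel order because the construction for \<nu> > 0 draws on the
  phase as well.\<close>

locale phase_order =
  fixes \<nu> :: real
  assumes nu_gt: "\<nu> > - 1"
begin

lemma u_nu_holomorphic: "u_nu \<nu> holomorphic_on {z. Im z < 0}"
proof -
  have "(\<lambda>z. exp (\<i> * z * of_real (ln 2)) * Gamma ((1 + of_real \<nu> + \<i> * z) / 2) * rGamma ((1 + of_real \<nu> - \<i> * z) / 2)) holomorphic_on {z. Im z < 0}"
    using nu_gt by (intro holomorphic_intros holomorphic_Gamma' holomorphic_rGamma') (auto intro!: not_nonpos_Int_of_Re_pos)
  then show ?thesis by (simp add: u_nu_rGamma[abs_def])
qed

lemma Gamma_half_nonzero: "Gamma ((1 + of_real \<nu> + \<i> * of_real x) / 2) \<noteq> (0::complex)"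
  "Gamma ((1 + of_real \<nu> - \<i> * of_real x) / 2) \<noteq> (0::complex)"
  using nu_gt by (auto simp: Gamma_eq_zero_iff intro!: not_nonpos_Int_of_Re_pos dest!: not_nonpos_Int_of_Re_pos)

lemma cnj_Gamma_half:
  "cnj (Gamma ((1 + of_real \<nu> + \<i> * of_real x) / 2)) = Gamma ((1 + of_real \<nu> - \<i> * of_real x) / 2)"
  by (simp add: cnj_Gamma)

text \<open>On the real line the two values of \<open>Gamma\<close> are conjugate to each other, and
  the exponential has modulus 1.\<close>

lemma norm_u_nu: "cmod (u_nu \<nu> (of_real x)) = 1"
proof -
  have "cmod (Gamma ((1 + of_real \<nu> - \<i> * of_real x) / 2)) = cmod (Gamma ((1 + of_real \<nu> + \<i> * of_real x) / 2))"
    by (metis cnj_Gamma_half complex_mod_cnj)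
  then show ?thesis
    using Gamma_half_nonzero[of x] by (simp add: u_nu_def norm_mult norm_divide)
qed

lemma u_nu_continuous: "continuous_on UNIV (\<lambda>x::real. u_nu \<nu> (of_real x))"
proof -
  have c: "continuous_on UNIV (\<lambda>x::real. Gamma (g x))"
    if "continuous_on UNIV g" "\<And>x. Re (g x) > 0" for g :: "real \<Rightarrow> complex"
  proof (rule continuous_on_compose2[OF continuous_on_Gamma that(1)])
    show "{z. Re z > 0} \<inter> \<int>\<^sub>\<le>\<^sub>0 = {}" using not_nonpos_Int_of_Re_pos by blast
  qed (use that(2) in auto)
  have "continuous_on UNIV (\<lambda>x::real. exp (\<i> * of_real x * of_real (ln 2)) * Gamma ((1 + of_real \<nu> + \<i> * of_real x) / 2) / Gamma ((1 + of_real \<nu> - \<i> * of_real x) / 2))"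
    using nu_gt Gamma_half_nonzero by (intro continuous_on_divide continuous_on_mult c continuous_intros) auto
  then show ?thesis by (simp add: u_nu_def)
qed

lemma u_nu_reflect: "u_nu \<nu> (- of_real x) = cnj (u_nu \<nu> (of_real x))"
  by (simp add: u_nu_def cnj_Gamma exp_cnj)

section \<open>The operator on the Fourier side\<close>

definition symbol :: "real \<Rightarrow> real \<Rightarrow> complex" where
  "symbol l x = exp (\<i> * of_real (l * x)) * u_nu \<nu> (of_real x)"

lemma norm_symbol: "cmod (symbol l x) = 1"
  by (simp add: symbol_def norm_mult norm_u_nu)

lemma symbol_measurable [measurable]: "symbol l \<in> borel_measurable borel"
  unfolding symbol_def using borel_measurable_continuous_onI[OF u_nu_continuous] by measurable

lemma symbol_reflect: "symbol l (- x) = cnj (symbol l x)"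
  using u_nu_reflect[of x] by (simp add: symbol_def exp_cnj)

lemma symbol_mult_reflect: "symbol l x * symbol l (- x) = 1"
  unfolding symbol_reflect complex_norm_square[symmetric] by (simp add: norm_symbol)

lemma L2_symbol: "f \<in> L2 \<Longrightarrow> (\<lambda>x. symbol l x * f x) \<in> L2"
  by (rule L2_mult_bounded[where C = 1]) (auto simp: norm_symbol)

text \<open>A kernel depending on \<xi> + \<eta> acts as a reflection followed by a convolution,
  hence on the Fourier side as a reflection followed by multiplication by a symbol.\<close>

definition symbol_op :: "real \<Rightarrow> (real \<Rightarrow> complex) \<Rightarrow> real \<Rightarrow> complex" where
  "symbol_op l f = fourier_inv (\<lambda>x. symbol l x * fourier f (- x))"

lemma symbol_op_arg_L2: "f \<in> L2 \<Longrightarrow> (\<lambda>x. symbol l x * fourier f (- x)) \<in> L2"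
  by (intro L2_symbol L2_reflect fourier_L2)

lemma symbol_op_L2: "f \<in> L2 \<Longrightarrow> symbol_op l f \<in> L2"
  unfolding symbol_op_def by (intro fourier_inv_L2 symbol_op_arg_L2)

lemma fourier_symbol_op: "f \<in> L2 \<Longrightarrow> aeeq (fourier (symbol_op l f)) (\<lambda>x. symbol l x * fourier f (- x))"
  unfolding symbol_op_def by (intro fourier_fourier_inv symbol_op_arg_L2)

lemma symbol_op_eqI:
  assumes f: "f \<in> L2" and g: "g \<in> L2" and eq: "aeeq (\<lambda>x. symbol l x * fourier f (- x)) (fourier g)"
  shows "aeeq (symbol_op l f) g"
  unfolding symbol_op_def
  by (rule aeeq_trans[OF fourier_inv_aeeq[OF symbol_op_arg_L2[OF f] fourier_L2[OF g] eq] fourier_inv_fourier[OF g]])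

lemma symbol_op_aeeq:
  assumes f: "f \<in> L2" and g: "g \<in> L2" and eq: "aeeq f g"
  shows "aeeq (symbol_op l f) (symbol_op l g)"
proof (rule symbol_op_eqI[OF f symbol_op_L2[OF g]])
  have "aeeq (\<lambda>x. symbol l x * fourier f (- x)) (\<lambda>x. symbol l x * fourier g (- x))"
    using aeeq_reflect[OF fourier_aeeq[OF f g eq]] unfolding aeeq_def by eventually_elim simp
  also have "aeeq \<dots> (fourier (symbol_op l g))" by (rule aeeq_sym[OF fourier_symbol_op[OF g]])
  finally show "aeeq (\<lambda>x. symbol l x * fourier f (- x)) (fourier (symbol_op l g))" .
qed

lemma symbol_op_linear:
  assumes f: "f \<in> L2" and g: "g \<in> L2"
  shows "aeeq (symbol_op l (\<lambda>x. a * f x + g x)) (\<lambda>x. a * symbol_op l f x + symbol_op l g x)"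
proof -
  have "aeeq (symbol_op l (\<lambda>x. a * f x + g x))
     (fourier_inv (\<lambda>x. a * (symbol l x * fourier f (- x)) + symbol l x * fourier g (- x)))"
    unfolding symbol_op_def
  proof (rule fourier_inv_aeeq)
    show "aeeq (\<lambda>x. symbol l x * fourier (\<lambda>x. a * f x + g x) (- x))
      (\<lambda>x. a * (symbol l x * fourier f (- x)) + symbol l x * fourier g (- x))"
      using aeeq_reflect[OF fourier_linear[OF f g, of a]] unfolding aeeq_def
      by eventually_elim (simp add: algebra_simps)
  qed (intro symbol_op_arg_L2 L2_add L2_cmult f g)+
  also have "aeeq \<dots> (\<lambda>x. a * symbol_op l f x + symbol_op l g x)"
    unfolding symbol_op_def by (intro fourier_inv_linear symbol_op_arg_L2 f g)
  finally show ?thesis .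
qed

lemma l2_norm_symbol: "l2_norm (\<lambda>x. symbol l x * f x) = l2_norm f"
  by (simp add: l2_norm_def norm_mult norm_symbol)

lemma l2_norm_symbol_op: "f \<in> L2 \<Longrightarrow> l2_norm (symbol_op l f) = l2_norm f"
  unfolding symbol_op_def
  by (subst l2_norm_fourier_inv) (auto intro: symbol_op_arg_L2 simp: l2_norm_symbol l2_norm_reflect[of "fourier f"] l2_norm_fourier)

text \<open>Two applications multiply the transform by m(x) m(-x), where m is the symbol; this is
  |m(x)|^2 = 1 because m(-x) = conj m(x).\<close>

lemma symbol_op_involution:
  assumes f: "f \<in> L2" shows "aeeq (symbol_op l (symbol_op l f)) f"
proof (rule symbol_op_eqI[OF symbol_op_L2[OF f] f])
  show "aeeq (\<lambda>x. symbol l x * fourier (symbol_op l f) (- x)) (fourier f)"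
    using aeeq_reflect[OF fourier_symbol_op[OF f, of l]] unfolding aeeq_def
  proof eventually_elim
    case (elim x)
    have "symbol l x * fourier (symbol_op l f) (- x) = (symbol l x * symbol l (- x)) * fourier f x"
      by (simp add: elim mult.assoc)
    then show ?case by (simp add: symbol_mult_reflect)
  qed
qed

text \<open>Replacing x by -x on the Fourier side moves the symbol to the second argument, again by
  m(-x) = conj m(x).\<close>

lemma symbol_op_selfadjoint:
  assumes f: "f \<in> L2" and g: "g \<in> L2"
  shows "l2_inner (symbol_op l f) g = l2_inner f (symbol_op l g)"
proof -
  have "l2_inner (symbol_op l f) g = l2_inner (\<lambda>x. symbol l x * fourier f (- x)) (fourier g)"
    unfolding symbol_op_def by (rule l2_inner_fourier_inv[OF symbol_op_arg_L2[OF f] g])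
  also have "\<dots> = l2_inner (fourier f) (\<lambda>x. symbol l x * fourier g (- x))"
    unfolding l2_inner_def
    using LINT_reflect[of "\<lambda>x. symbol l x * fourier f (- x) * cnj (fourier g x)"]
    by (simp add: symbol_reflect mult_ac)
  also have "\<dots> = l2_inner (fourier f) (fourier (symbol_op l g))"
    by (rule l2_inner_aeeq) (auto intro!: fourier_L2 f g symbol_op_arg_L2 symbol_op_L2 aeeq_sym[OF fourier_symbol_op])
  also have "\<dots> = l2_inner f (symbol_op l g)"
    by (rule plancherel[OF f symbol_op_L2[OF g]])
  finally show ?thesis .
qed

end

section \<open>Gamma integrals on the line\<close>

text \<open>The substitution t = p exp(-2 \<eta>) maps the line onto the positive half-line, with
  Jacobian 2 p exp(-2 \<eta>) in modulus; it turns Mellin integrals into integrals over the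
  line.\<close>

lemma exp_substitution:
  fixes f :: "real \<Rightarrow> complex"
  assumes [measurable]: "f \<in> borel_measurable borel" and p: "p > 0"
  shows "has_bochner_integral lborel (\<lambda>\<eta>. (2 * p * exp (- 2 * \<eta>)) *\<^sub>R f (p * exp (- 2 * \<eta>))) I \<longleftrightarrow>
    has_bochner_integral lborel (\<lambda>t. indicator {0<..} t *\<^sub>R f t) I"
proof -
  let ?g = "\<lambda>\<eta>. p * exp (- 2 * \<eta>)"
  have img: "?g ` UNIV = {0<..}"
  proof (intro equalityI subsetI)
    fix t :: real assume "t \<in> {0<..}"
    then have "t = ?g (- ln (t / p) / 2)" using p by (simp add: exp_ln)
    then show "t \<in> range ?g" by blast
  qed (use p in auto)
  have "(\<lambda>x. \<bar>- 2 * p * exp (- 2 * x)\<bar> *\<^sub>R f (?g x)) absolutely_integrable_on UNIV \<and>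
      integral UNIV (\<lambda>x. \<bar>- 2 * p * exp (- 2 * x)\<bar> *\<^sub>R f (?g x)) = I \<longleftrightarrow>
      f absolutely_integrable_on (range ?g) \<and> integral (range ?g) f = I"
    by (rule has_absolute_integral_change_of_variables_real)
      (use p in \<open>auto intro!: derivative_eq_intros injI\<close>)
  moreover have "\<bar>- 2 * p * exp (- 2 * x)\<bar> = 2 * p * exp (- 2 * x)" for x
    using p by (simp add: abs_mult)
  \<comment> \<open>The change of variables is stated for absolute gauge integrability; for Borel
    functions this is the Lebesgue integral.\<close>
  moreover have L: "h absolutely_integrable_on S \<and> integral S h = I \<longleftrightarrow> has_bochner_integral lborel (\<lambda>t. indicator S t *\<^sub>R h t) I"
    if [measurable]: "h \<in> borel_measurable borel" "S \<in> sets borel" for h :: "real \<Rightarrow> complex" and S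
  proof -
    have 1: "h absolutely_integrable_on S \<longleftrightarrow> integrable lborel (\<lambda>t. indicator S t *\<^sub>R h t)"
      unfolding set_integrable_def by (rule integrable_completion) measurable
    have 2: "integral S h = (LINT t|lborel. indicator S t *\<^sub>R h t)" if "h absolutely_integrable_on S"
    proof -
      have "integral S h = (LINT t|lebesgue. indicator S t *\<^sub>R h t)"
        using set_lebesgue_integral_eq_integral(2)[OF that] by (simp add: set_lebesgue_integral_def)
      also have "\<dots> = (LINT t|lborel. indicator S t *\<^sub>R h t)"
        by (rule integral_completion) measurable
      finally show ?thesis .
    qed
    show ?thesis using 1 2 by (auto simp: has_bochner_integral_iff)
  qed
  ultimately show ?thesis
    unfolding img by (simp add: L)
qed

text \<open>Euler's integral after t = p exp(-2 \<eta>); the factor p^{-a}/2 collects the scale and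
  the Jacobian.\<close>

lemma Gamma_integral_line:
  assumes a: "Re a > 0" and p: "p > 0"
  shows "has_bochner_integral lborel (\<lambda>\<eta>. exp (- 2 * a * of_real \<eta> - of_real (p * exp (- 2 * \<eta>))))
      (exp (- a * of_real (ln p)) * Gamma a / 2)"
proof -
  let ?f = "\<lambda>t::real. of_real t powr (a - 1) / of_real (exp t) :: complex"
  have [measurable]: "?f \<in> borel_measurable borel" by measurable
  have "has_bochner_integral lborel (\<lambda>t. indicator {0<..} t *\<^sub>R ?f t) (Gamma a)"
  proof -
    have ai: "?f absolutely_integrable_on {0<..}" by (rule absolutely_integrable_Gamma_integral'[OF a])
    then have 1: "integrable lborel (\<lambda>t. indicator {0<..} t *\<^sub>R ?f t)"
      unfolding set_integrable_def by (subst (asm) integrable_completion) measurable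
    have "integral {0<..} ?f = (LINT t|lebesgue. indicator {0<..} t *\<^sub>R ?f t)"
      using set_lebesgue_integral_eq_integral(2)[OF ai] by (simp add: set_lebesgue_integral_def)
    also have "\<dots> = (LINT t|lborel. indicator {0<..} t *\<^sub>R ?f t)"
      by (rule integral_completion) measurable
    finally show ?thesis
      using 1 integral_unique[OF Gamma_integral_complex'[OF a]] by (simp add: has_bochner_integral_iff)
  qed
  then have "has_bochner_integral lborel (\<lambda>\<eta>. (2 * p * exp (- 2 * \<eta>)) *\<^sub>R ?f (p * exp (- 2 * \<eta>))) (Gamma a)"
    by (subst exp_substitution[OF _ p]) auto
  then have "has_bochner_integral lborel (\<lambda>\<eta>. (exp (- a * of_real (ln p)) / 2) * ((2 * p * exp (- 2 * \<eta>)) *\<^sub>R ?f (p * exp (- 2 * \<eta>))))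
     ((exp (- a * of_real (ln p)) / 2) * Gamma a)"
    by (rule has_bochner_integral_mult_right)
  also have "(\<lambda>\<eta>. (exp (- a * of_real (ln p)) / 2) * ((2 * p * exp (- 2 * \<eta>)) *\<^sub>R ?f (p * exp (- 2 * \<eta>))))
     = (\<lambda>\<eta>. exp (- 2 * a * of_real \<eta> - of_real (p * exp (- 2 * \<eta>))))"
  proof (rule ext)
    fix \<eta> :: real
    let ?t = "p * exp (- 2 * \<eta>)"
    have t: "?t > 0" using p by simp
    have lnt: "ln ?t = ln p - 2 * \<eta>" using p by (simp add: ln_mult)
    have "of_real ?t * (of_real ?t powr (a - 1) :: complex) = of_real ?t powr a"
      using t by (simp add: powr_diff)
    also have "\<dots> = exp (a * of_real (ln p - 2 * \<eta>))"
      using t lnt p by (simp add: powr_def Ln_of_real del: of_real_mult)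
    finally have *: "of_real ?t * (of_real ?t powr (a - 1) :: complex) = exp (a * of_real (ln p - 2 * \<eta>))" .
    have "(exp (- a * of_real (ln p)) / 2) * ((2 * p * exp (- 2 * \<eta>)) *\<^sub>R ?f ?t) =
       exp (- a * of_real (ln p)) * (of_real ?t * (of_real ?t powr (a - 1))) / of_real (exp ?t)"
      by (simp add: scaleR_conv_of_real)
    also have "\<dots> = exp (- a * of_real (ln p)) * exp (a * of_real (ln p - 2 * \<eta>)) / exp (of_real ?t)"
      unfolding * by (simp add: exp_of_real del: of_real_mult)
    also have "\<dots> = exp (- 2 * a * of_real \<eta> - of_real ?t)"
      unfolding exp_add[symmetric] exp_diff[symmetric] by (rule arg_cong[where f = exp]) (simp add: algebra_simps)
    finally show "(exp (- a * of_real (ln p)) / 2) * ((2 * p * exp (- 2 * \<eta>)) *\<^sub>R ?f ?t) = exp (- 2 * a * of_real \<eta> - of_real ?t)" .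
  qed
  finally show ?thesis by simp
qed

section \<open>The Bessel kernel operator\<close>

lemma Gamma_integral_line_real:
  fixes a p :: real
  assumes a: "a > 0" and p: "p > 0"
  shows "has_bochner_integral lborel (\<lambda>\<eta>. exp (- 2 * a * \<eta> - p * exp (- 2 * \<eta>))) (exp (- a * ln p) * Gamma a / 2)"
proof -
  have 1: "exp (- 2 * of_real a * of_real \<eta> - of_real (p * exp (- 2 * \<eta>))) = complex_of_real (exp (- 2 * a * \<eta> - p * exp (- 2 * \<eta>)))" for \<eta>
    by (simp flip: exp_of_real)
  have 2: "exp (- of_real a * of_real (ln p)) * Gamma (complex_of_real a) / 2 = complex_of_real (exp (- a * ln p) * Gamma a / 2)"
    by (simp add: Gamma_complex_of_real flip: exp_of_real)
  show ?thesis
    using Gamma_integral_line[of "complex_of_real a" p] a p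
    unfolding 1 2 has_bochner_integral_iff complex_of_real_integrable_eq integral_complex_of_real of_real_eq_iff by simp
qed

locale bessel_order =
  fixes \<nu> :: real
  assumes \<nu>: "\<nu> > - 1 / 2"

sublocale bessel_order \<subseteq> phase_order
  using \<nu> by unfold_locales simp

context bessel_order
begin

definition bessel_coeff :: "nat \<Rightarrow> real" where
  "bessel_coeff m = 1 / (fact m * Gamma (real m + \<nu> + 1)) * 2 powr (- (2 * real m + \<nu>))"

definition bessel_kernel :: "real \<Rightarrow> real" where
  "bessel_kernel s = (\<Sum>m. (-1) ^ m * (bessel_coeff m * exp (- (2 * real m + \<nu> + 1) * s)))"

text \<open>The series without signs, that is e^{-s} I_\<nu>(e^{-s}) with the modified Bessel
  function. It grows roughly like exp(e^{-s}) as s tends to minus infinity, so exchanges of sums and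
  integrals call for a factor \<open>log_gauss\<close> or a support bounded on the left.\<close>

definition bessel_majorant :: "real \<Rightarrow> real" where
  "bessel_majorant s = (\<Sum>m. bessel_coeff m * exp (- (2 * real m + \<nu> + 1) * s))"

lemma bessel_coeff_pos: "bessel_coeff m > 0"
  using \<nu> by (auto simp: bessel_coeff_def intro!: divide_pos_pos mult_pos_pos Gamma_real_pos)

text \<open>By the functional equation of \<open>Gamma\<close> the ratio is 1/(4 (m+1) (m+\<nu>+1)),
  and \<nu> > -1/2 makes m + \<nu> + 1 at least 1/2. The resulting factorial decay beats every power
  e^{-2ms}.\<close>

lemma bessel_coeff_Suc_le: "bessel_coeff (Suc m) \<le> bessel_coeff m / (2 * (real m + 1))"
proof -
  have c: "real m + \<nu> + 1 \<ge> 1 / 2" using \<nu> by simp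
  have G: "Gamma (real (Suc m) + \<nu> + 1) = (real m + \<nu> + 1) * Gamma (real m + \<nu> + 1)"
  proof -
    have "real m + \<nu> + 1 \<notin> \<int>\<^sub>\<le>\<^sub>0" using c by (auto dest!: nonpos_Ints_nonpos)
    moreover have "real (Suc m) + \<nu> + 1 = (real m + \<nu> + 1) + 1" by simp
    ultimately show ?thesis using Gamma_plus1 by metis
  qed
  have p: "2 powr (- (2 * real (Suc m) + \<nu>)) = 2 powr (- (2 * real m + \<nu>)) * 2 powr (-2::real)"
    by (simp flip: powr_add add: algebra_simps)
  have "bessel_coeff (Suc m) = bessel_coeff m / (4 * (real m + 1) * (real m + \<nu> + 1))"
    unfolding bessel_coeff_def G p by (simp add: powr_minus field_simps)
  also have "\<dots> \<le> bessel_coeff m / (2 * (real m + 1))"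
  proof (rule divide_left_mono)
    have "2 * (real m + 1) * 1 \<le> 2 * (real m + 1) * (2 * (real m + \<nu> + 1))"
      using c by (intro mult_left_mono) auto
    then show "2 * (real m + 1) \<le> 4 * (real m + 1) * (real m + \<nu> + 1)" by (simp add: algebra_simps)
    show "0 < 4 * (real m + 1) * (real m + \<nu> + 1) * (2 * (real m + 1))"
      using c by (intro mult_pos_pos) auto
  qed (use bessel_coeff_pos[of m] in simp)
  finally show ?thesis .
qed

lemma bessel_coeff_le: "bessel_coeff m \<le> bessel_coeff 0 * ((1 / 2) ^ m / fact m)"
proof (induction m)
  case (Suc m)
  have "bessel_coeff (Suc m) \<le> bessel_coeff m / (2 * (real m + 1))" by (rule bessel_coeff_Suc_le)
  also have "\<dots> \<le> bessel_coeff 0 * ((1 / 2) ^ m / fact m) / (2 * (real m + 1))"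
    by (intro divide_right_mono Suc) auto
  also have "\<dots> = bessel_coeff 0 * ((1 / 2) ^ Suc m / fact (Suc m))" by (simp add: field_simps)
  finally show ?case .
qed simp

lemma summable_bessel: "summable (\<lambda>m. bessel_coeff m * exp (- (2 * real m + \<nu> + 1) * s))"
proof (rule summable_comparison_test')
  show "summable (\<lambda>m. (bessel_coeff 0 * exp (- (\<nu> + 1) * s)) * (inverse (fact m) * (exp (- 2 * s) / 2) ^ m))"
    by (intro summable_mult summable_exp)
  fix m :: nat
  have "exp (- (2 * real m + \<nu> + 1) * s) = exp (- (\<nu> + 1) * s) * exp (- 2 * s) ^ m"
    by (simp add: exp_add[symmetric] exp_of_nat_mult[symmetric] algebra_simps)
  then have "norm (bessel_coeff m * exp (- (2 * real m + \<nu> + 1) * s)) = bessel_coeff m * (exp (- (\<nu> + 1) * s) * exp (- 2 * s) ^ m)"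
    using bessel_coeff_pos[of m] by (simp add: abs_mult)
  also have "\<dots> \<le> bessel_coeff 0 * ((1 / 2) ^ m / fact m) * (exp (- (\<nu> + 1) * s) * exp (- 2 * s) ^ m)"
    by (intro mult_right_mono bessel_coeff_le) auto
  also have "\<dots> = (bessel_coeff 0 * exp (- (\<nu> + 1) * s)) * (inverse (fact m) * (exp (- 2 * s) / 2) ^ m)"
    by (simp add: power_divide field_simps)
  finally show "norm (bessel_coeff m * exp (- (2 * real m + \<nu> + 1) * s))
     \<le> (bessel_coeff 0 * exp (- (\<nu> + 1) * s)) * (inverse (fact m) * (exp (- 2 * s) / 2) ^ m)" .
qed

lemma summable_bessel_alternating: "summable (\<lambda>m. norm ((-1) ^ m * (bessel_coeff m * exp (- (2 * real m + \<nu> + 1) * s))))"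
  using summable_bessel[of s] bessel_coeff_pos by (simp add: abs_mult less_imp_le)

lemma bessel_kernel_le: "\<bar>bessel_kernel s\<bar> \<le> bessel_majorant s"
proof -
  have "norm (bessel_kernel s) \<le> (\<Sum>m. norm ((-1) ^ m * (bessel_coeff m * exp (- (2 * real m + \<nu> + 1) * s))))"
    unfolding bessel_kernel_def by (rule summable_norm[OF summable_bessel_alternating])
  also have "\<dots> = bessel_majorant s"
    unfolding bessel_majorant_def using bessel_coeff_pos by (simp add: abs_mult less_imp_le)
  finally show ?thesis by simp
qed

lemma bessel_kernel_measurable [measurable]: "bessel_kernel \<in> borel_measurable borel"
  unfolding bessel_kernel_def by measurable

lemma bessel_majorant_measurable [measurable]: "bessel_majorant \<in> borel_measurable borel"
  unfolding bessel_majorant_def by measurable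

lemma G_kernel_eq: "G_kernel \<nu> l \<xi> \<eta> = of_real (bessel_kernel (l + \<xi> + \<eta>))"
proof -
  define s where "s = l + \<xi> + \<eta>"
  have t: "exp (- s) * ((-1) ^ m / (fact m * Gamma (real m + \<nu> + 1)) * (exp (- s) / 2) powr (2 * real m + \<nu>)) =
     (-1) ^ m * (bessel_coeff m * exp (- (2 * real m + \<nu> + 1) * s))" for m
  proof -
    have "(exp (- s) / 2) powr (2 * real m + \<nu>) = exp (- (2 * real m + \<nu>) * s) * 2 powr (- (2 * real m + \<nu>))"
    proof -
      have 1: "ln (exp (- s) / 2) = - s - ln 2" by (simp add: ln_div)
      have 2: "(exp (- s) / 2) powr c = exp (c * ln (exp (- s) / 2))" "2 powr c = exp (c * ln 2)" for c :: real
        by (simp_all add: powr_def)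
      show ?thesis
        unfolding 2 1 exp_add[symmetric] by (rule arg_cong[where f = exp]) (simp add: algebra_simps)
    qed
    moreover have "exp (- (2 * real m + \<nu> + 1) * s) = exp (- s) * exp (- (2 * real m + \<nu>) * s)"
      by (simp add: exp_add[symmetric] algebra_simps)
    ultimately show ?thesis by (simp add: bessel_coeff_def field_simps)
  qed
  have "exp (- s) * besselJ \<nu> (exp (- s)) = (\<Sum>m. exp (- s) * ((-1) ^ m / (fact m * Gamma (real m + \<nu> + 1)) * (exp (- s) / 2) powr (2 * real m + \<nu>)))"
    unfolding besselJ_def
  proof (rule suminf_mult[symmetric])
    have "summable (\<lambda>m. exp (- s) * ((-1) ^ m / (fact m * Gamma (real m + \<nu> + 1)) * (exp (- s) / 2) powr (2 * real m + \<nu>)))"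
      unfolding t by (rule summable_norm_cancel[OF summable_bessel_alternating])
    then show "summable (\<lambda>m. (-1) ^ m / (fact m * Gamma (real m + \<nu> + 1)) * (exp (- s) / 2) powr (2 * real m + \<nu>))"
      by (rule summable_mult_D) simp
  qed
  also have "\<dots> = bessel_kernel s" unfolding t bessel_kernel_def ..
  finally have 1: "exp (- s) * besselJ \<nu> (exp (- s)) = bessel_kernel s" .
  have 2: "- l - \<xi> - \<eta> = - s" by (simp add: s_def)
  show ?thesis unfolding G_kernel_def 2 1 unfolding s_def ..
qed

text \<open>With s = e^{-\<xi>} this is s^{\<nu>+1} e^{-p s^2}, the family that the Hankel transform
  of order \<nu> permutes up to constants.\<close>

definition log_gauss :: "real \<Rightarrow> real \<Rightarrow> real" where
  "log_gauss p \<xi> = exp (- (\<nu> + 1) * \<xi> - p * exp (- 2 * \<xi>))"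

lemma log_gauss_pos [simp]: "log_gauss p \<xi> > 0" "log_gauss p \<xi> \<ge> 0" "log_gauss p \<xi> \<noteq> 0"
  by (simp_all add: log_gauss_def)

lemma log_gauss_measurable [measurable]: "log_gauss p \<in> borel_measurable borel"
  unfolding log_gauss_def by measurable

lemma log_gauss_L2: assumes p: "p > 0" shows "(\<lambda>\<xi>. complex_of_real (log_gauss p \<xi>)) \<in> L2"
proof (rule L2_I)
  have "(cmod (complex_of_real (log_gauss p \<xi>)))\<^sup>2 = exp (- 2 * (\<nu> + 1) * \<xi> - (2 * p) * exp (- 2 * \<xi>))" for \<xi>
    by (simp add: log_gauss_def power2_eq_square exp_add[symmetric] algebra_simps)
  then show "integrable lborel (\<lambda>\<xi>. (cmod (complex_of_real (log_gauss p \<xi>)))\<^sup>2)"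
    using Gamma_integral_line_real[of "\<nu> + 1" "2 * p"] \<nu> p by (simp add: has_bochner_integral_iff)
qed measurable

lemma log_gauss_integrable: assumes p: "p > 0" shows "integrable lborel (\<lambda>\<xi>. complex_of_real (log_gauss p \<xi>))"
proof -
  have "log_gauss p \<xi> = exp (- 2 * ((\<nu> + 1) / 2) * \<xi> - p * exp (- 2 * \<xi>))" for \<xi>
    by (simp add: log_gauss_def)
  then show ?thesis
    using Gamma_integral_line_real[of "(\<nu> + 1) / 2" p] \<nu> p by (simp add: has_bochner_integral_iff)
qed

lemma fourier_int_log_gauss:
  assumes p: "p > 0"
  shows "fourier_int (\<lambda>\<xi>. complex_of_real (log_gauss p \<xi>)) x =
    (1 / sqrt (2 * pi)) * (exp (- ((1 + of_real \<nu> + \<i> * of_real x) / 2) * of_real (ln p)) * Gamma ((1 + of_real \<nu> + \<i> * of_real x) / 2) / 2)"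
proof -
  let ?a = "(1 + of_real \<nu> + \<i> * of_real x) / 2"
  have "exp (- \<i> * of_real (\<xi> * x)) * complex_of_real (log_gauss p \<xi>) = exp (- 2 * ?a * of_real \<xi> - of_real (p * exp (- 2 * \<xi>)))" for \<xi>
    unfolding log_gauss_def exp_of_real[symmetric] exp_add[symmetric]
    by (rule arg_cong[where f = exp]) (simp add: algebra_simps flip: exp_of_real)
  moreover have "Re ?a > 0" using \<nu> by simp
  ultimately show ?thesis
    using has_bochner_integral_integral_eq[OF Gamma_integral_line[OF _ p, of ?a]] by (simp only: fourier_int_def)
qed

text \<open>The value predicted by Weber's integral: the parameter p becomes e^{-2l}/(4p), and the
  prefactor is (2 p e^l)^{-(\<nu>+1)}.\<close>

definition log_gauss_image :: "real \<Rightarrow> real \<Rightarrow> real \<Rightarrow> real" where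
  "log_gauss_image l p \<eta> = exp (- (\<nu> + 1) * (l + ln 2 + ln p)) * log_gauss (exp (- 2 * l) / (4 * p)) \<eta>"

text \<open>The transform at -x carries Gamma((1+\<nu>-ix)/2), which cancels the denominator of
  \<open>u_nu\<close> and leaves Gamma((1+\<nu>+ix)/2), the factor in the transform of
  \<open>log_gauss\<close> with the new parameter.\<close>

lemma symbol_op_log_gauss:
  assumes p: "p > 0"
  shows "aeeq (symbol_op l (\<lambda>\<xi>. of_real (log_gauss p \<xi>))) (\<lambda>\<eta>. of_real (log_gauss_image l p \<eta>))"
proof -
  let ?p = "exp (- 2 * l) / (4 * p)" and ?A = "exp (- (\<nu> + 1) * (l + ln 2 + ln p))"
  have p': "?p > 0" using p by simp
  have im: "complex_of_real (log_gauss_image l p \<eta>) = of_real ?A * of_real (log_gauss ?p \<eta>)" for \<eta>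
    by (simp add: log_gauss_image_def)
  have L2: "(\<lambda>\<eta>. complex_of_real (log_gauss_image l p \<eta>)) \<in> L2"
    unfolding im by (intro L2_cmult log_gauss_L2 p')
  have int: "integrable lborel (\<lambda>\<eta>. complex_of_real (log_gauss_image l p \<eta>))"
    unfolding im by (intro integrable_mult_right log_gauss_integrable p')
  have eq: "symbol l x * fourier_int (\<lambda>\<xi>. complex_of_real (log_gauss p \<xi>)) (- x) = fourier_int (\<lambda>\<eta>. complex_of_real (log_gauss_image l p \<eta>)) x" for x
  proof -
    define a where "a = (1 + of_real \<nu> + \<i> * complex_of_real x) / 2"
    define b where "b = (1 + of_real \<nu> - \<i> * complex_of_real x) / 2"
    have Gb: "Gamma b \<noteq> 0" unfolding b_def by (rule Gamma_half_nonzero)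
    have lnp: "ln ?p = - 2 * l - 2 * ln 2 - ln p"
    proof -
      have "ln ?p = - 2 * l - (ln 4 + ln p)" using p by (simp add: ln_div ln_mult)
      moreover have "ln (4::real) = 2 * ln 2" using ln_realpow[of "2::real" 2] by simp
      ultimately show ?thesis by simp
    qed
    have "symbol l x * fourier_int (\<lambda>\<xi>. complex_of_real (log_gauss p \<xi>)) (- x) =
       (1 / sqrt (2 * pi)) * (exp (\<i> * of_real (l * x)) * exp (\<i> * of_real x * of_real (ln 2)) * exp (- b * of_real (ln p)) * Gamma a / 2)"
    proof -
      have "fourier_int (\<lambda>\<xi>. complex_of_real (log_gauss p \<xi>)) (- x) = (1 / sqrt (2 * pi)) * (exp (- b * of_real (ln p)) * Gamma b / 2)"
        using fourier_int_log_gauss[OF p, of "- x"] by (simp add: b_def)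
      then show ?thesis
        unfolding symbol_def u_nu_def a_def[symmetric] b_def[symmetric] using Gb by simp
    qed
    \<comment> \<open>The exponents agree because a + b = 1 + \<nu> and a - b = i x.\<close>
    also have "exp (\<i> * of_real (l * x)) * exp (\<i> * of_real x * of_real (ln 2)) * exp (- b * of_real (ln p)) =
      of_real ?A * exp (- a * of_real (ln ?p))"
      unfolding lnp exp_of_real[symmetric] exp_add[symmetric]
      by (rule arg_cong[where f = exp]) (simp add: a_def b_def field_simps)
    also have "(1 / sqrt (2 * pi)) * (of_real ?A * exp (- a * of_real (ln ?p)) * Gamma a / 2) =
       of_real ?A * fourier_int (\<lambda>\<xi>. complex_of_real (log_gauss ?p \<xi>)) x"
      unfolding fourier_int_log_gauss[OF p'] a_def[symmetric] by simp
    also have "\<dots> = fourier_int (\<lambda>\<eta>. complex_of_real (log_gauss_image l p \<eta>)) x"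
      unfolding im fourier_int_cmult ..
    finally show ?thesis .
  qed
  show ?thesis
  proof (rule symbol_op_eqI[OF log_gauss_L2[OF p] L2])
    show "aeeq (\<lambda>x. symbol l x * fourier (\<lambda>\<xi>. complex_of_real (log_gauss p \<xi>)) (- x)) (fourier (\<lambda>\<eta>. complex_of_real (log_gauss_image l p \<eta>)))"
      using aeeq_reflect[OF fourier_eq_fourier_int[OF log_gauss_L2[OF p] log_gauss_integrable[OF p]]]
        fourier_eq_fourier_int[OF L2 int]
      unfolding aeeq_def by eventually_elim (simp only: eq)
  qed
qed

text \<open>The integral produces Gamma(m+\<nu>+1), which cancels the one in
  \<open>bessel_coeff\<close>; what remains is a term of an exponential series.\<close>

lemma bessel_term_integral:
  assumes p: "p > 0"
  shows "has_bochner_integral lborel (\<lambda>\<eta>. bessel_coeff m * exp (- (2 * real m + \<nu> + 1) * (s + \<eta>)) * log_gauss p \<eta>)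
    (exp (- (\<nu> + 1) * (s + ln 2 + ln p)) * ((exp (- 2 * s) / (4 * p)) ^ m / fact m))"
proof -
  have a: "real m + \<nu> + 1 > 0" using \<nu> by simp
  let ?c = "bessel_coeff m * exp (- (2 * real m + \<nu> + 1) * s)"
  have 1: "bessel_coeff m * exp (- (2 * real m + \<nu> + 1) * (s + \<eta>)) * log_gauss p \<eta>
     = ?c * exp (- 2 * (real m + \<nu> + 1) * \<eta> - p * exp (- 2 * \<eta>))" for \<eta>
    unfolding log_gauss_def by (simp add: exp_add[symmetric] algebra_simps)
  have G: "Gamma (real m + \<nu> + 1) \<noteq> 0" using Gamma_real_pos[OF a] by simp
  have ln4: "ln (4 * p) = 2 * ln 2 + ln p"
  proof -
    have "ln (4::real) = 2 * ln 2" using ln_realpow[of "2::real" 2] by simp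
    then show ?thesis using p by (simp add: ln_mult)
  qed
  have q: "exp (- 2 * s) / (4 * p) = exp (- 2 * s - 2 * ln 2 - ln p)"
  proof -
    have "exp (- 2 * s - 2 * ln 2 - ln p) = exp (- 2 * s - ln (4 * p))"
      unfolding ln4 by (rule arg_cong[where f = exp]) simp
    then show ?thesis using p by (simp add: exp_diff)
  qed
  have "?c * (exp (- (real m + \<nu> + 1) * ln p) * Gamma (real m + \<nu> + 1) / 2) =
     (exp (- (2 * real m + \<nu>) * ln 2) * exp (- (2 * real m + \<nu> + 1) * s) * exp (- (real m + \<nu> + 1) * ln p) * exp (- ln 2)) / fact m"
    using G by (simp add: bessel_coeff_def powr_def exp_minus field_simps)
  also have "\<dots> = exp (- (\<nu> + 1) * (s + ln 2 + ln p)) * (exp (- 2 * s - 2 * ln 2 - ln p)) ^ m / fact m"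
    unfolding exp_add[symmetric] exp_of_nat_mult[symmetric]
    by (rule arg_cong[where f = "\<lambda>x. exp x / fact m"]) (simp add: algebra_simps)
  finally have 2: "?c * (exp (- (real m + \<nu> + 1) * ln p) * Gamma (real m + \<nu> + 1) / 2) =
     exp (- (\<nu> + 1) * (s + ln 2 + ln p)) * ((exp (- 2 * s) / (4 * p)) ^ m / fact m)"
    unfolding q by simp
  show ?thesis
    unfolding 1 2[symmetric] by (intro has_bochner_integral_mult_right Gamma_integral_line_real a p)
qed

lemma log_gauss_image_eq:
  "log_gauss_image l p \<eta> = exp (- (\<nu> + 1) * (l + \<eta> + ln 2 + ln p)) * exp (- (exp (- 2 * (l + \<eta>)) / (4 * p)))"
proof -
  have "exp (- 2 * (l + \<eta>)) / (4 * p) = exp (- 2 * l) / (4 * p) * exp (- 2 * \<eta>)"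
  proof -
    have "exp (- 2 * (l + \<eta>)) = exp (- 2 * l) * exp (- 2 * \<eta>)"
      unfolding exp_add[symmetric] by (simp add: algebra_simps)
    then show ?thesis by simp
  qed
  then show ?thesis
    unfolding log_gauss_image_def log_gauss_def exp_add[symmetric]
    by (intro arg_cong[where f = exp]) (simp add: algebra_simps)
qed

text \<open>Weber's integral by termwise integration. With q = e^{-2s}/(4p), the integrals of the
  terms without signs sum to a multiple of exp(q); their finiteness justifies the exchange with
  signs, where the sum is the same multiple of exp(-q).\<close>

lemma bessel_majorant_integral:
  assumes p: "p > 0"
  shows "has_bochner_integral lborel (\<lambda>\<eta>. bessel_majorant (s + \<eta>) * log_gauss p \<eta>)
    (exp (- (\<nu> + 1) * (s + ln 2 + ln p)) * exp (exp (- 2 * s) / (4 * p)))" (is ?thesis1)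
  and bessel_kernel_integral:
    "has_bochner_integral lborel (\<lambda>\<eta>. bessel_kernel (s + \<eta>) * log_gauss p \<eta>)
    (exp (- (\<nu> + 1) * (s + ln 2 + ln p)) * exp (- (exp (- 2 * s) / (4 * p))))" (is ?thesis2)
proof -
  define B where "B = exp (- (\<nu> + 1) * (s + ln 2 + ln p))"
  define q where "q = exp (- 2 * s) / (4 * p)"
  define t where "t m \<eta> = bessel_coeff m * exp (- (2 * real m + \<nu> + 1) * (s + \<eta>)) * log_gauss p \<eta>" for m \<eta>
  have t_nonneg: "t m \<eta> \<ge> 0" for m \<eta> unfolding t_def using bessel_coeff_pos[of m] by simp
  have t_int: "has_bochner_integral lborel (t m) (B * (q ^ m / fact m))" for m
    unfolding t_def B_def q_def by (rule bessel_term_integral[OF p])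
  have ti: "integrable lborel (t m)" "(LINT \<eta>|lborel. t m \<eta>) = B * (q ^ m / fact m)" for m
    using t_int[of m] by (auto simp: has_bochner_integral_iff)
  have ser: "(\<lambda>m. x ^ m / fact m) sums exp x" for x :: real
    using exp_converges[of x] by (simp add: scaleR_conv_of_real divide_inverse mult.commute)
  \<comment> \<open>One computation for both series: e = 1 gives the majorant, e = -1 the
    kernel.\<close>
  have gen: "has_bochner_integral lborel (\<lambda>\<eta>. (\<Sum>m. e ^ m * t m \<eta>)) (B * exp (e * q))" if e: "\<bar>e\<bar> = 1" for e :: real
  proof -
    have i: "integrable lborel (\<lambda>\<eta>. e ^ m * t m \<eta>)" for m using ti(1) by simp
    have n: "norm (e ^ m * t m \<eta>) = t m \<eta>" for m \<eta>
      using t_nonneg[of m \<eta>] e by (simp add: abs_mult power_abs)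
    have s1: "AE \<eta> in lborel. summable (\<lambda>m. norm (e ^ m * t m \<eta>))"
      unfolding n unfolding t_def by (intro AE_I2 summable_mult2 summable_bessel)
    have s2: "summable (\<lambda>m. LINT \<eta>|lborel. norm (e ^ m * t m \<eta>))"
      unfolding n ti(2) using ser[of q] by (intro summable_mult) (auto simp: sums_iff)
    have "(LINT \<eta>|lborel. (\<Sum>m. e ^ m * t m \<eta>)) = (\<Sum>m. LINT \<eta>|lborel. e ^ m * t m \<eta>)"
      by (rule integral_suminf[OF i s1 s2])
    also have "\<dots> = (\<Sum>m. B * ((e * q) ^ m / fact m))"
      by (simp add: ti(2) power_mult_distrib mult_ac)
    also have "\<dots> = B * exp (e * q)"
      using sums_mult[OF ser[of "e * q"], of B] by (simp add: sums_iff)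
    finally show ?thesis
      using integrable_suminf[OF i s1 s2] by (simp add: has_bochner_integral_iff)
  qed
  have "(\<Sum>m. 1 ^ m * t m \<eta>) = bessel_majorant (s + \<eta>) * log_gauss p \<eta>" for \<eta>
    unfolding t_def bessel_majorant_def by (simp only: suminf_mult2[OF summable_bessel] power_one mult_1)
  then show ?thesis1 using gen[of 1] by (simp add: B_def q_def)
  have "(\<Sum>m. (-1) ^ m * t m \<eta>) = bessel_kernel (s + \<eta>) * log_gauss p \<eta>" for \<eta>
    unfolding t_def bessel_kernel_def
    by (simp only: suminf_mult2[OF summable_norm_cancel[OF summable_bessel_alternating]] mult.assoc)
  then show ?thesis2 using gen[of "-1"] by (simp add: B_def q_def)
qed

end

section \<open>The kernel integral and the symbol define the same operator\<close>

context bessel_order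
begin

definition kernel_int :: "real \<Rightarrow> (real \<Rightarrow> complex) \<Rightarrow> real \<Rightarrow> complex" where
  "kernel_int l f \<xi> = (LINT \<eta>|lborel. of_real (bessel_kernel (l + \<xi> + \<eta>)) * f \<eta>)"

text \<open>For \<eta> >= -R the growing factor is bounded by its value at -R, and inserting the
  factor exp(-e^{-2\<eta>}) of \<open>log_gauss 1\<close> costs at most exp(e^{2R}). The outcome is
  a square-integrable majorant.\<close>

lemma L2_log_gauss_bound:
  assumes p: "p > 0" and \<eta>: "\<eta> \<ge> - R"
  shows "exp (- (\<nu> + 1) * (l + \<eta> + ln 2 + ln p)) * exp (exp (- 2 * (l + \<eta>)) / (4 * p))
    \<le> exp (- (\<nu> + 1) * (l + ln 2 + ln p) + exp (- 2 * (l - R)) / (4 * p) + exp (2 * R)) * log_gauss 1 \<eta>"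
proof -
  have "exp (- 2 * (l + \<eta>)) \<le> exp (- 2 * (l - R))" "exp (- 2 * \<eta>) \<le> exp (2 * R)" using \<eta> by auto
  moreover from this(1) have "exp (- 2 * (l + \<eta>)) / (4 * p) \<le> exp (- 2 * (l - R)) / (4 * p)"
    using p by (intro divide_right_mono) auto
  moreover have "- (\<nu> + 1) * (l + \<eta> + ln 2 + ln p) = - (\<nu> + 1) * (l + ln 2 + ln p) + - (\<nu> + 1) * \<eta>"
    by (simp add: algebra_simps)
  ultimately have "- (\<nu> + 1) * (l + \<eta> + ln 2 + ln p) + exp (- 2 * (l + \<eta>)) / (4 * p)
     \<le> - (\<nu> + 1) * (l + ln 2 + ln p) + exp (- 2 * (l - R)) / (4 * p) + exp (2 * R) + (- (\<nu> + 1) * \<eta> - 1 * exp (- 2 * \<eta>))"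
    by linarith
  then show ?thesis
    unfolding log_gauss_def exp_add[symmetric] exp_le_cancel_iff .
qed

context
  fixes l R p :: real and f :: "real \<Rightarrow> complex"
  assumes f: "f \<in> L2" and supp: "\<And>\<eta>. \<eta> < - R \<Longrightarrow> f \<eta> = 0" and p: "p > 0"
begin

text \<open>Integrating the majorant in \<xi> first gives |f(\<eta>)| times a function that blows up
  as \<eta> tends to minus infinity. The support of f, bounded on the left, reduces it to a multiple
  of \<open>log_gauss 1\<close>, and a product of two square-integrable functions is
  integrable.\<close>

lemma kernel_product_integrable:
  "integrable (lborel \<Otimes>\<^sub>M lborel) (\<lambda>(\<eta>, \<xi>). of_real (log_gauss p \<xi>) * (of_real (bessel_kernel (l + \<xi> + \<eta>)) * f \<eta>))"
proof (rule lborel_pair.Fubini_integrable)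
  have [measurable]: "f \<in> borel_measurable borel" using f by (rule L2_measurable)
  let ?h = "\<lambda>(\<eta>, \<xi>). of_real (log_gauss p \<xi>) * (of_real (bessel_kernel (l + \<xi> + \<eta>)) * f \<eta>)"
  let ?M = "\<lambda>\<eta>. exp (- (\<nu> + 1) * (l + \<eta> + ln 2 + ln p)) * exp (exp (- 2 * (l + \<eta>)) / (4 * p))"
  define C where "C = exp (- (\<nu> + 1) * (l + ln 2 + ln p) + exp (- 2 * (l - R)) / (4 * p) + exp (2 * R))"
  show "?h \<in> borel_measurable (lborel \<Otimes>\<^sub>M lborel)" by measurable
  have maj: "has_bochner_integral lborel (\<lambda>\<xi>. bessel_majorant (l + \<xi> + \<eta>) * log_gauss p \<xi>) (?M \<eta>)" for \<eta>
    using bessel_majorant_integral[OF p, of "l + \<eta>"] by (simp add: add_ac)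
  have hb: "norm (?h (\<eta>, \<xi>)) \<le> cmod (f \<eta>) * (bessel_majorant (l + \<xi> + \<eta>) * log_gauss p \<xi>)" for \<eta> \<xi>
    using mult_left_mono[OF mult_right_mono[OF bessel_kernel_le[of "l + \<xi> + \<eta>"], of "log_gauss p \<xi>"], of "cmod (f \<eta>)"]
    by (simp add: norm_mult mult_ac)
  have int: "integrable lborel (\<lambda>\<xi>. ?h (\<eta>, \<xi>))" for \<eta>
  proof (rule Bochner_Integration.integrable_bound)
    show "integrable lborel (\<lambda>\<xi>. cmod (f \<eta>) * (bessel_majorant (l + \<xi> + \<eta>) * log_gauss p \<xi>))"
      using maj[of \<eta>] by (intro integrable_mult_right) (simp add: has_bochner_integral_iff)
    show "AE \<xi> in lborel. norm (?h (\<eta>, \<xi>)) \<le> norm (cmod (f \<eta>) * (bessel_majorant (l + \<xi> + \<eta>) * log_gauss p \<xi>))"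
      using order_trans[OF hb abs_ge_self] by (intro AE_I2) simp
    show "(\<lambda>\<xi>. ?h (\<eta>, \<xi>)) \<in> borel_measurable lborel" unfolding prod.case by measurable
  qed
  then show "AE \<eta> in lborel. integrable lborel (\<lambda>\<xi>. ?h (\<eta>, \<xi>))" by simp
  show "integrable lborel (\<lambda>\<eta>. LINT \<xi>|lborel. norm (?h (\<eta>, \<xi>)))"
  proof (rule Bochner_Integration.integrable_bound)
    show "integrable lborel (\<lambda>\<eta>. C *\<^sub>R (f \<eta> * of_real (log_gauss 1 \<eta>)))"
      by (intro integrable_scaleR_right L2_mult_integrable f log_gauss_L2) simp
    have "(LINT \<xi>|lborel. norm (?h (\<eta>, \<xi>))) \<le> C * (cmod (f \<eta>) * log_gauss 1 \<eta>)" for \<eta>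
    proof (cases "\<eta> < - R")
      case True
      then show ?thesis by (simp add: supp)
    next
      case False
      have "(LINT \<xi>|lborel. norm (?h (\<eta>, \<xi>))) \<le> (LINT \<xi>|lborel. cmod (f \<eta>) * (bessel_majorant (l + \<xi> + \<eta>) * log_gauss p \<xi>))"
        using maj[of \<eta>] by (intro integral_mono integrable_norm int integrable_mult_right hb) (simp add: has_bochner_integral_iff)
      also have "\<dots> = cmod (f \<eta>) * ?M \<eta>"
        using maj[of \<eta>] by (simp add: has_bochner_integral_iff)
      also have "\<dots> \<le> cmod (f \<eta>) * (C * log_gauss 1 \<eta>)"
        using L2_log_gauss_bound[OF p, of R \<eta> l] False unfolding C_def by (intro mult_left_mono) auto
      finally show ?thesis by (simp add: mult_ac)
    qed
    then show "AE \<eta> in lborel. norm (LINT \<xi>|lborel. norm (?h (\<eta>, \<xi>))) \<le> norm (C *\<^sub>R (f \<eta> * of_real (log_gauss 1 \<eta>)))"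
      by (intro AE_I2) (simp add: norm_mult C_def)
  qed measurable
qed

lemma kernel_int_integrable: "AE \<xi> in lborel. integrable lborel (\<lambda>\<eta>. of_real (bessel_kernel (l + \<xi> + \<eta>)) * f \<eta>)"
proof -
  from lborel_pair.AE_integrable_fst'[OF lborel_pair.integrable_product_swap[OF kernel_product_integrable]]
  have "AE \<xi> in lborel. integrable lborel (\<lambda>\<eta>. of_real (log_gauss p \<xi>) * (of_real (bessel_kernel (l + \<xi> + \<eta>)) * f \<eta>))"
    by simp
  then show ?thesis
  proof eventually_elim
    case (elim \<xi>)
    from integrable_mult_right[OF this, of "inverse (of_real (log_gauss p \<xi>))"]
    show ?case by (simp flip: mult.assoc)
  qed
qed

text \<open>Fubini: as the kernel depends on \<xi> + \<eta>, integrating it against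
  \<open>log_gauss p\<close> in \<xi> is Weber's integral at l + \<eta>.\<close>

lemma kernel_int_log_gauss:
  "has_bochner_integral lborel (\<lambda>\<xi>. of_real (log_gauss p \<xi>) * kernel_int l f \<xi>) (LINT \<eta>|lborel. f \<eta> * of_real (log_gauss_image l p \<eta>))"
proof -
  let ?h = "\<lambda>\<eta> \<xi>. of_real (log_gauss p \<xi>) * (of_real (bessel_kernel (l + \<xi> + \<eta>)) * f \<eta>)"
  have int: "integrable lborel (\<lambda>\<xi>. LINT \<eta>|lborel. ?h \<eta> \<xi>)"
    using lborel_pair.integrable_fst'[OF lborel_pair.integrable_product_swap[OF kernel_product_integrable]] by simp
  have "(LINT \<xi>|lborel. LINT \<eta>|lborel. ?h \<eta> \<xi>) = (LINT \<eta>|lborel. LINT \<xi>|lborel. ?h \<eta> \<xi>)"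
    by (rule lborel_pair.Fubini_integral[OF kernel_product_integrable])
  also have "\<dots> = (LINT \<eta>|lborel. f \<eta> * of_real (log_gauss_image l p \<eta>))"
  proof (intro Bochner_Integration.integral_cong refl)
    fix \<eta>
    have "(LINT \<xi>|lborel. bessel_kernel (l + \<xi> + \<eta>) * log_gauss p \<xi>) = log_gauss_image l p \<eta>"
      using bessel_kernel_integral[OF p, of "l + \<eta>"] unfolding log_gauss_image_eq by (simp add: has_bochner_integral_iff add_ac)
    then have "complex_of_real (log_gauss_image l p \<eta>) = (LINT \<xi>|lborel. of_real (bessel_kernel (l + \<xi> + \<eta>) * log_gauss p \<xi>))"
      by (simp only: integral_complex_of_real)
    then have "f \<eta> * of_real (log_gauss_image l p \<eta>) = (LINT \<xi>|lborel. f \<eta> * of_real (bessel_kernel (l + \<xi> + \<eta>) * log_gauss p \<xi>))"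
      by (simp only: integral_mult_right_zero)
    also have "\<dots> = (LINT \<xi>|lborel. ?h \<eta> \<xi>)"
      by (intro Bochner_Integration.integral_cong refl) (simp add: mult_ac)
    finally show "(LINT \<xi>|lborel. ?h \<eta> \<xi>) = f \<eta> * of_real (log_gauss_image l p \<eta>)" ..
  qed
  finally show ?thesis
    using int by (simp add: has_bochner_integral_iff kernel_int_def)
qed

end

text \<open>Both functions have the same integrals against every \<open>log_gauss p\<close>: for the
  symbol by self-adjointness and its action on \<open>log_gauss\<close>, for the kernel by Fubini.
  The parameters p = 1 + m give all moments of the weighted difference in the variable
  exp(-e^{-2\<xi>}), which is injective with values between 0 and 1.\<close>

lemma symbol_op_eq_kernel_int:
  assumes f: "f \<in> L2" and supp: "\<And>\<eta>. \<eta> < - R \<Longrightarrow> f \<eta> = 0"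
  shows "aeeq (symbol_op l f) (kernel_int l f)"
proof -
  have [measurable]: "f \<in> borel_measurable borel" using f by (rule L2_measurable)
  define D where "D \<xi> = symbol_op l f \<xi> - kernel_int l f \<xi>" for \<xi>
  have D: "has_bochner_integral lborel (\<lambda>\<xi>. D \<xi> * of_real (log_gauss p \<xi>)) 0" if p: "p > 0" for p
  proof -
    let ?g = "\<lambda>\<xi>. complex_of_real (log_gauss p \<xi>)"
    have "(LINT \<xi>|lborel. symbol_op l f \<xi> * ?g \<xi>) = l2_inner (symbol_op l f) ?g"
      by (simp add: l2_inner_def)
    also have "\<dots> = l2_inner f (symbol_op l ?g)"
      by (rule symbol_op_selfadjoint[OF f log_gauss_L2[OF p]])
    also have "\<dots> = l2_inner f (\<lambda>\<eta>. of_real (log_gauss_image l p \<eta>))"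
    proof (rule l2_inner_aeeq)
      show "aeeq (symbol_op l ?g) (\<lambda>\<eta>. complex_of_real (log_gauss_image l p \<eta>))"
        by (rule symbol_op_log_gauss[OF p])
      show "(\<lambda>\<eta>. complex_of_real (log_gauss_image l p \<eta>)) \<in> L2"
        unfolding log_gauss_image_def of_real_mult using p by (intro L2_cmult log_gauss_L2) simp
    qed (auto intro: f symbol_op_L2 log_gauss_L2 p)
    also have "\<dots> = (LINT \<eta>|lborel. f \<eta> * of_real (log_gauss_image l p \<eta>))"
      by (simp add: l2_inner_def)
    finally have "has_bochner_integral lborel (\<lambda>\<xi>. symbol_op l f \<xi> * ?g \<xi>) (LINT \<eta>|lborel. f \<eta> * of_real (log_gauss_image l p \<eta>))"
      using L2_mult_integrable[OF symbol_op_L2[OF f] log_gauss_L2[OF p]] by (simp add: has_bochner_integral_iff)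
    from has_bochner_integral_diff[OF this kernel_int_log_gauss[where R = R and l = l, OF f supp p]]
    show ?thesis by (simp add: D_def algebra_simps)
  qed
  define w where "w \<xi> = D \<xi> * of_real (log_gauss 1 \<xi>)" for \<xi>
  have "AE \<xi> in lborel. w \<xi> = 0"
  proof (rule moments_zero_imp_AE_zero[where \<theta> = "\<lambda>\<xi>. exp (- exp (- 2 * \<xi>))" and \<rho> = "\<lambda>t. - ln (- ln t) / 2"])
    show "integrable lborel w" using D[of 1] by (simp add: w_def[abs_def] has_bochner_integral_iff)
    fix m :: nat
    have "w \<xi> * of_real (exp (- exp (- 2 * \<xi>)) ^ m) = D \<xi> * of_real (log_gauss (1 + real m) \<xi>)" for \<xi>
    proof -
      have "log_gauss 1 \<xi> * exp (- exp (- 2 * \<xi>)) ^ m = log_gauss (1 + real m) \<xi>"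
        unfolding log_gauss_def exp_of_nat_mult[symmetric] exp_add[symmetric] by (simp add: algebra_simps)
      then show ?thesis unfolding w_def by (metis mult.assoc of_real_mult)
    qed
    then show "(LINT \<xi>|lborel. w \<xi> * of_real (exp (- exp (- 2 * \<xi>)) ^ m)) = 0"
      using D[of "1 + real m"] by (simp only: has_bochner_integral_iff)
  qed auto
  then show ?thesis
    unfolding aeeq_def by eventually_elim (simp add: w_def D_def)
qed

section \<open>Existence and uniqueness of the operator with the Bessel kernel\<close>

lemma kernel_op_symbol_op: "kernel_op (G_kernel \<nu> l) (symbol_op l)"
  unfolding kernel_op_def
proof (intro conjI ballI allI impI)
  show "\<exists>C. \<forall>f\<in>L2. l2_norm (symbol_op l f) \<le> C * l2_norm f"
    by (intro exI[of _ 1]) (simp add: l2_norm_symbol_op)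
  fix f assume f: "f \<in> L2" and "\<exists>R. \<forall>x. \<bar>x\<bar> > R \<longrightarrow> f x = 0"
  then obtain R where R: "\<And>x. \<bar>x\<bar> > R \<Longrightarrow> f x = 0" by blast
  have supp: "f \<eta> = 0" if "\<eta> < - R" for \<eta> using that by (intro R) auto
  have "AE \<xi> in lborel. integrable lborel (\<lambda>\<eta>. of_real (bessel_kernel (l + \<xi> + \<eta>)) * f \<eta>)"
    using kernel_int_integrable[where R = R and l = l and p = 1, OF f supp] by simp
  moreover have "AE \<xi> in lborel. symbol_op l f \<xi> = kernel_int l f \<xi>"
    using symbol_op_eq_kernel_int[where R = R, OF f supp] by (simp add: aeeq_def)
  ultimately show "AE \<xi> in lborel. integrable lborel (\<lambda>\<eta>. G_kernel \<nu> l \<xi> \<eta> * f \<eta>) \<and> symbol_op l f \<xi> = (LINT \<eta>|lborel. G_kernel \<nu> l \<xi> \<eta> * f \<eta>)"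
    by eventually_elim (simp add: G_kernel_eq kernel_int_def)
qed (auto intro: symbol_op_L2 symbol_op_aeeq symbol_op_linear)

text \<open>The kernel prescribes values on compactly supported functions only; boundedness of both
  operators and density of the truncations extend the agreement. Statements about an arbitrary
  operator with this kernel thus reduce to \<open>symbol_op\<close>.\<close>

lemma kernel_op_unique:
  assumes G: "kernel_op (G_kernel \<nu> l) G" and f: "f \<in> L2"
  shows "aeeq (G f) (symbol_op l f)"
proof -
  let ?T = "\<lambda>n x. indicator {- real n..real n} x * f x"
  have T: "?T n \<in> L2" for n by (intro L2_indicator f) simp
  have G_L2: "G h \<in> L2" if "h \<in> L2" for h using G that unfolding kernel_op_def by blast
  have G_lin: "aeeq (G (\<lambda>x. a * h x + k x)) (\<lambda>x. a * G h x + G k x)" if "h \<in> L2" "k \<in> L2" for a h k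
    using G that unfolding kernel_op_def by blast
  obtain C where C: "\<And>h. h \<in> L2 \<Longrightarrow> l2_norm (G h) \<le> C * l2_norm h"
    using G unfolding kernel_op_def by blast
  \<comment> \<open>Linearity holds only almost everywhere, which suffices inside a norm.\<close>
  have lin_diff: "l2_norm (\<lambda>x. A (?T n) x - A f x) = l2_norm (A (\<lambda>x. ?T n x - f x))"
    if A: "\<And>h. h \<in> L2 \<Longrightarrow> A h \<in> L2" and lin: "\<And>a h k. h \<in> L2 \<Longrightarrow> k \<in> L2 \<Longrightarrow> aeeq (A (\<lambda>x. a * h x + k x)) (\<lambda>x. a * A h x + A k x)"
    for A n
  proof (rule l2_norm_aeeq)
    show "aeeq (\<lambda>x. A (?T n) x - A f x) (A (\<lambda>x. ?T n x - f x))"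
      using aeeq_sym[OF lin[OF f T[of n], of "-1"]] by simp
  qed (intro L2_measurable L2_diff A f T)+
  have "(\<lambda>n. l2_norm (\<lambda>x. G (?T n) x - G f x)) \<longlonglongrightarrow> 0"
  proof (rule Lim_null_comparison)
    show "(\<lambda>n. C * l2_norm (\<lambda>x. ?T n x - f x)) \<longlonglongrightarrow> 0"
      using tendsto_mult_left[OF L2_truncate_tendsto[OF f], of C] by simp
    show "\<forall>\<^sub>F n in sequentially. norm (l2_norm (\<lambda>x. G (?T n) x - G f x)) \<le> C * l2_norm (\<lambda>x. ?T n x - f x)"
      using C[OF L2_diff[OF T f]] by (simp add: lin_diff[of G, OF G_L2 G_lin])
  qed
  moreover have "(\<lambda>n. l2_norm (\<lambda>x. G (?T n) x - symbol_op l f x)) \<longlonglongrightarrow> 0"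
  proof -
    have "l2_norm (\<lambda>x. G (?T n) x - symbol_op l f x) = l2_norm (\<lambda>x. ?T n x - f x)" for n
    proof -
      have sT: "\<exists>R. \<forall>x. \<bar>x\<bar> > R \<longrightarrow> ?T n x = 0" by (intro exI[of _ "real n"]) (auto simp: indicator_def)
      have k: "AE \<xi> in lborel. H (?T n) \<xi> = (LINT \<eta>|lborel. G_kernel \<nu> l \<xi> \<eta> * ?T n \<eta>)"
        if "kernel_op (G_kernel \<nu> l) H" for H
      proof -
        have "\<forall>f\<in>L2. (\<exists>R. \<forall>x. \<bar>x\<bar> > R \<longrightarrow> f x = 0) \<longrightarrow>
           (AE \<xi> in lborel. integrable lborel (\<lambda>\<eta>. G_kernel \<nu> l \<xi> \<eta> * f \<eta>) \<and> H f \<xi> = (LINT \<eta>|lborel. G_kernel \<nu> l \<xi> \<eta> * f \<eta>))"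
          using that unfolding kernel_op_def by (elim conjE)
        from this[THEN bspec, OF T[of n], THEN mp, OF sT] show ?thesis by eventually_elim simp
      qed
      have "l2_norm (\<lambda>x. G (?T n) x - symbol_op l f x) = l2_norm (\<lambda>x. symbol_op l (?T n) x - symbol_op l f x)"
      proof (rule l2_norm_aeeq)
        show "aeeq (\<lambda>x. G (?T n) x - symbol_op l f x) (\<lambda>x. symbol_op l (?T n) x - symbol_op l f x)"
          using k[OF G] k[OF kernel_op_symbol_op] unfolding aeeq_def by eventually_elim simp
      qed (intro L2_measurable L2_diff G_L2 symbol_op_L2 T f)+
      also have "\<dots> = l2_norm (symbol_op l (\<lambda>x. ?T n x - f x))"
        by (rule lin_diff[OF symbol_op_L2 symbol_op_linear])
      also have "\<dots> = l2_norm (\<lambda>x. ?T n x - f x)" by (intro l2_norm_symbol_op L2_diff T f)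
      finally show ?thesis .
    qed
    then show ?thesis using L2_truncate_tendsto[OF f] by simp
  qed
  ultimately show ?thesis
    by (intro l2_limit_unique[where F = sequentially and X = "\<lambda>n. G (?T n)"])
      (auto intro!: always_eventually G_L2 T f symbol_op_L2)
qed

end

text \<open>A nonempty open interval is not a null set; a statement valid almost everywhere can
  therefore be used at points of any such interval.\<close>

lemma AE_ex_in_interval:
  assumes ae: "AE x::real in lborel. P x" and "b < c" shows "\<exists>x. b < x \<and> x < c \<and> P x"
proof (rule ccontr)
  assume "\<not> ?thesis"
  then have "AE x in lborel. x \<notin> {b<..<c}"
    using ae by (auto elim!: eventually_mono)
  then have "{b<..<c} \<in> null_sets lborel"
    by (intro AE_iff_null_sets[THEN iffD2]) auto
  then show False using \<open>b < c\<close> by (simp add: null_sets_def)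
qed

section \<open>Trivial intersection\<close>

context bessel_order
begin

text \<open>For \<xi> > 0 the kernel integral is e^{-(\<nu>+1)\<xi>} S(e^{-2\<xi>}), where the
  coefficients of the power series S are the moments of \<phi> times nonzero numbers. S vanishes at
  points arbitrarily close to 0, so every coefficient is 0.\<close>

lemma kernel_int_vanish_half_line:
  assumes \<phi>: "\<phi> \<in> L2" and supp: "\<And>\<eta>. \<eta> \<le> 0 \<Longrightarrow> \<phi> \<eta> = 0"
    and zero: "AE \<xi> in lborel. \<xi> > 0 \<longrightarrow> kernel_int 0 \<phi> \<xi> = 0"
  shows "aeeq \<phi> (\<lambda>x. 0)"
proof -
  have [measurable]: "\<phi> \<in> borel_measurable borel" using \<phi> by (rule L2_measurable)
  define e where "e m \<eta> = of_real (exp (- (2 * real m + \<nu> + 1) * \<eta>)) * \<phi> \<eta>" for m \<eta>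
  \<comment> \<open>On \<eta> > 0 one has e^{-2\<eta>} <= 1, so the constant \<open>exp 1\<close>
    makes up for the inner exponential of \<open>log_gauss 1\<close>, and one b dominates every
    \<open>e m\<close>.\<close>
  define b where "b \<eta> = exp 1 * cmod (of_real (log_gauss 1 \<eta>) * \<phi> \<eta>)" for \<eta>
  have bi: "integrable lborel b"
    unfolding b_def by (intro integrable_mult_right integrable_norm L2_mult_integrable log_gauss_L2 \<phi>) simp
  have b_nonneg: "b \<eta> \<ge> 0" for \<eta> unfolding b_def by simp
  have [measurable]: "e m \<in> borel_measurable borel" for m unfolding e_def by measurable
  have eb: "cmod (e m \<eta>) \<le> b \<eta>" for m \<eta>
  proof (cases "\<eta> > 0")
    case True
    have "(2 * real m + \<nu> + 1) * \<eta> \<ge> (\<nu> + 1) * \<eta>" using True by (intro mult_right_mono) auto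
    moreover have "exp (- 2 * \<eta>) \<le> 1" using True by simp
    ultimately have "- (2 * real m + \<nu> + 1) * \<eta> \<le> 1 + (- (\<nu> + 1) * \<eta> - 1 * exp (- 2 * \<eta>))"
      by (simp only: minus_mult_left[symmetric] mult_1)
    then have "exp (- (2 * real m + \<nu> + 1) * \<eta>) \<le> exp 1 * log_gauss 1 \<eta>"
      unfolding log_gauss_def exp_add[symmetric] exp_le_cancel_iff .
    from mult_right_mono[OF this, of "cmod (\<phi> \<eta>)"] show ?thesis
      by (simp add: e_def b_def norm_mult mult.assoc)
  qed (use supp in \<open>simp add: e_def b_def\<close>)
  have ei: "integrable lborel (e m)" for m
    by (rule Bochner_Integration.integrable_bound[OF bi]) (use eb order_trans[OF eb abs_ge_self] in auto)
  define M where "M m = (LINT \<eta>|lborel. e m \<eta>)" for m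
  have M_le: "cmod (M m) \<le> (LINT \<eta>|lborel. b \<eta>)" for m
    unfolding M_def by (rule order_trans[OF integral_norm_bound integral_mono]) (use ei bi eb in auto)
  define c where "c m = (-1) ^ m * of_real (bessel_coeff m) * M m" for m
  have expand: "kernel_int 0 \<phi> \<xi> = (\<Sum>m. of_real (exp (- (2 * real m + \<nu> + 1) * \<xi>)) * c m)" if "\<xi> > 0" for \<xi>
  proof -
    define k where "k m = complex_of_real ((-1) ^ m * (bessel_coeff m * exp (- (2 * real m + \<nu> + 1) * \<xi>)))" for m
    have kn: "cmod (k m) = bessel_coeff m * exp (- (2 * real m + \<nu> + 1) * \<xi>)" for m
      unfolding k_def using bessel_coeff_pos[of m] by (simp add: norm_mult norm_power)
    have ks: "summable (\<lambda>m. cmod (k m))" unfolding kn by (rule summable_bessel)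
    have "of_real (bessel_kernel (0 + \<xi> + \<eta>)) * \<phi> \<eta> = (\<Sum>m. k m * e m \<eta>)" for \<eta>
    proof -
      have t: "complex_of_real ((-1) ^ m * (bessel_coeff m * exp (- (2 * real m + \<nu> + 1) * (\<xi> + \<eta>)))) * \<phi> \<eta> = k m * e m \<eta>" for m
      proof -
        have "exp (- (2 * real m + \<nu> + 1) * (\<xi> + \<eta>)) = exp (- (2 * real m + \<nu> + 1) * \<xi>) * exp (- (2 * real m + \<nu> + 1) * \<eta>)"
          unfolding exp_add[symmetric] by (simp add: algebra_simps)
        then show ?thesis unfolding k_def e_def by (simp only: of_real_mult mult_ac)
      qed
      have s: "summable (\<lambda>m. (-1) ^ m * (bessel_coeff m * exp (- (2 * real m + \<nu> + 1) * (\<xi> + \<eta>))))"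
        by (rule summable_norm_cancel[OF summable_bessel_alternating])
      have "of_real (bessel_kernel (\<xi> + \<eta>)) = (\<Sum>m. complex_of_real ((-1) ^ m * (bessel_coeff m * exp (- (2 * real m + \<nu> + 1) * (\<xi> + \<eta>)))))"
        unfolding bessel_kernel_def by (rule suminf_of_real[OF s])
      then show ?thesis
        using suminf_mult2[OF summable_of_real[OF s], of "\<phi> \<eta>"] by (simp only: t add_0)
    qed
    then have "kernel_int 0 \<phi> \<xi> = (LINT \<eta>|lborel. (\<Sum>m. k m * e m \<eta>))"
      by (simp only: kernel_int_def)
    also have "\<dots> = (\<Sum>m. LINT \<eta>|lborel. k m * e m \<eta>)"
    proof (rule integral_suminf)
      show "integrable lborel (\<lambda>\<eta>. k m * e m \<eta>)" for m using ei by simp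
      have le: "norm (k m * e m \<eta>) \<le> cmod (k m) * b \<eta>" for m \<eta>
        using eb[of m \<eta>] by (simp add: norm_mult mult_left_mono)
      show "AE \<eta> in lborel. summable (\<lambda>m. norm (k m * e m \<eta>))"
        by (intro AE_I2 summable_comparison_test'[OF summable_mult2[OF ks]]) (use le in auto)
      have "(LINT \<eta>|lborel. norm (k m * e m \<eta>)) \<le> cmod (k m) * (LINT \<eta>|lborel. b \<eta>)" for m
      proof -
        have "(LINT \<eta>|lborel. norm (k m * e m \<eta>)) \<le> (LINT \<eta>|lborel. cmod (k m) * b \<eta>)"
          using ei bi le by (intro integral_mono) auto
        then show ?thesis by simp
      qed
      then show "summable (\<lambda>m. LINT \<eta>|lborel. norm (k m * e m \<eta>))"
        by (intro summable_comparison_test'[OF summable_mult2[OF ks]]) auto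
    qed
    also have "\<dots> = (\<Sum>m. of_real (exp (- (2 * real m + \<nu> + 1) * \<xi>)) * c m)"
      by (simp add: k_def c_def M_def mult_ac)
    finally show ?thesis .
  qed
  have c_sum: "summable (\<lambda>m. cmod (c m))"
  proof (rule summable_comparison_test')
    show "summable (\<lambda>m. bessel_coeff m * (LINT \<eta>|lborel. b \<eta>))"
      using summable_mult2[OF summable_bessel[of 0]] by simp
    show "norm (cmod (c m)) \<le> bessel_coeff m * (LINT \<eta>|lborel. b \<eta>)" for m
      using M_le[of m] bessel_coeff_pos[of m] by (simp add: c_def norm_mult norm_power mult_left_mono)
  qed
  define S where "S x = (\<Sum>m. c m * x ^ m)" for x :: complex
  have S: "(\<lambda>m. c m * x ^ m) sums S x" if "cmod x < 1" for x
    unfolding S_def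
  proof (rule summable_sums, rule summable_comparison_test'[OF c_sum])
    show "norm (c m * x ^ m) \<le> cmod (c m)" for m
      using that by (simp add: norm_mult norm_power mult_left_le power_le_one)
  qed
  have S0: "AE \<xi> in lborel. \<xi> > 0 \<longrightarrow> S (of_real (exp (- 2 * \<xi>))) = 0"
    using zero
  proof eventually_elim
    case (elim \<xi>)
    show ?case
    proof
      assume \<xi>: "\<xi> > 0"
      let ?x = "complex_of_real (exp (- 2 * \<xi>))"
      have t: "of_real (exp (- (2 * real m + \<nu> + 1) * \<xi>)) * c m = of_real (exp (- (\<nu> + 1) * \<xi>)) * (c m * ?x ^ m)" for m
      proof -
        have "exp (- (2 * real m + \<nu> + 1) * \<xi>) = exp (- (\<nu> + 1) * \<xi>) * exp (- 2 * \<xi>) ^ m"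
          unfolding exp_of_nat_mult[symmetric] exp_add[symmetric] by (simp add: algebra_simps)
        then show ?thesis by (simp only: of_real_mult of_real_power mult_ac)
      qed
      have "(\<lambda>m. c m * ?x ^ m) sums S ?x" using \<xi> by (intro S) (simp add: norm_exp_eq_Re)
      from sums_mult[OF this, of "of_real (exp (- (\<nu> + 1) * \<xi>))"]
      have "kernel_int 0 \<phi> \<xi> = of_real (exp (- (\<nu> + 1) * \<xi>)) * S ?x"
        unfolding expand[OF \<xi>] t by (simp only: sums_iff)
      then show "S ?x = 0" using elim \<xi> by simp
    qed
  qed
  have c0: "c m = 0" for m
  proof (rule ccontr)
    assume "c m \<noteq> 0"
    \<comment> \<open>The series is shifted by one, to z S(z): the theorem on isolated zeros asks
      for a function vanishing at the centre with a nonzero coefficient of positive index.\<close>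
    define a where "a n = (case n of 0 \<Rightarrow> 0 | Suc k \<Rightarrow> c k)" for n
    have sums: "(\<lambda>n. a n * (x - 0) ^ n) sums (x * S x)" if "cmod (x - 0) < 1" for x
    proof -
      have "(\<lambda>m. x * (c m * x ^ m)) sums (x * S x)" using that by (intro sums_mult S) simp
      then have "(\<lambda>n. a (Suc n) * x ^ Suc n) sums (x * S x)" by (simp add: a_def mult_ac)
      then show ?thesis by (subst (asm) sums_Suc_iff) (simp add: a_def)
    qed
    have "\<exists>s>0. \<forall>z\<in>cball 0 s - {0}. z * S z \<noteq> 0"
    proof (rule powser_0_nonzero[of 1 0 a "\<lambda>x. x * S x" "Suc m"])
      show "a (Suc m) \<noteq> 0" using \<open>c m \<noteq> 0\<close> by (simp add: a_def)
      show "(\<lambda>n. a n * (x - 0) ^ n) sums (x * S x)" if "cmod (x - 0) < 1" for x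
        using that by (rule sums)
      fix s :: real
      assume "0 < s" "\<And>z. z \<in> cball 0 s - {0} \<Longrightarrow> z * S z \<noteq> 0"
      then show ?thesis by (intro exI[of _ s] conjI ballI)
    qed (rule zero_less_one mult_zero_left zero_less_Suc)+
    then obtain s where s: "0 < s" "\<forall>z\<in>cball 0 s - {0}. z * S z \<noteq> 0" by (elim exE conjE)
    \<comment> \<open>Beyond t one has \<xi> > 0 and e^{-2\<xi>} < s.\<close>
    define t where "t = max 0 (- ln s / 2)"
    obtain \<xi> where \<xi>: "t < \<xi>" "\<xi> > 0 \<longrightarrow> S (of_real (exp (- 2 * \<xi>))) = 0"
      using AE_ex_in_interval[OF S0, of t "t + 1"] by auto
    have "- ln s / 2 < \<xi>" using \<xi>(1) by (simp add: t_def)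
    then have "- 2 * \<xi> < ln s" by simp
    then have "exp (- 2 * \<xi>) < exp (ln s)" by (simp only: exp_less_cancel_iff)
    then have "exp (- 2 * \<xi>) \<le> s" using s(1) by simp
    then have "complex_of_real (exp (- 2 * \<xi>)) \<in> cball 0 s - {0}" by (simp add: norm_exp_eq_Re)
    from bspec[OF s(2) this] \<xi> show False by (simp add: t_def)
  qed
  have M0: "M m = 0" for m using c0[of m] bessel_coeff_pos[of m] by (simp add: c_def)
  have "AE \<eta> in lborel. e 0 \<eta> = 0"
  proof (rule moments_zero_imp_AE_zero[where \<theta> = "\<lambda>\<eta>. exp (- 2 * \<eta>)" and \<rho> = "\<lambda>t. - ln t / 2"])
    show "integrable lborel (e 0)" by (rule ei)
    show "e 0 \<eta> \<noteq> 0 \<Longrightarrow> \<bar>exp (- 2 * \<eta>)\<bar> \<le> 1" for \<eta>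
      using supp[of \<eta>] by (cases "\<eta> \<le> 0") (auto simp: e_def)
    have "e 0 \<eta> * of_real (exp (- 2 * \<eta>) ^ m) = e m \<eta>" for m \<eta>
    proof -
      have "e 0 \<eta> * of_real (exp (- 2 * \<eta>) ^ m) = of_real (exp (- (2 * real 0 + \<nu> + 1) * \<eta>) * exp (- 2 * \<eta>) ^ m) * \<phi> \<eta>"
        unfolding e_def of_real_mult by (simp only: mult_ac)
      also have "exp (- (2 * real 0 + \<nu> + 1) * \<eta>) * exp (- 2 * \<eta>) ^ m = exp (- (2 * real m + \<nu> + 1) * \<eta>)"
        unfolding exp_of_nat_mult[symmetric] exp_add[symmetric] by (simp add: algebra_simps)
      finally show ?thesis unfolding e_def .
    qed
    then show "(LINT \<eta>|lborel. e 0 \<eta> * of_real (exp (- 2 * \<eta>) ^ m)) = 0" for m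
      using M0[of m] by (simp only: M_def)
  qed auto
  then show ?thesis unfolding aeeq_def by eventually_elim (simp add: e_def)
qed

text \<open>With \<phi> the transform of f, supported on the positive half-line, f is the reflected
  transform of \<phi>. As |u| = 1, the relation f = conj(u) g becomes u f = g, so
  \<open>symbol_op 0\<close> maps \<phi> to the inverse transform of g, which vanishes on the
  positive half-line.\<close>

lemma H2_star_intersection:
  assumes f: "f \<in> H2" and g: "g \<in> H2" and eq: "aeeq f (\<lambda>x. u_nu_star \<nu> (of_real x) * g x)"
  shows "aeeq f (\<lambda>x. 0)"
proof -
  have fL2: "f \<in> L2" and gL2: "g \<in> L2" using f g by (auto simp: H2_def)
  define \<phi> where "\<phi> \<xi> = indicator {0<..} \<xi> * fourier f \<xi>" for \<xi>
  have \<phi>: "\<phi> \<in> L2" unfolding \<phi>_def by (intro L2_indicator fourier_L2 fL2) simp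
  have "AE \<xi> in lborel. \<xi> > 0 \<longrightarrow> fourier f (- \<xi>) = 0"
    using H2_iff_fourier_inv_support[THEN iffD1, OF f, THEN conjunct2] fourier_inv_eq[OF fL2] unfolding aeeq_def
    by eventually_elim simp
  from AE_reflect[OF this] have \<phi>_eq: "aeeq \<phi> (fourier f)"
    using AE_lborel_singleton[of 0] unfolding aeeq_def by eventually_elim (auto simp: \<phi>_def indicator_def)
  have "aeeq (fourier \<phi>) (\<lambda>x. f (- x))"
    by (rule aeeq_trans[OF fourier_aeeq[OF \<phi> fourier_L2[OF fL2] \<phi>_eq] fourier_fourier[OF fL2]])
  from aeeq_reflect[OF this] have F\<phi>: "aeeq (\<lambda>x. fourier \<phi> (- x)) f" by simp
  have "aeeq (symbol_op 0 \<phi>) (fourier_inv g)"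
  proof (rule symbol_op_eqI[OF \<phi> fourier_inv_L2[OF gL2]])
    have "aeeq (\<lambda>x. symbol 0 x * fourier \<phi> (- x)) g"
      using F\<phi> eq unfolding aeeq_def
    proof eventually_elim
      case (elim x)
      have "symbol 0 x * fourier \<phi> (- x) = (u_nu \<nu> (of_real x) * cnj (u_nu \<nu> (of_real x))) * g x"
        using elim by (simp add: symbol_def u_nu_star_def mult.assoc)
      also have "u_nu \<nu> (of_real x) * cnj (u_nu \<nu> (of_real x)) = 1"
        unfolding complex_norm_square[symmetric] by (simp add: norm_u_nu)
      finally show ?case by simp
    qed
    also have "aeeq g (fourier (fourier_inv g))" by (rule aeeq_sym[OF fourier_fourier_inv[OF gL2]])
    finally show "aeeq (\<lambda>x. symbol 0 x * fourier \<phi> (- x)) (fourier (fourier_inv g))" .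
  qed
  moreover have "aeeq (symbol_op 0 \<phi>) (kernel_int 0 \<phi>)"
    by (rule symbol_op_eq_kernel_int[where R = 0, OF \<phi>]) (simp add: \<phi>_def)
  ultimately have "AE \<xi> in lborel. \<xi> > 0 \<longrightarrow> kernel_int 0 \<phi> \<xi> = 0"
    using H2_iff_fourier_inv_support[THEN iffD1, OF g, THEN conjunct2] unfolding aeeq_def
    by eventually_elim simp
  then have "aeeq \<phi> (\<lambda>x. 0)"
    by (intro kernel_int_vanish_half_line[OF \<phi>]) (auto simp: \<phi>_def)
  then have "l2_norm (fourier f) = l2_norm (\<lambda>x. 0)"
    using aeeq_trans[OF aeeq_sym[OF \<phi>_eq]] by (intro l2_norm_aeeq L2_measurable fourier_L2 fL2 L2_zero)
  then show ?thesis by (intro l2_norm_eq_0[OF fL2]) (simp add: l2_norm_fourier[OF fL2])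
qed

end

section \<open>A Sonine function\<close>

lemma integrable_inverse_1_plus_square_UNIV: "integrable lborel (\<lambda>x::real. inverse (1 + x\<^sup>2))"
  using integrable_inverse_1_plus_square by (simp add: set_integrable_def)

context
  fixes \<nu> :: real
  assumes \<nu>: "\<nu> > 0"
begin

text \<open>The prescribed Laplace transform e^{-1/\<tau>} (1+\<tau>)^{-1-\<nu>}, continued from z =
  i \<tau> to the half-plane. Being a Hardy function, it is the Laplace transform of a
  square-integrable density, obtained without an explicit formula.\<close>

definition sonine_ext :: "complex \<Rightarrow> complex" where
  "sonine_ext z = exp (- \<i> / z) * (1 - \<i> * z) powr (of_real (- 1 - \<nu>))"

definition sonine_bound :: "real \<Rightarrow> complex" where
  "sonine_bound x = of_real (1 / sqrt (1 + x\<^sup>2))"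

lemma sonine_bound_L2: "sonine_bound \<in> L2"
proof (rule L2_I)
  have "(cmod (sonine_bound x))\<^sup>2 = inverse (1 + x\<^sup>2)" for x
    unfolding sonine_bound_def norm_of_real power2_abs by (simp add: power_divide add_nonneg_nonneg inverse_eq_divide)
  then show "integrable lborel (\<lambda>x. (cmod (sonine_bound x))\<^sup>2)"
    using integrable_inverse_1_plus_square_UNIV by simp
qed (unfold sonine_bound_def, measurable)

text \<open>Re(-i/z) = -y/|z|^2 <= 0 bounds the exponential by 1, and |1 - i z| >= sqrt(1 + x^2) >=
  1 with \<nu> > 0 bounds the power by 1/sqrt(1 + x^2), uniformly in the height.\<close>

lemma sonine_ext_bound:
  assumes "y \<ge> 0" shows "cmod (sonine_ext (Complex x y)) \<le> cmod (sonine_bound x)"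
proof -
  let ?z = "Complex x y"
  have "Re (- \<i> / ?z) \<le> 0"
    using assms by (simp add: Re_divide divide_nonpos_nonneg)
  then have 1: "cmod (exp (- \<i> / ?z)) \<le> 1" by simp
  have ge: "sqrt (1 + x\<^sup>2) \<le> cmod (1 - \<i> * ?z)"
    using assms by (simp add: cmod_def real_sqrt_le_iff power_mono one_le_power)
  have s1: "sqrt (1 + x\<^sup>2) \<ge> 1" by simp
  have "cmod ((1 - \<i> * ?z) powr of_real (- 1 - \<nu>)) = cmod (1 - \<i> * ?z) powr (- 1 - \<nu>)"
    by (subst norm_powr_real_powr') auto
  also have "\<dots> \<le> cmod (1 - \<i> * ?z) powr (- 1)"
    using \<nu> order_trans[OF s1 ge] by (intro powr_mono) auto
  also have "\<dots> = 1 / cmod (1 - \<i> * ?z)" using ge s1 by (simp add: powr_minus divide_inverse)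
  also have "\<dots> \<le> 1 / sqrt (1 + x\<^sup>2)"
  proof (rule divide_left_mono[OF ge])
    show "0 < cmod (1 - \<i> * ?z) * sqrt (1 + x\<^sup>2)"
      using s1 ge by (intro mult_pos_pos) linarith+
  qed simp
  finally have 2: "cmod ((1 - \<i> * ?z) powr of_real (- 1 - \<nu>)) \<le> 1 / sqrt (1 + x\<^sup>2)" .
  have "cmod (sonine_ext ?z) \<le> 1 * (1 / sqrt (1 + x\<^sup>2))"
    unfolding sonine_ext_def norm_mult by (intro mult_mono 1 2) auto
  then show ?thesis by (simp add: sonine_bound_def norm_divide)
qed

lemma sonine_ext_holomorphic: "sonine_ext holomorphic_on {z. Im z > 0}"
  unfolding sonine_ext_def
proof (intro holomorphic_intros)
  fix z :: complex assume z: "z \<in> {z. Im z > 0}"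
  then show "z \<noteq> 0" by auto
  have "Re (1 - \<i> * z) > 0" using z by simp
  then show "1 - \<i> * z \<notin> \<real>\<^sub>\<le>\<^sub>0" using complex_nonpos_Reals_iff by auto
qed

lemma sonine_ext_isCont:
  assumes "z \<noteq> 0" "Im z \<ge> 0" shows "isCont sonine_ext z"
proof -
  have "Re (1 - \<i> * z) > 0" using assms by simp
  then have "1 - \<i> * z \<notin> \<real>\<^sub>\<le>\<^sub>0" using complex_nonpos_Reals_iff by auto
  then show ?thesis
    unfolding sonine_ext_def using assms by (intro continuous_intros) auto
qed

lemma sonine_ext_measurable [measurable]: "(\<lambda>x. sonine_ext (Complex x y)) \<in> borel_measurable borel"
  unfolding sonine_ext_def Complex_eq by measurable

lemma sonine_ext_L2: "y \<ge> 0 \<Longrightarrow> (\<lambda>x. sonine_ext (Complex x y)) \<in> L2"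
  by (rule L2_dominated[OF _ sonine_bound_L2, where C = 1]) (auto simp: sonine_ext_bound)

lemma sonine_ext_tendsto:
  "((\<lambda>y. l2_norm (\<lambda>x. sonine_ext (Complex x y) - sonine_ext (Complex x 0))) \<longlongrightarrow> 0) (at_right 0)"
proof (rule l2_dominated_convergence[OF _ _ sonine_bound_L2, where C = 2])
  show "\<forall>\<^sub>F y in at_right 0. AE x in lborel. cmod (sonine_ext (Complex x y) - sonine_ext (Complex x 0)) \<le> 2 * cmod (sonine_bound x)"
  proof (rule eventually_at_rightI[of 0 1])
    fix y :: real assume "y \<in> {0<..<1}"
    then have "cmod (sonine_ext (Complex x y) - sonine_ext (Complex x 0)) \<le> 2 * cmod (sonine_bound x)" for x
      using norm_triangle_ineq4[of "sonine_ext (Complex x y)" "sonine_ext (Complex x 0)"]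
        sonine_ext_bound[of y x] sonine_ext_bound[of 0 x] by auto
    then show "AE x in lborel. cmod (sonine_ext (Complex x y) - sonine_ext (Complex x 0)) \<le> 2 * cmod (sonine_bound x)" by simp
  qed simp
  \<comment> \<open>The point 0, the essential singularity of exp(-i/z), is excluded; at every other
    boundary point the extension is continuous.\<close>
  show "AE x in lborel. ((\<lambda>y. sonine_ext (Complex x y)) \<longlongrightarrow> sonine_ext (Complex x 0)) (at_right 0)"
    using AE_lborel_singleton[of 0]
  proof eventually_elim
    case (elim x)
    have "isCont sonine_ext (Complex x 0)" using elim by (intro sonine_ext_isCont) (auto simp: complex_eq_iff)
    moreover have "((\<lambda>y. Complex x y) \<longlongrightarrow> Complex x 0) (at_right 0)"
      unfolding Complex_eq by (auto intro!: tendsto_eq_intros)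
    ultimately show ?case by (rule isCont_tendsto_compose)
  qed
qed auto

text \<open>The function chi: the inverse transform of the boundary values, reflected to the
  positive half-line and rescaled by the constant of the unitary transform.\<close>

definition sonine_density :: "real \<Rightarrow> complex" where
  "sonine_density v = indicator {..<0} (- v) * fourier_inv (\<lambda>x. sonine_ext (Complex x 0)) (- v) / sqrt (2 * pi)"

lemma sonine_density_L2: "sonine_density \<in> L2"
proof -
  have "(\<lambda>\<xi>. indicator {..<0} \<xi> * fourier_inv (\<lambda>x. sonine_ext (Complex x 0)) \<xi>) \<in> L2"
    by (intro L2_indicator fourier_inv_L2 sonine_ext_L2) auto
  from L2_cmult[OF L2_reflect[OF this], of "1 / sqrt (2 * pi)"] show ?thesis
    unfolding sonine_density_def[abs_def] by simp
qed

lemma sonine_density_nonpos: "v \<le> 0 \<Longrightarrow> sonine_density v = 0"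
  by (simp add: sonine_density_def)

text \<open>On the imaginary axis the Hardy extension is a Laplace integral, and at z = i \<tau> the
  formula for \<open>sonine_ext\<close> becomes real.\<close>

lemma sonine_laplace:
  assumes \<tau>: "\<tau> > 0"
  shows "(LINT v|lborel. of_real (exp (- \<tau> * v)) * sonine_density v) = of_real (exp (- 1 / \<tau>) * (1 + \<tau>) powr (- 1 - \<nu>))"
proof -
  let ?\<psi> = "\<lambda>\<xi>. indicator {..<0} \<xi> * fourier_inv (\<lambda>x. sonine_ext (Complex x 0)) \<xi>"
  have "sonine_ext (Complex 0 \<tau>) = laplace_ext ?\<psi> (Complex 0 \<tau>)"
  proof (rule hardy_laplace_ext[where C = "l2_norm sonine_bound"])
    show "l2_norm (\<lambda>x. sonine_ext (Complex x y)) \<le> l2_norm sonine_bound" if "y > 0" for y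
      using that by (intro l2_norm_mono sonine_ext_L2 sonine_bound_L2 AE_I2 sonine_ext_bound) auto
  qed (use \<tau> in \<open>auto intro: sonine_ext_holomorphic sonine_ext_L2 sonine_ext_tendsto\<close>)
  also have "\<dots> = (1 / sqrt (2 * pi)) * (LINT \<xi>|lborel. of_real (exp (\<tau> * \<xi>)) * ?\<psi> \<xi>)"
    unfolding laplace_ext_Complex fourier_int_def by simp
  also have "\<dots> = (1 / sqrt (2 * pi)) * (LINT v|lborel. of_real (exp (\<tau> * (- v))) * ?\<psi> (- v))"
    using LINT_reflect[of "\<lambda>\<xi>. of_real (exp (\<tau> * \<xi>)) * ?\<psi> \<xi>"] by simp
  also have "\<dots> = (LINT v|lborel. (1 / sqrt (2 * pi)) * (of_real (exp (\<tau> * (- v))) * ?\<psi> (- v)))"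
    by (rule integral_mult_right_zero[symmetric])
  also have "\<dots> = (LINT v|lborel. of_real (exp (- \<tau> * v)) * sonine_density v)"
    by (intro Bochner_Integration.integral_cong refl) (simp add: sonine_density_def)
  finally have "(LINT v|lborel. of_real (exp (- \<tau> * v)) * sonine_density v) = sonine_ext (Complex 0 \<tau>)" ..
  also have "sonine_ext (Complex 0 \<tau>) = of_real (exp (- 1 / \<tau>) * (1 + \<tau>) powr (- 1 - \<nu>))"
  proof -
    have "Complex 0 \<tau> = \<i> * of_real \<tau>" by (simp add: Complex_eq)
    moreover have "- \<i> / (\<i> * of_real \<tau>) = complex_of_real (- 1 / \<tau>)" by simp
    moreover have "1 - \<i> * (\<i> * of_real \<tau>) = complex_of_real (1 + \<tau>)" by (simp flip: mult.assoc)
    moreover have "complex_of_real (1 + \<tau>) powr of_real (- 1 - \<nu>) = of_real ((1 + \<tau>) powr (- 1 - \<nu>))"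
      using \<tau> by (subst powr_of_real) auto
    ultimately show ?thesis unfolding sonine_ext_def by (simp only: exp_of_real of_real_mult)
  qed
  finally show ?thesis .
qed

text \<open>The exponent \<nu> - 1 is forced: Euler's integral at (1+\<nu>-ix)/2 contributes
  e^{(1+\<nu>)\<xi>} e^{-ix\<xi>}, and the Jacobian of e^{-2\<xi>} contributes e^{-2\<xi>}.\<close>

definition sonine_fun :: "real \<Rightarrow> complex" where
  "sonine_fun \<xi> = of_real (exp ((\<nu> - 1) * \<xi>)) * sonine_density (exp (- 2 * \<xi>) - 1)"

lemma sonine_fun_nonneg: "\<xi> \<ge> 0 \<Longrightarrow> sonine_fun \<xi> = 0"
  by (simp add: sonine_fun_def sonine_density_nonpos)

lemma sonine_density_measurable [measurable]: "sonine_density \<in> borel_measurable borel"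
  by (rule L2_measurable[OF sonine_density_L2])

text \<open>In t = e^{-2\<xi>} the squared norm is half of that of
  \<open>sonine_density\<close>.\<close>

lemma sonine_factor_L2: "(\<lambda>\<xi>. of_real (exp (- \<xi>)) * sonine_density (exp (- 2 * \<xi>) - 1)) \<in> L2"
proof (rule L2_I)
  let ?f = "\<lambda>t. complex_of_real ((cmod (sonine_density (t - 1)))\<^sup>2)"
  have "integrable lborel (\<lambda>t. (cmod (sonine_density (- 1 + 1 * t)))\<^sup>2)"
    by (rule lborel_integrable_real_affine[OF L2_integrable[OF sonine_density_L2]]) simp
  then have i: "integrable lborel ?f" by (simp add: complex_of_real_integrable_eq del: of_real_power)
  have "integrable lborel (\<lambda>t. indicator {0<..} t *\<^sub>R ?f t)"
    by (rule Bochner_Integration.integrable_bound[OF i]) (auto simp: indicator_def)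
  then have "integrable lborel (\<lambda>\<eta>. (2 * 1 * exp (- 2 * \<eta>)) *\<^sub>R ?f (1 * exp (- 2 * \<eta>)))"
    using exp_substitution[of ?f 1] by (auto simp: has_bochner_integral_iff)
  then have "integrable lborel (\<lambda>\<eta>. cmod ((2 * 1 * exp (- 2 * \<eta>)) *\<^sub>R ?f (1 * exp (- 2 * \<eta>))))"
    by (rule integrable_norm)
  then have "integrable lborel (\<lambda>\<eta>. cmod ((2 * 1 * exp (- 2 * \<eta>)) *\<^sub>R ?f (1 * exp (- 2 * \<eta>))) / 2)"
    by (rule integrable_divide)
  moreover have "cmod ((2 * 1 * exp (- 2 * \<eta>)) *\<^sub>R ?f (1 * exp (- 2 * \<eta>))) / 2 = (cmod (of_real (exp (- \<eta>)) * sonine_density (exp (- 2 * \<eta>) - 1)))\<^sup>2" for \<eta>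
  proof -
    have "exp (- 2 * \<eta>) = (exp (- \<eta>))\<^sup>2" by (simp flip: exp_double)
    then show ?thesis by (simp add: norm_mult norm_power power_mult_distrib)
  qed
  ultimately show "integrable lborel (\<lambda>\<eta>. (cmod (of_real (exp (- \<eta>)) * sonine_density (exp (- 2 * \<eta>) - 1)))\<^sup>2)" by simp
qed measurable

text \<open>On the negative half-line e^{\<nu>\<xi>} is bounded and square-integrable because \<nu>
  > 0; the former makes the product square-integrable, the latter makes it integrable. The power 0
  matches the form of \<open>L2_power_exp_neg\<close>.\<close>

lemma sonine_fun_factor:
  "sonine_fun \<xi> = complex_of_real (indicator {..<0} \<xi> * (\<bar>\<xi>\<bar> ^ 0 * exp (\<nu> * \<xi>))) * (of_real (exp (- \<xi>)) * sonine_density (exp (- 2 * \<xi>) - 1))"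
proof (cases "\<xi> < 0")
  case True
  have "exp ((\<nu> - 1) * \<xi>) = exp (\<nu> * \<xi>) * exp (- \<xi>)" unfolding exp_add[symmetric] by (simp add: algebra_simps)
  then show ?thesis using True by (simp add: sonine_fun_def)
next
  case False
  then show ?thesis by (simp add: sonine_fun_nonneg)
qed

lemma sonine_fun_integrable: "integrable lborel sonine_fun"
  unfolding sonine_fun_factor[abs_def] by (intro L2_mult_integrable L2_power_exp_neg \<nu> sonine_factor_L2)

lemma sonine_fun_L2: "sonine_fun \<in> L2"
  unfolding sonine_fun_factor[abs_def]
proof (rule L2_mult_bounded[OF _ sonine_factor_L2, where C = 1])
  show "cmod (complex_of_real (indicator {..<0} \<xi> * (\<bar>\<xi>\<bar> ^ 0 * exp (\<nu> * \<xi>)))) \<le> 1" for \<xi>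
    using \<nu> by (auto simp: indicator_def mult_nonneg_nonpos norm_mult)
qed measurable

section \<open>The transform as an even function divided by a Gamma factor\<close>

definition sonine_even :: "real \<Rightarrow> real" where
  "sonine_even \<eta> = exp (- exp (- 2 * \<eta>) - exp (2 * \<eta>)) * (exp \<eta> + exp (- \<eta>)) powr (- 1 - \<nu>)"

lemma sonine_even_reflect: "sonine_even (- \<eta>) = sonine_even \<eta>"
  by (simp add: sonine_even_def add.commute)

lemma sonine_even_pos: "sonine_even \<eta> > 0"
proof -
  have "exp \<eta> + exp (- \<eta>) > 0" by (intro add_pos_pos) auto
  then show ?thesis unfolding sonine_even_def by (intro mult_pos_pos) auto
qed

text \<open>Euler's integral for the Gamma function turns the Mellin transform of the shifted density
  into its Laplace transform, whose symmetry under inversion makes the result even.\<close>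

lemma sonine_fourier:
  "has_bochner_integral lborel (\<lambda>\<eta>. exp (\<i> * of_real (x * \<eta>)) * of_real (sonine_even \<eta>))
    (Gamma ((1 + of_real \<nu> - \<i> * of_real x) / 2) * sqrt (2 * pi) * fourier_int sonine_fun x)"
proof -
  define \<beta> where "\<beta> = (1 + of_real \<nu> - \<i> * complex_of_real x) / 2"
  have \<beta>: "Re \<beta> > 0" using \<nu> by (simp add: \<beta>_def)
  \<comment> \<open>The factor 2 e^{-2\<xi>} is the Jacobian of t = e^{-2\<xi>}, the variable of the
    Laplace integral.\<close>
  define c where "c \<xi> = complex_of_real (2 * exp (- 2 * \<xi>)) * sonine_density (exp (- 2 * \<xi>) - 1)" for \<xi>
  have [measurable]: "c \<in> borel_measurable borel" unfolding c_def by measurable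
  \<comment> \<open>Integrated in \<eta>, the exponential gives Gamma(\<beta>) times
    e^{2\<beta>\<xi>}, up to the factor 1/2; integrated in \<xi>, the product gives the Laplace
    transform of the shifted density at e^{-2\<eta>}.\<close>
  define h where "h \<xi> \<eta> = c \<xi> * exp (- 2 * \<beta> * of_real \<eta> - of_real (exp (- 2 * \<xi>) * exp (- 2 * \<eta>)))" for \<xi> \<eta> :: real
  have [measurable]: "(\<lambda>(\<xi>, \<eta>). h \<xi> \<eta>) \<in> borel_measurable (borel \<Otimes>\<^sub>M borel)" unfolding h_def by measurable
  have \<beta>2: "2 * \<beta> = 1 + of_real \<nu> - \<i> * of_real x" by (simp add: \<beta>_def)
  have cf: "c \<xi> * exp (2 * \<beta> * of_real \<xi>) = 2 * (exp (- \<i> * of_real (\<xi> * x)) * sonine_fun \<xi>)" for \<xi>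
  proof -
    have "complex_of_real (exp (- 2 * \<xi>)) * exp (2 * \<beta> * of_real \<xi>) = exp (- \<i> * of_real (\<xi> * x)) * of_real (exp ((\<nu> - 1) * \<xi>))"
      unfolding exp_of_real[symmetric] exp_add[symmetric] \<beta>2 by (rule arg_cong[where f = exp]) (simp add: algebra_simps)
    then show ?thesis by (simp add: c_def sonine_fun_def mult_ac)
  qed
  have inner_\<eta>: "has_bochner_integral lborel (\<lambda>\<eta>. h \<xi> \<eta>) (Gamma \<beta> * (exp (- \<i> * of_real (\<xi> * x)) * sonine_fun \<xi>))" for \<xi>
  proof -
    have "has_bochner_integral lborel (\<lambda>\<eta>. h \<xi> \<eta>) (c \<xi> * (exp (- \<beta> * of_real (ln (exp (- 2 * \<xi>)))) * Gamma \<beta> / 2))"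
      unfolding h_def by (intro has_bochner_integral_mult_right Gamma_integral_line \<beta>) simp
    moreover have "c \<xi> * (exp (- \<beta> * of_real (ln (exp (- 2 * \<xi>)))) * Gamma \<beta> / 2) = (c \<xi> * exp (2 * \<beta> * of_real \<xi>)) * (Gamma \<beta> / 2)"
      by (simp add: mult_ac)
    moreover have "\<dots> = Gamma \<beta> * (exp (- \<i> * of_real (\<xi> * x)) * sonine_fun \<xi>)"
      unfolding cf by simp
    ultimately show ?thesis by (simp only:)
  qed
  \<comment> \<open>The modulus has the same shape with the real parameter (1+\<nu>)/2, which yields
    absolute integrability over the plane.\<close>
  have norm_h: "has_bochner_integral lborel (\<lambda>\<eta>. cmod (h \<xi> \<eta>)) (Gamma ((1 + \<nu>) / 2) * cmod (sonine_fun \<xi>))" for \<xi>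
  proof -
    have "cmod (h \<xi> \<eta>) = cmod (c \<xi>) * exp (- 2 * ((1 + \<nu>) / 2) * \<eta> - exp (- 2 * \<xi>) * exp (- 2 * \<eta>))" for \<eta>
      by (simp add: h_def norm_mult \<beta>_def)
    moreover have "has_bochner_integral lborel (\<lambda>\<eta>. cmod (c \<xi>) * exp (- 2 * ((1 + \<nu>) / 2) * \<eta> - exp (- 2 * \<xi>) * exp (- 2 * \<eta>)))
       (cmod (c \<xi>) * (exp (- ((1 + \<nu>) / 2) * ln (exp (- 2 * \<xi>))) * Gamma ((1 + \<nu>) / 2) / 2))"
      using \<nu> by (intro has_bochner_integral_mult_right Gamma_integral_line_real) auto
    moreover have "cmod (c \<xi>) * (exp (- ((1 + \<nu>) / 2) * ln (exp (- 2 * \<xi>))) * Gamma ((1 + \<nu>) / 2) / 2) = Gamma ((1 + \<nu>) / 2) * cmod (sonine_fun \<xi>)"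
    proof -
      have e1: "exp (- 2 * \<xi>) * exp ((1 + \<nu>) * \<xi>) = exp ((\<nu> - 1) * \<xi>)" unfolding exp_add[symmetric] by (simp add: algebra_simps)
      have e2: "exp (- ((1 + \<nu>) / 2) * ln (exp (- 2 * \<xi>))) = exp ((1 + \<nu>) * \<xi>)" by (simp add: field_simps)
      have c1: "cmod (c \<xi>) = 2 * exp (- 2 * \<xi>) * cmod (sonine_density (exp (- 2 * \<xi>) - 1))"
        by (simp add: c_def norm_mult)
      have c2: "cmod (sonine_fun \<xi>) = exp ((\<nu> - 1) * \<xi>) * cmod (sonine_density (exp (- 2 * \<xi>) - 1))"
        by (simp add: sonine_fun_def norm_mult)
      have "cmod (c \<xi>) * exp (- ((1 + \<nu>) / 2) * ln (exp (- 2 * \<xi>))) = 2 * cmod (sonine_fun \<xi>)"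
        unfolding c1 c2 e2 e1[symmetric] by (simp only: mult_ac)
      then show ?thesis by simp
    qed
    ultimately show ?thesis by (simp only:)
  qed
  have int: "integrable (lborel \<Otimes>\<^sub>M lborel) (\<lambda>(\<xi>, \<eta>). h \<xi> \<eta>)"
  proof (rule lborel_pair.Fubini_integrable)
    show "(\<lambda>(\<xi>, \<eta>). h \<xi> \<eta>) \<in> borel_measurable (lborel \<Otimes>\<^sub>M lborel)" by measurable
    show "AE \<xi> in lborel. integrable lborel (\<lambda>\<eta>. case (\<xi>, \<eta>) of (\<xi>, \<eta>) \<Rightarrow> h \<xi> \<eta>)"
      using inner_\<eta> by (auto simp: has_bochner_integral_iff)
    have "(LINT \<eta>|lborel. norm (case (\<xi>, \<eta>) of (\<xi>, \<eta>) \<Rightarrow> h \<xi> \<eta>)) = Gamma ((1 + \<nu>) / 2) * cmod (sonine_fun \<xi>)" for \<xi>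
      using norm_h[of \<xi>] by (simp add: has_bochner_integral_iff)
    then show "integrable lborel (\<lambda>\<xi>. LINT \<eta>|lborel. norm (case (\<xi>, \<eta>) of (\<xi>, \<eta>) \<Rightarrow> h \<xi> \<eta>))"
      using sonine_fun_integrable by simp
  qed
  have inner_\<xi>: "(LINT \<xi>|lborel. h \<xi> \<eta>) = exp (\<i> * of_real (x * \<eta>)) * of_real (sonine_even \<eta>)" for \<eta>
  proof -
    define \<tau> where "\<tau> = exp (- 2 * \<eta>)"
    have \<tau>: "\<tau> > 0" by (simp add: \<tau>_def)
    let ?f = "\<lambda>t. of_real (exp (- \<tau> * t)) * sonine_density (t - 1)"
    have fi: "integrable lborel (\<lambda>t. of_real (exp (- \<tau> * t)) * sonine_density t)"
    proof -
      have "integrable lborel (\<lambda>t. of_real (\<bar>t\<bar> ^ 0 * exp (\<tau> * t)) * sonine_density (- t))"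
        by (rule integrable_power_exp_neg_mult[OF \<tau> L2_reflect[OF sonine_density_L2]]) (simp add: sonine_density_nonpos)
      from lborel_integrable_real_affine[OF this, of "-1" 0] show ?thesis by simp
    qed
    \<comment> \<open>The shift by 1 in the density yields the factor e^{-\<tau>}, the counterpart
      of e^{-1/\<tau>} under inversion of \<tau>.\<close>
    have f_eq: "indicator {0<..} t *\<^sub>R ?f t = of_real (exp (- \<tau>)) * (of_real (exp (- \<tau> * (- 1 + 1 * t))) * sonine_density (- 1 + 1 * t))" for t
    proof (cases "t > 0")
      case True
      have "exp (- \<tau> * t) = exp (- \<tau>) * exp (- \<tau> * (- 1 + 1 * t))" unfolding exp_add[symmetric] by (simp add: algebra_simps)
      then show ?thesis using True by simp
    qed (simp add: sonine_density_nonpos)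
    have "has_bochner_integral lborel (\<lambda>t. indicator {0<..} t *\<^sub>R ?f t) (of_real (exp (- \<tau>) * (exp (- 1 / \<tau>) * (1 + \<tau>) powr (- 1 - \<nu>))))"
      unfolding f_eq of_real_mult[of "exp (- \<tau>)"]
    proof (intro has_bochner_integral_mult_right)
      have "(LINT t|lborel. of_real (exp (- \<tau> * (- 1 + 1 * t))) * sonine_density (- 1 + 1 * t)) = (LINT t|lborel. of_real (exp (- \<tau> * t)) * sonine_density t)"
        using lborel_integral_real_affine[of 1 "\<lambda>t. of_real (exp (- \<tau> * t)) * sonine_density t" "-1"] by simp
      then show "has_bochner_integral lborel (\<lambda>t. of_real (exp (- \<tau> * (- 1 + 1 * t))) * sonine_density (- 1 + 1 * t)) (of_real (exp (- 1 / \<tau>) * (1 + \<tau>) powr (- 1 - \<nu>)))"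
        using lborel_integrable_real_affine[OF fi, of 1 "-1"] sonine_laplace[OF \<tau>] by (simp add: has_bochner_integral_iff)
    qed
    then have "has_bochner_integral lborel (\<lambda>\<xi>. (2 * 1 * exp (- 2 * \<xi>)) *\<^sub>R ?f (1 * exp (- 2 * \<xi>))) (of_real (exp (- \<tau>) * (exp (- 1 / \<tau>) * (1 + \<tau>) powr (- 1 - \<nu>))))"
      by (subst exp_substitution) auto
    then have "has_bochner_integral lborel (\<lambda>\<xi>. exp (- 2 * \<beta> * of_real \<eta>) * ((2 * 1 * exp (- 2 * \<xi>)) *\<^sub>R ?f (1 * exp (- 2 * \<xi>))))
       (exp (- 2 * \<beta> * of_real \<eta>) * of_real (exp (- \<tau>) * (exp (- 1 / \<tau>) * (1 + \<tau>) powr (- 1 - \<nu>))))"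
      by (rule has_bochner_integral_mult_right)
    moreover have "exp (- 2 * \<beta> * of_real \<eta>) * ((2 * 1 * exp (- 2 * \<xi>)) *\<^sub>R ?f (1 * exp (- 2 * \<xi>))) = h \<xi> \<eta>" for \<xi>
      unfolding h_def c_def exp_diff exp_of_real \<tau>_def[symmetric]
      by (simp add: scaleR_conv_of_real exp_minus divide_inverse mult_ac)
    ultimately have "(LINT \<xi>|lborel. h \<xi> \<eta>) = exp (- 2 * \<beta> * of_real \<eta>) * of_real (exp (- \<tau>) * (exp (- 1 / \<tau>) * (1 + \<tau>) powr (- 1 - \<nu>)))"
      by (simp only: has_bochner_integral_iff)
    also have "exp (- 2 * \<beta> * of_real \<eta>) = exp (\<i> * of_real (x * \<eta>)) * of_real (exp (- (1 + \<nu>) * \<eta>))"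
    proof -
      have "- 2 * \<beta> * of_real \<eta> = - (2 * \<beta>) * of_real \<eta>" by simp
      then show ?thesis
        unfolding exp_of_real[symmetric] exp_add[symmetric] \<beta>2
        by (intro arg_cong[where f = exp]) (simp add: algebra_simps)
    qed
    \<comment> \<open>The factor e^{-(1+\<nu>)\<eta>} symmetrizes (1+\<tau>)^{-1-\<nu>} to (e^\<eta>
      + e^{-\<eta>})^{-1-\<nu>}.\<close>
    also have "exp (\<i> * of_real (x * \<eta>)) * of_real (exp (- (1 + \<nu>) * \<eta>)) * of_real (exp (- \<tau>) * (exp (- 1 / \<tau>) * (1 + \<tau>) powr (- 1 - \<nu>)))
       = exp (\<i> * of_real (x * \<eta>)) * of_real (sonine_even \<eta>)"
    proof -
      have "(exp \<eta> + exp (- \<eta>)) powr (- 1 - \<nu>) = (exp \<eta> * (1 + \<tau>)) powr (- 1 - \<nu>)"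
      proof -
        have "exp \<eta> * (1 + \<tau>) = exp \<eta> + exp (- \<eta>)" by (simp add: \<tau>_def ring_distribs exp_add[symmetric])
        then show ?thesis by simp
      qed
      also have "\<dots> = exp \<eta> powr (- 1 - \<nu>) * (1 + \<tau>) powr (- 1 - \<nu>)" by (rule powr_mult)
      also have "exp \<eta> powr (- 1 - \<nu>) = exp (- (1 + \<nu>) * \<eta>)" by (simp add: powr_def algebra_simps)
      finally have 1: "(exp \<eta> + exp (- \<eta>)) powr (- 1 - \<nu>) = exp (- (1 + \<nu>) * \<eta>) * (1 + \<tau>) powr (- 1 - \<nu>)" .
      have "- 1 / \<tau> = - exp (2 * \<eta>)" by (simp add: \<tau>_def exp_minus divide_inverse)
      then have 2: "exp (- exp (- 2 * \<eta>) - exp (2 * \<eta>)) = exp (- \<tau>) * exp (- 1 / \<tau>)"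
        unfolding \<tau>_def[symmetric] exp_add[symmetric] by simp
      show ?thesis unfolding sonine_even_def 1 2 by (simp add: mult_ac)
    qed
    finally show ?thesis .
  qed
  have "integrable lborel (\<lambda>\<eta>. LINT \<xi>|lborel. h \<xi> \<eta>)"
    using lborel_pair.integrable_fst'[OF lborel_pair.integrable_product_swap[OF int]] by simp
  moreover have "(LINT \<eta>|lborel. LINT \<xi>|lborel. h \<xi> \<eta>) = (LINT \<xi>|lborel. LINT \<eta>|lborel. h \<xi> \<eta>)"
    by (rule lborel_pair.Fubini_integral[OF int])
  moreover have "(LINT \<xi>|lborel. LINT \<eta>|lborel. h \<xi> \<eta>) = Gamma \<beta> * sqrt (2 * pi) * fourier_int sonine_fun x"
  proof -
    have "(LINT \<xi>|lborel. LINT \<eta>|lborel. h \<xi> \<eta>) = (LINT \<xi>|lborel. Gamma \<beta> * (exp (- \<i> * of_real (\<xi> * x)) * sonine_fun \<xi>))"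
      using inner_\<eta> by (intro Bochner_Integration.integral_cong refl) (simp add: has_bochner_integral_iff)
    then show ?thesis by (simp add: fourier_int_def)
  qed
  ultimately show ?thesis
    unfolding inner_\<xi> \<beta>_def by (simp only: has_bochner_integral_iff)
qed

end

text \<open>The integral I of the even real function is real. Up to a real constant Gamma(b) F = I,
  so conjugation gives Gamma(a) conj F = Gamma(b) F; multiplying by 2^{ix} / Gamma(b) yields the
  claim.\<close>

lemma sonine_fourier_symmetry:
  assumes \<nu>: "\<nu> > 0"
  shows "u_nu \<nu> (of_real x) * cnj (fourier_int (sonine_fun \<nu>) x) = exp (\<i> * of_real (ln 2 * x)) * fourier_int (sonine_fun \<nu>) x"
proof -
  interpret phase_order \<nu> using \<nu> by unfold_locales simp
  define a where "a = (1 + of_real \<nu> + \<i> * complex_of_real x) / 2"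
  define b where "b = (1 + of_real \<nu> - \<i> * complex_of_real x) / 2"
  define I where "I x = (LINT \<eta>|lborel. exp (\<i> * of_real (x * \<eta>)) * complex_of_real (sonine_even \<nu> \<eta>))" for x
  have F: "Gamma b * sqrt (2 * pi) * fourier_int (sonine_fun \<nu>) x = I x"
    using sonine_fourier[OF \<nu>, of x] by (simp add: has_bochner_integral_iff I_def b_def)
  have "cnj (I x) = (LINT \<eta>|lborel. exp (\<i> * of_real (x * (- \<eta>))) * complex_of_real (sonine_even \<nu> (- \<eta>)))"
    unfolding I_def Bochner_Integration.integral_cnj[symmetric]
    by (intro Bochner_Integration.integral_cong refl) (simp add: exp_cnj sonine_even_reflect[OF \<nu>])
  also have "\<dots> = I x"
    unfolding I_def by (rule LINT_reflect)
  finally have "cnj (Gamma b * sqrt (2 * pi) * fourier_int (sonine_fun \<nu>) x) = Gamma b * sqrt (2 * pi) * fourier_int (sonine_fun \<nu>) x"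
    unfolding F .
  moreover have "cnj (Gamma b) = Gamma a"
    unfolding a_def b_def cnj_Gamma by simp
  ultimately have eq: "Gamma a * cnj (fourier_int (sonine_fun \<nu>) x) = Gamma b * fourier_int (sonine_fun \<nu>) x"
    by (simp add: mult_ac)
  have "Gamma b \<noteq> 0" unfolding b_def by (rule Gamma_half_nonzero)
  have "u_nu \<nu> (of_real x) * cnj (fourier_int (sonine_fun \<nu>) x) =
     exp (\<i> * of_real x * of_real (ln 2)) * (Gamma a * cnj (fourier_int (sonine_fun \<nu>) x)) / Gamma b"
    by (simp add: u_nu_def a_def b_def)
  also have "\<dots> = exp (\<i> * of_real x * of_real (ln 2)) * fourier_int (sonine_fun \<nu>) x"
    unfolding eq using \<open>Gamma b \<noteq> 0\<close> by simp
  finally show ?thesis by (simp add: mult_ac)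
qed

text \<open>Multiplication by 2^{ix} translates the support by ln 2 to the left, so it stays in the
  negative half-line.\<close>

lemma sonine_transform_in_H2:
  assumes \<nu>: "\<nu> > 0"
  shows "fourier_int (sonine_fun \<nu>) \<in> H2" "(\<lambda>x. exp (\<i> * of_real (ln 2 * x)) * fourier_int (sonine_fun \<nu>) x) \<in> H2"
proof -
  note L2 = sonine_fun_L2[OF \<nu>] and int = sonine_fun_integrable[OF \<nu>]
  show "fourier_int (sonine_fun \<nu>) \<in> H2"
    by (rule fourier_half_line_in_H2[OF L2])
      (auto simp: sonine_fun_nonneg[OF \<nu>] intro: fourier_int_L2 L2 int aeeq_sym[OF fourier_eq_fourier_int])
  define \<psi> where "\<psi> \<xi> = sonine_fun \<nu> (ln 2 + 1 * \<xi>)" for \<xi>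
  have \<psi>i: "integrable lborel \<psi>"
    unfolding \<psi>_def[abs_def] by (rule lborel_integrable_real_affine[OF int]) simp
  have \<psi>: "\<psi> \<in> L2"
  proof (rule L2_I)
    show "integrable lborel (\<lambda>x. (cmod (\<psi> x))\<^sup>2)"
      unfolding \<psi>_def by (rule lborel_integrable_real_affine[OF L2_integrable[OF L2]]) simp
  qed (use \<psi>i in auto)
  have "fourier_int \<psi> x = exp (\<i> * of_real (ln 2 * x)) * fourier_int (sonine_fun \<nu>) x" for x
  proof -
    have "(LINT \<xi>|lborel. exp (- \<i> * of_real (\<xi> * x)) * sonine_fun \<nu> \<xi>) =
      (LINT \<xi>|lborel. exp (- \<i> * of_real ((ln 2 + 1 * \<xi>) * x)) * sonine_fun \<nu> (ln 2 + 1 * \<xi>))"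
      using lborel_integral_real_affine[of 1 "\<lambda>\<xi>. exp (- \<i> * of_real (\<xi> * x)) * sonine_fun \<nu> \<xi>" "ln 2"] by simp
    also have "\<dots> = (LINT \<xi>|lborel. exp (- \<i> * of_real (ln 2 * x)) * (exp (- \<i> * of_real (\<xi> * x)) * \<psi> \<xi>))"
      by (intro Bochner_Integration.integral_cong refl) (simp add: \<psi>_def ring_distribs exp_add exp_diff exp_minus divide_inverse mult_ac)
    also have "\<dots> = exp (- \<i> * of_real (ln 2 * x)) * (LINT \<xi>|lborel. exp (- \<i> * of_real (\<xi> * x)) * \<psi> \<xi>)"
      by (rule integral_mult_right_zero)
    finally have "exp (\<i> * of_real (ln 2 * x)) * (LINT \<xi>|lborel. exp (- \<i> * of_real (\<xi> * x)) * sonine_fun \<nu> \<xi>)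
       = (exp (\<i> * of_real (ln 2 * x)) * exp (- \<i> * of_real (ln 2 * x))) * (LINT \<xi>|lborel. exp (- \<i> * of_real (\<xi> * x)) * \<psi> \<xi>)"
      by (simp only: mult.assoc)
    also have "exp (\<i> * of_real (ln 2 * x)) * exp (- \<i> * of_real (ln 2 * x)) = 1"
      unfolding exp_add[symmetric] by simp
    finally show ?thesis unfolding fourier_int_def by (simp only: mult_1 mult_ac)
  qed
  then have "aeeq (\<lambda>x. exp (\<i> * of_real (ln 2 * x)) * fourier_int (sonine_fun \<nu>) x) (fourier \<psi>)"
    using aeeq_sym[OF fourier_eq_fourier_int[OF \<psi> \<psi>i]] by (simp add: aeeq_def)
  moreover have "(\<lambda>x. exp (\<i> * of_real (ln 2 * x)) * fourier_int (sonine_fun \<nu>) x) \<in> L2"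
    by (rule L2_mult_bounded[OF _ fourier_int_L2(1)[OF L2 int], where C = 1]) auto
  moreover have "AE \<xi> in lborel. \<xi> > 0 \<longrightarrow> \<psi> \<xi> = 0"
    by (simp add: \<psi>_def sonine_fun_nonneg[OF \<nu>])
  ultimately show "(\<lambda>x. exp (\<i> * of_real (ln 2 * x)) * fourier_int (sonine_fun \<nu>) x) \<in> H2"
    by (intro fourier_half_line_in_H2[OF \<psi>])
qed

text \<open>Otherwise, at x = 0, the positive function \<open>sonine_even\<close> would have
  integral 0.\<close>

lemma sonine_transform_nonzero:
  assumes \<nu>: "\<nu> > 0" shows "\<not> aeeq (fourier_int (sonine_fun \<nu>)) (\<lambda>x. 0)"
proof
  note L2 = sonine_fun_L2[OF \<nu>] and int = sonine_fun_integrable[OF \<nu>]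
  assume "aeeq (fourier_int (sonine_fun \<nu>)) (\<lambda>x. 0)"
  with fourier_eq_fourier_int[OF L2 int] have "aeeq (fourier (sonine_fun \<nu>)) (\<lambda>x. 0)" by (rule aeeq_trans)
  then have "l2_norm (fourier (sonine_fun \<nu>)) = l2_norm (\<lambda>x. 0)"
    by (rule l2_norm_aeeq) (auto intro: L2_measurable fourier_L2 L2)
  then have "aeeq (sonine_fun \<nu>) (\<lambda>x. 0)"
    by (intro l2_norm_eq_0[OF L2]) (simp add: l2_norm_fourier[OF L2])
  then have "fourier_int (sonine_fun \<nu>) 0 = 0"
    using integral_cong_AE[of "sonine_fun \<nu>" lborel "\<lambda>x. 0"] L2_measurable[OF L2]
    by (simp add: fourier_int_def aeeq_def)
  then have "has_bochner_integral lborel (\<lambda>\<eta>. complex_of_real (sonine_even \<nu> \<eta>)) 0"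
    using sonine_fourier[OF \<nu>, of 0] by simp
  then have i: "integrable lborel (sonine_even \<nu>)" and z: "(LINT \<eta>|lborel. sonine_even \<nu> \<eta>) = 0"
    by (auto simp: has_bochner_integral_iff complex_of_real_integrable_eq)
  have "AE \<eta> in lborel. sonine_even \<nu> \<eta> = 0"
    using integral_nonneg_eq_0_iff_AE[OF i] z sonine_even_pos[OF \<nu>] by (simp add: less_imp_le)
  then have "AE \<eta>::real in lborel. False"
    using sonine_even_pos[OF \<nu>] by (auto elim!: eventually_mono simp: less_le)
  then show False using AE_ex_in_interval[of "\<lambda>_. False" 0 1] by simp
qed

section \<open>Projections onto the Hardy spaces\<close>

lemma H2_L2: "f \<in> H2 \<Longrightarrow> f \<in> L2"
  by (simp add: H2_def)

lemma H2_conj_L2: "f \<in> H2_conj \<Longrightarrow> f \<in> L2"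
  using L2_cnj[OF H2_L2, of "\<lambda>x. cnj (f x)"] by (simp add: H2_conj_def)

lemma H2_diff:
  assumes f: "f \<in> H2" and g: "g \<in> H2" shows "(\<lambda>x. f x - g x) \<in> H2"
proof -
  have "aeeq (fourier_inv (\<lambda>x. f x - g x)) (\<lambda>\<xi>. fourier_inv f \<xi> - fourier_inv g \<xi>)"
    using fourier_inv_linear[OF H2_L2[OF g] H2_L2[OF f], of "-1"] by simp
  then have "AE \<xi> in lborel. \<xi> > 0 \<longrightarrow> fourier_inv (\<lambda>x. f x - g x) \<xi> = 0"
    using H2_iff_fourier_inv_support[THEN iffD1, OF f, THEN conjunct2]
      H2_iff_fourier_inv_support[THEN iffD1, OF g, THEN conjunct2]
    unfolding aeeq_def by eventually_elim simp
  then show ?thesis using L2_diff[OF H2_L2[OF f] H2_L2[OF g]] by (simp add: H2_iff_fourier_inv_support)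
qed

lemma H2_conj_diff: "f \<in> H2_conj \<Longrightarrow> g \<in> H2_conj \<Longrightarrow> (\<lambda>x. f x - g x) \<in> H2_conj"
  using H2_diff[of "\<lambda>x. cnj (f x)" "\<lambda>x. cnj (g x)"] by (simp add: H2_conj_def)

lemma l2_inner_zero_left:
  assumes "f \<in> L2" "h \<in> L2" "aeeq f (\<lambda>x. 0)" shows "l2_inner f h = 0"
  using l2_inner_aeeq[OF assms(3,1) L2_zero aeeq_refl assms(2,2)] by (simp add: l2_inner_def)

text \<open>The projections are given by a choice, and S stands for either Hardy space. If f agrees
  almost everywhere with some g in S, then g is an admissible choice; for any choice p, the
  difference g - p lies in S and is orthogonal to itself. So the projection acts as the identity on
  S.\<close>

lemma orthogonal_choice_aeeq:
  assumes S: "\<And>g. g \<in> S \<Longrightarrow> g \<in> L2" and diff: "\<And>g h. g \<in> S \<Longrightarrow> h \<in> S \<Longrightarrow> (\<lambda>x. g x - h x) \<in> S"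
    and f: "f \<in> L2" and g: "g \<in> S" and fg: "aeeq f g"
    and p: "p = (SOME p. p \<in> S \<and> (\<forall>h\<in>S. l2_inner (\<lambda>x. f x - p x) h = 0))"
  shows "p \<in> S" "aeeq p f"
proof -
  let ?P = "\<lambda>p. p \<in> S \<and> (\<forall>h\<in>S. l2_inner (\<lambda>x. f x - p x) h = 0)"
  have "?P g"
  proof (intro conjI ballI g l2_inner_zero_left L2_diff f S)
    show "aeeq (\<lambda>x. f x - g x) (\<lambda>x. 0)" using fg unfolding aeeq_def by eventually_elim simp
  qed
  then have P: "?P p" unfolding p by (rule someI[where P = ?P])
  then show pS: "p \<in> S" by simp
  let ?d = "\<lambda>x. g x - p x"
  have d: "?d \<in> S" using diff[OF g pS] .
  have "l2_inner ?d ?d = l2_inner (\<lambda>x. f x - p x) ?d"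
  proof (rule l2_inner_aeeq)
    show "aeeq ?d (\<lambda>x. f x - p x)" using fg unfolding aeeq_def by eventually_elim simp
  qed (auto intro: S d L2_diff f pS)
  also have "\<dots> = 0" using P d by blast
  finally have "l2_norm ?d = 0" by (simp add: l2_inner_self)
  from l2_norm_eq_0[OF S[OF d] this] fg show "aeeq p f"
    unfolding aeeq_def by eventually_elim simp
qed

lemma R_plus_aeeq:
  assumes f: "f \<in> H2" shows "R_plus f \<in> H2" "aeeq (R_plus f) f"
proof -
  note * = orthogonal_choice_aeeq[OF H2_L2 H2_diff H2_L2[OF f] f aeeq_refl R_plus_def]
  show "R_plus f \<in> H2" by (rule *(1))
  show "aeeq (R_plus f) f" by (rule *(2))
qed

lemma R_minus_aeeq:
  assumes "f \<in> L2" "g \<in> H2_conj" "aeeq f g" shows "R_minus f \<in> H2_conj" "aeeq (R_minus f) f"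
proof -
  note * = orthogonal_choice_aeeq[OF H2_conj_L2 H2_conj_diff assms R_minus_def]
  show "R_minus f \<in> H2_conj" by (rule *(1))
  show "aeeq (R_minus f) f" by (rule *(2))
qed

section \<open>The projection and its range\<close>

lemma P_plus_L2: "f \<in> L2 \<Longrightarrow> P_plus f \<in> L2"
  unfolding P_plus_def[abs_def] by (rule L2_indicator) auto

lemma P_plus_aeeq: "aeeq f g \<Longrightarrow> aeeq (P_plus f) (P_plus g)"
  unfolding aeeq_def P_plus_def by (elim eventually_mono) simp

lemma P_plus_idem: "P_plus (P_plus f) = P_plus f"
  by (auto simp: P_plus_def fun_eq_iff indicator_def)

lemma P_plus_selfadjoint: "l2_inner (P_plus f) g = l2_inner f (P_plus g)"
  unfolding l2_inner_def P_plus_def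
  by (intro Bochner_Integration.integral_cong refl) (simp add: indicator_def)

context bessel_order
begin

context
  fixes l :: real and G :: "(real \<Rightarrow> complex) \<Rightarrow> real \<Rightarrow> complex"
  assumes G: "kernel_op (G_kernel \<nu> l) G"
begin

lemma kernel_op_L2: "f \<in> L2 \<Longrightarrow> G f \<in> L2"
  using G unfolding kernel_op_def by blast

text \<open>Uniqueness replaces the arbitrary G by \<open>symbol_op\<close>; both replacements hold
  only almost everywhere, so the operators applied afterwards have to respect such
  equalities.\<close>

lemma kernel_projection_eq:
  assumes f: "f \<in> L2"
  shows "aeeq (G (P_plus (G f))) (symbol_op l (P_plus (symbol_op l f)))"
proof -
  have "aeeq (G (P_plus (G f))) (symbol_op l (P_plus (G f)))"
    by (intro kernel_op_unique[OF G] P_plus_L2 kernel_op_L2 f)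
  also have "aeeq \<dots> (symbol_op l (P_plus (symbol_op l f)))"
    by (intro symbol_op_aeeq P_plus_aeeq kernel_op_unique[OF G] P_plus_L2 kernel_op_L2 symbol_op_L2 f)
  finally show ?thesis .
qed

text \<open>With S the self-adjoint involution \<open>symbol_op l\<close> and P the indicator
  projection, Q = S P S is self-adjoint and Q Q = S P S S P S = S P S.\<close>

lemma kernel_projection_orth: "orth_proj (\<lambda>f. G (P_plus (G f)))"
  unfolding orth_proj_def
proof (intro conjI ballI)
  let ?S = "symbol_op l"
  show Q: "G (P_plus (G f)) \<in> L2" if "f \<in> L2" for f using that by (intro kernel_op_L2 P_plus_L2)
  fix f assume f: "f \<in> L2"
  let ?h = "P_plus (?S f)"
  have h: "?h \<in> L2" by (intro P_plus_L2 symbol_op_L2 f)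
  have "aeeq (G (P_plus (G (G (P_plus (G f)))))) (?S (P_plus (?S (G (P_plus (G f))))))"
    by (rule kernel_projection_eq[OF Q[OF f]])
  also have "aeeq \<dots> (?S (P_plus (?S (?S ?h))))"
    by (intro symbol_op_aeeq P_plus_aeeq P_plus_L2 symbol_op_L2 Q f h kernel_projection_eq)
  also have "aeeq \<dots> (?S (P_plus ?h))"
    by (intro symbol_op_aeeq P_plus_aeeq P_plus_L2 symbol_op_L2 h symbol_op_involution)
  also have "\<dots> = ?S ?h" by (simp add: P_plus_idem)
  also have "aeeq \<dots> (G (P_plus (G f)))" by (rule aeeq_sym[OF kernel_projection_eq[OF f]])
  finally show "aeeq (G (P_plus (G (G (P_plus (G f)))))) (G (P_plus (G f)))" .
  fix g assume g: "g \<in> L2"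
  have "l2_inner (G (P_plus (G f))) g = l2_inner (?S (P_plus (?S f))) g"
    by (intro l2_inner_aeeq kernel_projection_eq aeeq_refl Q P_plus_L2 symbol_op_L2 f g)
  also have "\<dots> = l2_inner (?S f) (P_plus (?S g))"
    by (simp add: symbol_op_selfadjoint P_plus_L2 symbol_op_L2 f g P_plus_selfadjoint)
  also have "\<dots> = l2_inner f (?S (P_plus (?S g)))"
    by (simp add: symbol_op_selfadjoint P_plus_L2 symbol_op_L2 f g)
  also have "\<dots> = l2_inner f (G (P_plus (G g)))"
    by (intro l2_inner_aeeq aeeq_sym[OF kernel_projection_eq] aeeq_refl Q P_plus_L2 symbol_op_L2 f g)
  finally show "l2_inner (G (P_plus (G f))) g = l2_inner f (G (P_plus (G g)))" .
qed

text \<open>Since S is onto, the range of S P S consists of the S \<phi> with \<phi> supported on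
  the positive half-line. The transform of S \<phi> is the symbol times the transform of the
  reflection of \<phi>, and reflections of such \<phi> are the functions whose transforms form
  \<open>H2\<close>.\<close>

lemma kernel_projection_range:
  "(\<exists>f\<in>L2. aeeq h (fourier (G (P_plus (G (fourier_inv f)))))) \<longleftrightarrow>
   (\<exists>f\<in>H2. aeeq h (\<lambda>x. exp (\<i> * of_real (l * x)) * u_nu \<nu> (of_real x) * f x))"
proof
  let ?S = "symbol_op l"
  assume "\<exists>f\<in>L2. aeeq h (fourier (G (P_plus (G (fourier_inv f)))))"
  then obtain f where f: "f \<in> L2" and hf: "aeeq h (fourier (G (P_plus (G (fourier_inv f)))))" by blast
  define \<phi> where "\<phi> = P_plus (?S (fourier_inv f))"
  have \<phi>: "\<phi> \<in> L2" unfolding \<phi>_def by (intro P_plus_L2 symbol_op_L2 fourier_inv_L2 f)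
  note hf
  also have "aeeq (fourier (G (P_plus (G (fourier_inv f))))) (fourier (?S \<phi>))"
    unfolding \<phi>_def by (intro fourier_aeeq kernel_projection_eq kernel_op_L2 P_plus_L2 symbol_op_L2 fourier_inv_L2 f)
  also have "aeeq \<dots> (\<lambda>x. symbol l x * fourier \<phi> (- x))" by (rule fourier_symbol_op[OF \<phi>])
  finally have "aeeq h (\<lambda>x. exp (\<i> * of_real (l * x)) * u_nu \<nu> (of_real x) * fourier \<phi> (- x))"
    by (simp add: symbol_def)
  moreover have "(\<lambda>x. fourier \<phi> (- x)) \<in> H2"
  proof (rule fourier_half_line_in_H2[OF L2_reflect[OF \<phi>]])
    show "AE \<xi> in lborel. \<xi> > 0 \<longrightarrow> \<phi> (- \<xi>) = 0" by (simp add: \<phi>_def P_plus_def)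
    show "(\<lambda>x. fourier \<phi> (- x)) \<in> L2" by (intro L2_reflect fourier_L2 \<phi>)
    show "aeeq (\<lambda>x. fourier \<phi> (- x)) (fourier (\<lambda>x. \<phi> (- x)))" by (rule aeeq_sym[OF fourier_reflect[OF \<phi>]])
  qed
  ultimately show "\<exists>f\<in>H2. aeeq h (\<lambda>x. exp (\<i> * of_real (l * x)) * u_nu \<nu> (of_real x) * f x)"
    by (rule bexI[where x = "\<lambda>x. fourier \<phi> (- x)"])
next
  let ?S = "symbol_op l"
  assume "\<exists>f\<in>H2. aeeq h (\<lambda>x. exp (\<i> * of_real (l * x)) * u_nu \<nu> (of_real x) * f x)"
  then obtain f where f: "f \<in> H2" and hf: "aeeq h (\<lambda>x. symbol l x * f x)"
    by (auto simp: symbol_def)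
  have fL2: "f \<in> L2" using f by (rule H2_L2)
  define \<phi> where "\<phi> \<xi> = fourier_inv f (- \<xi>)" for \<xi>
  have \<phi>: "\<phi> \<in> L2" unfolding \<phi>_def by (intro L2_reflect fourier_inv_L2 fL2)
  have P\<phi>: "aeeq (P_plus \<phi>) \<phi>"
    using AE_reflect[OF H2_iff_fourier_inv_support[THEN iffD1, OF f, THEN conjunct2]] AE_lborel_singleton[of 0]
    unfolding aeeq_def by eventually_elim (auto simp: P_plus_def \<phi>_def indicator_def)
  \<comment> \<open>S is its own inverse, so applying it to the inverse transform of g returns
    \<phi>, which P leaves unchanged.\<close>
  define g where "g = fourier (?S \<phi>)"
  have g: "g \<in> L2" unfolding g_def by (intro fourier_L2 symbol_op_L2 \<phi>)
  have "aeeq (?S (fourier_inv g)) (?S (?S \<phi>))"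
    unfolding g_def by (intro symbol_op_aeeq fourier_inv_fourier fourier_inv_L2 fourier_L2 symbol_op_L2 \<phi>)
  also have "aeeq \<dots> \<phi>" by (rule symbol_op_involution[OF \<phi>])
  finally have Sg: "aeeq (?S (fourier_inv g)) \<phi>" .
  have "aeeq (G (P_plus (G (fourier_inv g)))) (?S (P_plus (?S (fourier_inv g))))"
    by (intro kernel_projection_eq fourier_inv_L2 g)
  also have "aeeq \<dots> (?S \<phi>)"
    by (intro symbol_op_aeeq aeeq_trans[OF P_plus_aeeq[OF Sg] P\<phi>] P_plus_L2 symbol_op_L2 fourier_inv_L2 g \<phi>)
  finally have "aeeq (fourier (G (P_plus (G (fourier_inv g))))) (fourier (?S \<phi>))"
    by (intro fourier_aeeq kernel_op_L2 P_plus_L2 symbol_op_L2 fourier_inv_L2 g \<phi>)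
  also have "aeeq \<dots> (\<lambda>x. symbol l x * fourier \<phi> (- x))" by (rule fourier_symbol_op[OF \<phi>])
  also have "aeeq \<dots> (\<lambda>x. symbol l x * f x)"
    using aeeq_reflect[OF fourier_reflect[OF fourier_inv_L2[OF fL2]]] fourier_fourier_inv[OF fL2]
    unfolding aeeq_def \<phi>_def[abs_def] by eventually_elim simp
  finally show "\<exists>f\<in>L2. aeeq h (fourier (G (P_plus (G (fourier_inv f)))))"
    using aeeq_trans[OF hf aeeq_sym] g by blast
qed

end

text \<open>For f in K the function conj(u) f already lies in the conjugate Hardy space, so both
  projections act as the identity and only a unimodular multiplication remains.\<close>

lemma hankel_isometry:
  assumes f: "f \<in> H2" and g: "g \<in> H2_conj" and fg: "aeeq f (\<lambda>x. u_nu \<nu> (of_real x) * g x)"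
  shows "l2_norm (R_minus (\<lambda>x. cnj (u_nu \<nu> (of_real x)) * R_plus f x)) = l2_norm f"
proof -
  let ?u = "\<lambda>x::real. u_nu \<nu> (of_real x)"
  have u: "?u \<in> borel_measurable borel" by (rule borel_measurable_continuous_onI[OF u_nu_continuous])
  note R = R_plus_aeeq[OF f]
  let ?F = "\<lambda>x. cnj (?u x) * R_plus f x"
  have F: "?F \<in> L2"
    using u by (intro L2_mult_bounded[OF _ H2_L2[OF R(1)], where C = 1]) (auto simp: norm_u_nu)
  have Fg: "aeeq ?F g"
    using R(2) fg unfolding aeeq_def
  proof eventually_elim
    case (elim x)
    have "cnj (?u x) * R_plus f x = (?u x * cnj (?u x)) * g x" using elim by (simp add: mult_ac)
    also have "?u x * cnj (?u x) = 1" unfolding complex_norm_square[symmetric] by (simp add: norm_u_nu)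
    finally show ?case by simp
  qed
  note M = R_minus_aeeq[OF F g Fg]
  have "l2_norm (R_minus ?F) = l2_norm ?F"
    using M(2) by (rule l2_norm_aeeq) (intro L2_measurable H2_conj_L2 M F)+
  also have "\<dots> = l2_norm (R_plus f)" by (simp add: l2_norm_def norm_mult norm_u_nu)
  also have "\<dots> = l2_norm f" using R(2) by (rule l2_norm_aeeq) (intro L2_measurable H2_L2 R f)+
  finally show ?thesis .
qed

lemma hankel_kernel_nonzero:
  assumes "\<nu> > 0"
  shows "\<exists>f\<in>H2. (\<exists>g\<in>H2_conj. aeeq f (\<lambda>x. u_nu \<nu> (of_real x) * g x)) \<and> \<not> aeeq f (\<lambda>x. 0)"
proof (intro bexI conjI)
  let ?f = "fourier_int (sonine_fun \<nu>)" and ?u = "\<lambda>x::real. u_nu \<nu> (of_real x)"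
  show "?f \<in> H2" by (rule sonine_transform_in_H2[OF assms])
  show "\<not> aeeq ?f (\<lambda>x. 0)" by (rule sonine_transform_nonzero[OF assms])
  have "?u x * (cnj (?u x) * ?f x) = ?f x" for x
    unfolding mult.assoc[symmetric] complex_norm_square[symmetric] by (simp add: norm_u_nu)
  then show "aeeq ?f (\<lambda>x. ?u x * (cnj (?u x) * ?f x))" by (simp only: aeeq_refl)
  \<comment> \<open>With F the transform of \<open>sonine_fun\<close>, the conjugate of conj(u) F is
    u conj F, which the symmetry turns into 2^{ix} F, an element of \<open>H2\<close>.\<close>
  have "(\<lambda>x. cnj (cnj (?u x) * ?f x)) = (\<lambda>x. exp (\<i> * of_real (ln 2 * x)) * ?f x)"
    using sonine_fourier_symmetry[OF assms] by (simp add: fun_eq_iff)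
  then show "(\<lambda>x. cnj (?u x) * ?f x) \<in> H2_conj"
    unfolding H2_conj_def using sonine_transform_in_H2(2)[OF assms] by simp
qed

end

theorem theorem4p2:
  fixes \<nu> :: real
  assumes "\<nu> > - 1 / 2"
  shows
    \<comment> \<open>G_l exists as a bounded operator on L^2 with the given kernel\<close>
    "(\<forall>l. \<exists>G. kernel_op (G_kernel \<nu> l) G) \<and>
     \<comment> \<open>(i) and (ii): Q_l = G_l P_+ G_l\<close>
     (\<forall>l G. kernel_op (G_kernel \<nu> l) G \<longrightarrow>
        orth_proj (\<lambda>f. G (P_plus (G f))) \<and>
        (\<forall>h. (\<exists>f\<in>L2. aeeq h (fourier (G (P_plus (G (fourier_inv f)))))) \<longleftrightarrow>
             (\<exists>f\<in>H2. aeeq h (\<lambda>x. exp (\<i> * of_real (l * x)) * u_nu \<nu> (of_real x) * f x)))) \<and>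
     \<comment> \<open>properties of u_nu\<close>
     u_nu \<nu> meromorphic_on UNIV \<and>
     u_nu \<nu> holomorphic_on {z. Im z < 0} \<and>
     (\<forall>x::real. cmod (u_nu \<nu> (of_real x)) = 1) \<and>
     continuous_on UNIV (\<lambda>x::real. u_nu \<nu> (of_real x)) \<and>
     \<comment> \<open>(iii)\<close>
     (\<forall>f\<in>H2. (\<exists>g\<in>H2. aeeq f (\<lambda>x. u_nu_star \<nu> (of_real x) * g x)) \<longrightarrow> aeeq f (\<lambda>x. 0)) \<and>
     (\<nu> > 0 \<longrightarrow>
        (let K = {f\<in>H2. \<exists>g\<in>H2_conj. aeeq f (\<lambda>x. u_nu \<nu> (of_real x) * g x)} in
          (\<exists>f\<in>K. \<not> aeeq f (\<lambda>x. 0)) \<and>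
          (\<forall>f\<in>K. l2_norm (R_minus (\<lambda>x. cnj (u_nu \<nu> (of_real x)) * R_plus f x)) = l2_norm f)))"
proof -
  interpret bessel_order \<nu> by unfold_locales fact
  have nonzero: "\<nu> > 0 \<Longrightarrow> \<exists>f\<in>{f\<in>H2. \<exists>g\<in>H2_conj. aeeq f (\<lambda>x. u_nu \<nu> (of_real x) * g x)}. \<not> aeeq f (\<lambda>x. 0)"
    using hankel_kernel_nonzero by blast
  show ?thesis
    unfolding Let_def
    by (intro conjI allI impI ballI kernel_projection_orth kernel_projection_range u_nu_meromorphic u_nu_holomorphic
        norm_u_nu u_nu_continuous nonzero)
      (use kernel_op_symbol_op in \<open>auto intro: H2_star_intersection hankel_isometry\<close>)
qed

end
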